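(* Let $M$ be a smooth Riemannian manifold, $\sigma>0$, $V:M\to\mathbb{R}$ a $\mathcal{C}^2$ potential function, $S\subset M$ a regular submanifold (the obstacle boundary), $x_0,\dots,x_N\in M$ distinct points not lying on $S$, $0=T_0<T_1<\dots<T_N=T$, $v_0\in T_{x_0}M$, $v_N\in T_{x_N}M$. Let $\mathcal{D}$ be a nonintegrable distribution of constant rank on $M$ whose annihilator is spanned by linearly independent one-forms $\omega_1,\dots,\omega_k$ ($k<\dim M$), let $Y_1,\dots,Y_k$ be the vector fields with $\omega_j(Z)=\langle Y_j,Z\rangle$ for every vector field $Z$, and let $S_j$ be the tensors defined by $d\omega_j(u,z)=\langle (S_j)_x(u),z\rangle$ for $u,z\in T_xM$. Consider the problem of minimizing $$J(x)=\int_0^T\frac12\left(\Big\|\frac{D^2x}{dt^2}(t)\Big\|^2+\sigma\Big\|\frac{dx}{dt}(t)\Big\|^2+V(x(t))\right)dt$$ over the curves $x$ in the admissible set $\overline{\Omega}$ satisfying the constraints $\langle Y_j,\frac{dx}{dt}\rangle=0$, $j=1,\dots,k$. If $x\in\overline{\Omega}$ is a normal extremum for this problem, then $x$ is $\mathcal{C}^2$ and there exist smooth functions $\lambda_1,\dots,\lambda_k$ such that on each interval $[T_{i-1},T_i]$, $i=1,\dots,N$, $$0=\frac{D^4x}{dt^4}+R\left(\frac{D^2x}{dt^2},\frac{dx}{dt}\right)\frac{dx}{dt}-\sigma\frac{D^2x}{dt^2}+\frac12\,\mathrm{grad}\,V(x)-\sum_{j=1}^k\lambda_j'Y_j-\sum_{j=1}^k\lambda_jS_j\left(\frac{dx}{dt}\right),$$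 together with $\langle Y_j,\frac{dx}{dt}\rangle=0$, $j=1,\dots,k$.
   Context: $\langle\cdot,\cdot\rangle$ is the metric, $\nabla$ the Levi-Civita connection, $R(X,Y)Z=\nabla_X\nabla_YZ-\nabla_Y\nabla_XZ-\nabla_{[X,Y]}Z$ the curvature tensor; $d\omega(X,Y)=X\omega(Y)-Y\omega(X)-\omega([X,Y])$. For a curve $x$, $\frac{D^{s+1}x}{dt^{s+1}}$ denotes the $s$-th covariant derivative along $x$ of $\frac{dx}{dt}$. $V$ is the artificial potential used to repel curves from the obstacle bounded by $S$. Admissible set $\overline{\Omega}$: all $\mathcal{C}^1$ curves $x:[0,T]\to M$ that are smooth on each $[T_{i-1},T_i]$, $i=1,\dots,N$, and satisfy $x(T_i)=x_i$ for $i=1,\dots,N-1$, $x(0)=x_0$, $x(T)=x_N$, $\frac{dx}{dt}(0)=v_0$, $\frac{dx}{dt}(T)=v_N$. Admissible variation of $x\in\overline{\Omega}$: a $\mathcal{C}^1$ map $\alpha:(-\epsilon,\epsilon)\times[0,T]\to M$, $(r,t)\mapsto\alpha_r(t)$, smooth on each $(-\epsilon,\epsilon)\times[T_{i-1},T_i]$, with $\alpha_0=x$ and $\alpha_r\in\overline{\Omega}$ for every $r$. Normal extremum: a curve $x\in\overline{\Omega}$ satisfying the constraints $\langle Y_j,\frac{dx}{dt}\rangle=0$ for which there are smooth functions (Lagrange multipliers) $\lambda_1,\dots,\lambda_k$ on $[0,T]$ such that the extended functional $$\widetilde{J}(x)=\frac12\int_0^T\left(\Big\|\frac{D^2x}{dt^2}\Big\|^2+\sigma\Big\|\frac{dx}{dt}\Big\|^2+V(x)+\sum_{j=1}^k\lambda_j\Big\langle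 Y_j,\frac{dx}{dt}\Big\rangle\right)dt$$ satisfies $\frac{d}{dr}\widetilde{J}(\alpha_r)\big|_{r=0}=0$ for every admissible variation $\alpha$ of $x$. (The multipliers in the conclusion need not be normalized in the same way as those in this definition.) *)

theory Defs
  imports "HOL-Analysis.Analysis"
begin

section \<open>Differentiability classes in Euclidean spaces\<close>

text \<open>
  One definition serves open sets and the sets \<open>[a,b]\<close> and \<open>(-e,e) \<times> [a,b]\<close> (and their
  relatively open subsets); there derivatives within the set are unique and one-sided at the
  boundary.
\<close>

primrec Ck_on ::
  "nat \<Rightarrow> 'a::euclidean_space set \<Rightarrow> ('a \<Rightarrow> 'b::real_normed_vector) \<Rightarrow> bool" where
  "Ck_on 0 S f \<longleftrightarrow> continuous_on S f"
| "Ck_on (Suc n) S f \<longleftrightarrow>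
    (\<exists>f'. (\<forall>x\<in>S. (f has_derivative f' x) (at x within S)) \<and> (\<forall>v. Ck_on n S (\<lambda>x. f' x v)))"

definition smooth_on ::
  "'a::euclidean_space set \<Rightarrow> ('a \<Rightarrow> 'b::real_normed_vector) \<Rightarrow> bool" where
  "smooth_on S f \<longleftrightarrow> (\<forall>n. Ck_on n S f)"

section \<open>Smooth manifolds\<close>

text \<open>
  A manifold is a Hausdorff, second countable type \<open>'m\<close> with a smooth atlas modelled on the
  Euclidean space \<open>'e\<close>, of dimension \<open>DIM('e)\<close>. A chart is a pair of a domain and a coordinate
  map; the values of the latter outside the domain are irrelevant.
\<close>

type_synonym ('m, 'e) chart = "'m set \<times> ('m \<Rightarrow> 'e)"

abbreviation cdom :: "('m, 'e) chart \<Rightarrow> 'm set" where "cdom c \<equiv> fst c"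

abbreviation cmap :: "('m, 'e) chart \<Rightarrow> 'm \<Rightarrow> 'e" where "cmap c \<equiv> snd c"

definition cinv :: "('m, 'e) chart \<Rightarrow> 'e \<Rightarrow> 'm" where
  "cinv c = inv_into (cdom c) (cmap c)"

definition is_chart :: "('m::topological_space, 'e::euclidean_space) chart \<Rightarrow> bool" where
  "is_chart c \<longleftrightarrow> open (cdom c) \<and> open (cmap c ` cdom c) \<and>
     homeomorphism (cdom c) (cmap c ` cdom c) (cmap c) (cinv c)"

definition smooth_transition ::
  "('m, 'e::euclidean_space) chart \<Rightarrow> ('m, 'e) chart \<Rightarrow> bool" where
  "smooth_transition c d \<longleftrightarrow> smooth_on (cmap c ` (cdom c \<inter> cdom d)) (cmap d \<circ> cinv c)"

definition smooth_manifold ::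
  "('m::{t2_space,second_countable_topology}, 'e::euclidean_space) chart set \<Rightarrow> bool" where
  "smooth_manifold A \<longleftrightarrow> (\<Union>c\<in>A. cdom c) = UNIV \<and> (\<forall>c\<in>A. is_chart c) \<and>
     (\<forall>c\<in>A. \<forall>d\<in>A. smooth_transition c d)"

definition compatible_chart ::
  "('m::topological_space, 'e::euclidean_space) chart set \<Rightarrow> ('m, 'e) chart \<Rightarrow> bool" where
  "compatible_chart A c \<longleftrightarrow>
     is_chart c \<and> (\<forall>d\<in>A. smooth_transition c d \<and> smooth_transition d c)"

definition charts_at :: "('m, 'e) chart set \<Rightarrow> 'm \<Rightarrow> ('m, 'e) chart set" where
  "charts_at A p = {c\<in>A. p \<in> cdom c}"

text \<open>Maps from (an open subset \<open>U\<close> of) the manifold, and maps into the manifold.\<close>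

definition Ck_fun_on ::
  "('m, 'e::euclidean_space) chart set \<Rightarrow> nat \<Rightarrow> 'm set \<Rightarrow> ('m \<Rightarrow> 'b::real_normed_vector) \<Rightarrow> bool"
  where "Ck_fun_on A n U f \<longleftrightarrow> (\<forall>c\<in>A. Ck_on n (cmap c ` (U \<inter> cdom c)) (f \<circ> cinv c))"

definition smooth_fun_on ::
  "('m, 'e::euclidean_space) chart set \<Rightarrow> 'm set \<Rightarrow> ('m \<Rightarrow> 'b::real_normed_vector) \<Rightarrow> bool" where
  "smooth_fun_on A U f \<longleftrightarrow> (\<forall>n. Ck_fun_on A n U f)"

definition Ck_into ::
  "('m::topological_space, 'e::euclidean_space) chart set \<Rightarrow> nat \<Rightarrow> 'a::euclidean_space set \<Rightarrow>
     ('a \<Rightarrow> 'm) \<Rightarrow> bool" where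
  "Ck_into A n S f \<longleftrightarrow>
     continuous_on S f \<and> (\<forall>c\<in>A. Ck_on n (S \<inter> f -` cdom c) (cmap c \<circ> f))"

definition smooth_into ::
  "('m::topological_space, 'e::euclidean_space) chart set \<Rightarrow> 'a::euclidean_space set \<Rightarrow>
     ('a \<Rightarrow> 'm) \<Rightarrow> bool" where
  "smooth_into A S f \<longleftrightarrow> (\<forall>n. Ck_into A n S f)"

section \<open>Tangent vectors and vector fields\<close>

text \<open>
  A tangent vector at \<open>p\<close> is the family of its coordinate representations in the charts at \<open>p\<close>,
  which are related by the derivatives of the transition maps. For charts not at \<open>p\<close> the entry
  is \<open>0\<close>, so that equality of tangent vectors at \<open>p\<close> is equality of families.
\<close>

datatype ('m, 'e) tvec = TVec (coords: "('m, 'e) chart \<Rightarrow> 'e")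

instantiation tvec :: (type, real_vector) real_vector
begin

definition "0 = TVec (\<lambda>c. 0)"
definition "u + v = TVec (\<lambda>c. coords u c + coords v c)"
definition "- u = TVec (\<lambda>c. - coords u c)"
definition "u - v = TVec (\<lambda>c. coords u c - coords v c)"
definition "a *\<^sub>R u = TVec (\<lambda>c. a *\<^sub>R coords u c)"

instance
  by standard
    (auto simp: zero_tvec_def plus_tvec_def uminus_tvec_def minus_tvec_def scaleR_tvec_def
      scaleR_add_right scaleR_add_left tvec.expand)

end

definition tangent_space ::
  "('m, 'e::euclidean_space) chart set \<Rightarrow> 'm \<Rightarrow> ('m, 'e) tvec set" where
  "tangent_space A p = {v.
     (\<forall>c\<in>charts_at A p. \<forall>d\<in>charts_at A p.
        coords v d = frechet_derivative (cmap d \<circ> cinv c) (at (cmap c p)) (coords v c)) \<and>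
     (\<forall>c. c \<notin> charts_at A p \<longrightarrow> coords v c = 0)}"

type_synonym ('m, 'e) vfield = "'m \<Rightarrow> ('m, 'e) tvec"

definition smooth_vfield_on ::
  "('m, 'e::euclidean_space) chart set \<Rightarrow> 'm set \<Rightarrow> ('m, 'e) vfield \<Rightarrow> bool" where
  "smooth_vfield_on A U X \<longleftrightarrow> (\<forall>p\<in>U. X p \<in> tangent_space A p) \<and>
     (\<forall>c\<in>A. smooth_on (cmap c ` (U \<inter> cdom c)) (\<lambda>y. coords (X (cinv c y)) c))"

text \<open>
  The coordinate vector field of the chart \<open>c\<close> in direction \<open>b\<close>, a smooth field on \<open>cdom c\<close>.
\<close>

definition coord_vfield ::
  "('m, 'e::euclidean_space) chart set \<Rightarrow> ('m, 'e) chart \<Rightarrow> 'e \<Rightarrow> ('m, 'e) vfield" where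
  "coord_vfield A c b p = TVec (\<lambda>d. if c \<in> charts_at A p \<and> d \<in> charts_at A p
     then frechet_derivative (cmap d \<circ> cinv c) (at (cmap c p)) b else 0)"

text \<open>The derivative \<open>u f\<close> of a function in the direction of a tangent vector \<open>u\<close> at \<open>p\<close>; by
  the chain rule the choice of the chart is immaterial.\<close>

definition dir_deriv ::
  "('m, 'e::euclidean_space) chart set \<Rightarrow> 'm \<Rightarrow> ('m, 'e) tvec \<Rightarrow> ('m \<Rightarrow> real) \<Rightarrow> real" where
  "dir_deriv A p u f = (let c = (SOME c. c \<in> charts_at A p) in
     frechet_derivative (f \<circ> cinv c) (at (cmap c p)) (coords u c))"

definition lie_bracket ::
  "('m, 'e::euclidean_space) chart set \<Rightarrow> ('m, 'e) vfield \<Rightarrow> ('m, 'e) vfield \<Rightarrow> ('m, 'e) vfield"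
  where
  "lie_bracket A X Y p = TVec (\<lambda>c. if c \<in> charts_at A p then
       frechet_derivative (\<lambda>y. coords (Y (cinv c y)) c) (at (cmap c p)) (coords (X p) c)
     - frechet_derivative (\<lambda>y. coords (X (cinv c y)) c) (at (cmap c p)) (coords (Y p) c)
     else 0)"

definition one_form ::
  "('m::topological_space, 'e::euclidean_space) chart set \<Rightarrow> ('m \<Rightarrow> ('m, 'e) tvec \<Rightarrow> real) \<Rightarrow> bool"
  where
  "one_form A \<omega> \<longleftrightarrow>
     (\<forall>p a b. \<forall>u\<in>tangent_space A p. \<forall>v\<in>tangent_space A p.
        \<omega> p (a *\<^sub>R u + b *\<^sub>R v) = a * \<omega> p u + b * \<omega> p v) \<and>
     (\<forall>U X. open U \<longrightarrow> smooth_vfield_on A U X \<longrightarrow> smooth_fun_on A U (\<lambda>p. \<omega> p (X p)))"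

definition ext_deriv ::
  "('m, 'e::euclidean_space) chart set \<Rightarrow> ('m \<Rightarrow> ('m, 'e) tvec \<Rightarrow> real) \<Rightarrow>
     ('m, 'e) vfield \<Rightarrow> ('m, 'e) vfield \<Rightarrow> 'm \<Rightarrow> real" where
  "ext_deriv A \<omega> X Y p =
     dir_deriv A p (X p) (\<lambda>q. \<omega> q (Y q)) - dir_deriv A p (Y p) (\<lambda>q. \<omega> q (X q))
     - \<omega> p (lie_bracket A X Y p)"

section \<open>Riemannian metrics, the Levi-Civita connection and curvature\<close>

type_synonym ('m, 'e) metric = "'m \<Rightarrow> ('m, 'e) tvec \<Rightarrow> ('m, 'e) tvec \<Rightarrow> real"

definition riemannian_metric ::
  "('m::topological_space, 'e::euclidean_space) chart set \<Rightarrow> ('m, 'e) metric \<Rightarrow> bool" where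
  "riemannian_metric A g \<longleftrightarrow>
     (\<forall>p. \<forall>u\<in>tangent_space A p. \<forall>v\<in>tangent_space A p. g p u v = g p v u) \<and>
     (\<forall>p a b. \<forall>u\<in>tangent_space A p. \<forall>v\<in>tangent_space A p. \<forall>w\<in>tangent_space A p.
        g p (a *\<^sub>R u + b *\<^sub>R v) w = a * g p u w + b * g p v w) \<and>
     (\<forall>p. \<forall>u\<in>tangent_space A p. u \<noteq> 0 \<longrightarrow> 0 < g p u u) \<and>
     (\<forall>U X Y. open U \<longrightarrow> smooth_vfield_on A U X \<longrightarrow> smooth_vfield_on A U Y \<longrightarrow>
        smooth_fun_on A U (\<lambda>p. g p (X p) (Y p)))"

definition gradient ::
  "('m, 'e::euclidean_space) chart set \<Rightarrow> ('m, 'e) metric \<Rightarrow> ('m \<Rightarrow> real) \<Rightarrow> ('m, 'e) vfield" where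
  "gradient A g f p = (THE u. u \<in> tangent_space A p \<and>
     (\<forall>w\<in>tangent_space A p. g p u w = dir_deriv A p w f))"

text \<open>
  \<open>nabla p u Y\<close> is the covariant derivative at \<open>p\<close> of \<open>Y\<close> in the direction \<open>u\<close>. The connection
  acts on fields which are smooth on some open set, not just on global ones; as the domain
  varies over all open sets, \<open>nabla p u Y\<close> depends on the germ of \<open>Y\<close> at \<open>p\<close> only.
\<close>

type_synonym ('m, 'e) connection =
  "'m \<Rightarrow> ('m, 'e) tvec \<Rightarrow> ('m, 'e) vfield \<Rightarrow> ('m, 'e) tvec"

definition affine_connection ::
  "('m::topological_space, 'e::euclidean_space) chart set \<Rightarrow> ('m, 'e) connection \<Rightarrow> bool" where
  "affine_connection A nabla \<longleftrightarrow> (\<forall>U. open U \<longrightarrow>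
     (\<forall>X Y. smooth_vfield_on A U X \<longrightarrow> smooth_vfield_on A U Y \<longrightarrow>
        smooth_vfield_on A U (\<lambda>p. nabla p (X p) Y)) \<and>
     (\<forall>Y. smooth_vfield_on A U Y \<longrightarrow> (\<forall>p\<in>U. \<forall>u\<in>tangent_space A p. \<forall>v\<in>tangent_space A p. \<forall>a b.
        nabla p (a *\<^sub>R u + b *\<^sub>R v) Y = a *\<^sub>R nabla p u Y + b *\<^sub>R nabla p v Y)) \<and>
     (\<forall>Y Z. smooth_vfield_on A U Y \<longrightarrow> smooth_vfield_on A U Z \<longrightarrow>
        (\<forall>p\<in>U. \<forall>u\<in>tangent_space A p.
           nabla p u (\<lambda>q. Y q + Z q) = nabla p u Y + nabla p u Z)) \<and>
     (\<forall>f Y. smooth_fun_on A U f \<longrightarrow> smooth_vfield_on A U Y \<longrightarrow>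
        (\<forall>p\<in>U. \<forall>u\<in>tangent_space A p.
           nabla p u (\<lambda>q. f q *\<^sub>R Y q) = dir_deriv A p u f *\<^sub>R Y p + f p *\<^sub>R nabla p u Y)))"

definition levi_civita_connection ::
  "('m::topological_space, 'e::euclidean_space) chart set \<Rightarrow> ('m, 'e) metric \<Rightarrow>
     ('m, 'e) connection \<Rightarrow> bool" where
  "levi_civita_connection A g nabla \<longleftrightarrow> affine_connection A nabla \<and>
     (\<forall>U X Y. open U \<longrightarrow> smooth_vfield_on A U X \<longrightarrow> smooth_vfield_on A U Y \<longrightarrow>
        (\<forall>p\<in>U. nabla p (X p) Y - nabla p (Y p) X = lie_bracket A X Y p)) \<and>
     (\<forall>U X Y Z. open U \<longrightarrow> smooth_vfield_on A U X \<longrightarrow> smooth_vfield_on A U Y \<longrightarrow>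
        smooth_vfield_on A U Z \<longrightarrow>
        (\<forall>p\<in>U. dir_deriv A p (X p) (\<lambda>q. g q (Y q) (Z q))
           = g p (nabla p (X p) Y) (Z p) + g p (Y p) (nabla p (X p) Z)))"

text \<open>
  Every tangent vector at \<open>p\<close> is the value at \<open>p\<close> of a field which is smooth near \<open>p\<close>, so
  the tensors \<open>R\<close> and \<open>S\<close> below are uniquely determined on tangent vectors.
\<close>

definition curvature_tensor ::
  "('m::topological_space, 'e::euclidean_space) chart set \<Rightarrow> ('m, 'e) connection \<Rightarrow>
     ('m \<Rightarrow> ('m, 'e) tvec \<Rightarrow> ('m, 'e) tvec \<Rightarrow> ('m, 'e) tvec \<Rightarrow> ('m, 'e) tvec) \<Rightarrow> bool" where
  "curvature_tensor A nabla R \<longleftrightarrow>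
     (\<forall>U X Y Z. open U \<longrightarrow> smooth_vfield_on A U X \<longrightarrow> smooth_vfield_on A U Y \<longrightarrow>
        smooth_vfield_on A U Z \<longrightarrow>
        (\<forall>p\<in>U. R p (X p) (Y p) (Z p) =
             nabla p (X p) (\<lambda>q. nabla q (Y q) Z) - nabla p (Y p) (\<lambda>q. nabla q (X q) Z)
             - nabla p (lie_bracket A X Y p) Z))"

definition ext_deriv_tensor ::
  "('m::topological_space, 'e::euclidean_space) chart set \<Rightarrow> ('m, 'e) metric \<Rightarrow>
     ('m \<Rightarrow> ('m, 'e) tvec \<Rightarrow> real) \<Rightarrow> ('m \<Rightarrow> ('m, 'e) tvec \<Rightarrow> ('m, 'e) tvec) \<Rightarrow> bool" where
  "ext_deriv_tensor A g \<omega> S \<longleftrightarrow>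
     (\<forall>p. \<forall>u\<in>tangent_space A p. S p u \<in> tangent_space A p) \<and>
     (\<forall>U X Z. open U \<longrightarrow> smooth_vfield_on A U X \<longrightarrow> smooth_vfield_on A U Z \<longrightarrow>
        (\<forall>p\<in>U. ext_deriv A \<omega> X Z p = g p (S p (X p)) (Z p)))"

section \<open>Derivatives along curves\<close>

text \<open>
  The interval \<open>I\<close> determines on which side derivatives are taken at boundary points: a
  piecewise smooth curve has different one-sided higher derivatives at a breakpoint.
\<close>

definition velocity ::
  "('m, 'e::euclidean_space) chart set \<Rightarrow> real set \<Rightarrow> (real \<Rightarrow> 'm) \<Rightarrow> real \<Rightarrow> ('m, 'e) tvec" where
  "velocity A I x t = TVec (\<lambda>c. if c \<in> charts_at A (x t)
     then vector_derivative (cmap c \<circ> x) (at t within I) else 0)"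

text \<open>
  If \<open>W = (\<Sum>b. W\<^sub>b E\<^sub>b)\<close> is a field along \<open>x\<close>, expressed in the coordinate fields \<open>E\<^sub>b\<close> of a
  chart, its covariant derivative is \<open>(\<Sum>b. W\<^sub>b' E\<^sub>b + W\<^sub>b nabla\<^bsub>x'\<^esub> E\<^sub>b)\<close>.
\<close>

definition cov_deriv_along ::
  "('m, 'e::euclidean_space) chart set \<Rightarrow> ('m, 'e) connection \<Rightarrow> real set \<Rightarrow> (real \<Rightarrow> 'm) \<Rightarrow>
     (real \<Rightarrow> ('m, 'e) tvec) \<Rightarrow> real \<Rightarrow> ('m, 'e) tvec" where
  "cov_deriv_along A nabla I x W t = TVec (\<lambda>c. if c \<in> charts_at A (x t) then
       vector_derivative (\<lambda>s. coords (W s) c) (at t within I)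
     + (\<Sum>b\<in>Basis. (coords (W t) c \<bullet> b) *\<^sub>R
          coords (nabla (x t) (velocity A I x t) (coord_vfield A c b)) c)
     else 0)"

text \<open>\<open>curve_deriv A nabla I x n\<close> is \<open>D\<^sup>nx/dt\<^sup>n\<close>, for \<open>n \<ge> 1\<close>.\<close>

definition curve_deriv ::
  "('m, 'e::euclidean_space) chart set \<Rightarrow> ('m, 'e) connection \<Rightarrow> real set \<Rightarrow> (real \<Rightarrow> 'm) \<Rightarrow>
     nat \<Rightarrow> real \<Rightarrow> ('m, 'e) tvec" where
  "curve_deriv A nabla I x n = (cov_deriv_along A nabla I x ^^ (n - 1)) (velocity A I x)"

section \<open>Submanifolds and distributions\<close>

definition regular_submanifold ::
  "('m::topological_space, 'e::euclidean_space) chart set \<Rightarrow> 'm set \<Rightarrow> bool" where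
  "regular_submanifold A P \<longleftrightarrow> (\<exists>d. \<forall>p\<in>P. \<exists>c W. compatible_chart A c \<and> p \<in> cdom c \<and>
     subspace W \<and> dim W = d \<and> cmap c ` (cdom c \<inter> P) = cmap c ` cdom c \<inter> W)"

definition submanifold_tangent_space ::
  "('m::topological_space, 'e::euclidean_space) chart set \<Rightarrow> 'm set \<Rightarrow> 'm \<Rightarrow> ('m, 'e) tvec set"
  where
  "submanifold_tangent_space A P p =
     {velocity A {-e<..<e} x 0 | e x.
        0 < e \<and> smooth_into A {-e<..<e} x \<and> x 0 = p \<and> x ` {-e<..<e} \<subseteq> P}"

definition distribution ::
  "('m::topological_space, 'e::euclidean_space) chart set \<Rightarrow> ('m \<Rightarrow> ('m, 'e) tvec set) \<Rightarrow> bool"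
  where
  "distribution A D \<longleftrightarrow> (\<exists>r.
     (\<forall>p. D p \<subseteq> tangent_space A p \<and> subspace (D p) \<and> dim (D p) = r) \<and>
     (\<forall>p. \<exists>U X. open U \<and> p \<in> U \<and> (\<forall>i<r. smooth_vfield_on A U (X i)) \<and>
        (\<forall>q\<in>U. D q = span ((\<lambda>i. X i q) ` {..<r}))))"

text \<open>
  An immersed integral manifold is locally embedded, so for the existence of integral
  manifolds through each point it is enough to consider embedded ones.
\<close>

definition integrable_distribution ::
  "('m::topological_space, 'e::euclidean_space) chart set \<Rightarrow> ('m \<Rightarrow> ('m, 'e) tvec set) \<Rightarrow> bool"
  where
  "integrable_distribution A D \<longleftrightarrow> (\<forall>p. \<exists>P. regular_submanifold A P \<and> p \<in> P \<and>
     (\<forall>q\<in>P. submanifold_tangent_space A P q = D q))"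

definition lin_indep_forms ::
  "('m, 'e::euclidean_space) chart set \<Rightarrow> nat \<Rightarrow> (nat \<Rightarrow> 'm \<Rightarrow> ('m, 'e) tvec \<Rightarrow> real) \<Rightarrow> bool"
  where
  "lin_indep_forms A k \<omega> \<longleftrightarrow> (\<forall>p a.
     (\<forall>u\<in>tangent_space A p. (\<Sum>j=1..k. a j * \<omega> j p u) = 0) \<longrightarrow> (\<forall>j\<in>{1..k}. a j = 0))"

definition annihilator_spanned_by ::
  "('m, 'e::euclidean_space) chart set \<Rightarrow> ('m \<Rightarrow> ('m, 'e) tvec set) \<Rightarrow> nat \<Rightarrow>
     (nat \<Rightarrow> 'm \<Rightarrow> ('m, 'e) tvec \<Rightarrow> real) \<Rightarrow> bool" where
  "annihilator_spanned_by A D k \<omega> \<longleftrightarrow> (\<forall>p \<eta>.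
     (\<forall>u\<in>tangent_space A p. \<forall>v\<in>tangent_space A p. \<forall>a b.
        \<eta> (a *\<^sub>R u + b *\<^sub>R v) = a * \<eta> u + b * \<eta> v) \<longrightarrow>
     ((\<forall>u\<in>D p. \<eta> u = 0) \<longleftrightarrow>
      (\<exists>a. \<forall>u\<in>tangent_space A p. \<eta> u = (\<Sum>j=1..k. a j * \<omega> j p u))))"

section \<open>The variational problem\<close>

text \<open>\<open>T 0 < \<dots> < T N\<close> are the interpolation times and \<open>xs 0, \<dots>, xs N\<close> the points.\<close>

definition admissible_curve ::
  "('m::topological_space, 'e::euclidean_space) chart set \<Rightarrow> nat \<Rightarrow> (nat \<Rightarrow> real) \<Rightarrow>
     (nat \<Rightarrow> 'm) \<Rightarrow> ('m, 'e) tvec \<Rightarrow> ('m, 'e) tvec \<Rightarrow> (real \<Rightarrow> 'm) \<Rightarrow> bool" where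
  "admissible_curve A N T xs v0 vN x \<longleftrightarrow>
     Ck_into A 1 {0..T N} x \<and> (\<forall>i\<in>{1..N}. smooth_into A {T (i - 1)..T i} x) \<and>
     (\<forall>i\<le>N. x (T i) = xs i) \<and>
     velocity A {0..T N} x 0 = v0 \<and> velocity A {0..T N} x (T N) = vN"

definition admissible_variation ::
  "('m::topological_space, 'e::euclidean_space) chart set \<Rightarrow> nat \<Rightarrow> (nat \<Rightarrow> real) \<Rightarrow>
     (nat \<Rightarrow> 'm) \<Rightarrow> ('m, 'e) tvec \<Rightarrow> ('m, 'e) tvec \<Rightarrow> (real \<Rightarrow> 'm) \<Rightarrow>
     real \<Rightarrow> (real \<Rightarrow> real \<Rightarrow> 'm) \<Rightarrow> bool" where
  "admissible_variation A N T xs v0 vN x e \<alpha> \<longleftrightarrow> 0 < e \<and>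
     Ck_into A 1 ({-e<..<e} \<times> {0..T N}) (\<lambda>(r, t). \<alpha> r t) \<and>
     (\<forall>i\<in>{1..N}. smooth_into A ({-e<..<e} \<times> {T (i - 1)..T i}) (\<lambda>(r, t). \<alpha> r t)) \<and>
     (\<forall>t\<in>{0..T N}. \<alpha> 0 t = x t) \<and>
     (\<forall>r\<in>{-e<..<e}. admissible_curve A N T xs v0 vN (\<alpha> r))"

text \<open>
  The acceleration is not defined at the breakpoints; as a null set they do not affect the
  integral.
\<close>

definition extended_functional ::
  "('m, 'e::euclidean_space) chart set \<Rightarrow> ('m, 'e) metric \<Rightarrow> ('m, 'e) connection \<Rightarrow>
     real \<Rightarrow> ('m \<Rightarrow> real) \<Rightarrow> nat \<Rightarrow> (nat \<Rightarrow> ('m, 'e) vfield) \<Rightarrow> real \<Rightarrow> (nat \<Rightarrow> real \<Rightarrow> real) \<Rightarrow>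
     (real \<Rightarrow> 'm) \<Rightarrow> real" where
  "extended_functional A g nabla \<sigma> V k Y \<tau> \<mu> x = 1 / 2 * integral {0..\<tau>} (\<lambda>t.
     let v = velocity A {0..\<tau>} x t; a = curve_deriv A nabla {0..\<tau>} x 2 t in
       g (x t) a a + \<sigma> * g (x t) v v + V (x t) + (\<Sum>j=1..k. \<mu> j t * g (x t) (Y j (x t)) v))"

definition satisfies_constraints ::
  "('m, 'e::euclidean_space) chart set \<Rightarrow> ('m, 'e) metric \<Rightarrow> nat \<Rightarrow> (nat \<Rightarrow> ('m, 'e) vfield) \<Rightarrow>
     real \<Rightarrow> (real \<Rightarrow> 'm) \<Rightarrow> bool" where
  "satisfies_constraints A g k Y \<tau> x \<longleftrightarrow>
     (\<forall>j\<in>{1..k}. \<forall>t\<in>{0..\<tau>}. g (x t) (Y j (x t)) (velocity A {0..\<tau>} x t) = 0)"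

definition normal_extremum ::
  "('m::topological_space, 'e::euclidean_space) chart set \<Rightarrow> ('m, 'e) metric \<Rightarrow>
     ('m, 'e) connection \<Rightarrow> real \<Rightarrow> ('m \<Rightarrow> real) \<Rightarrow> nat \<Rightarrow> (nat \<Rightarrow> ('m, 'e) vfield) \<Rightarrow>
     nat \<Rightarrow> (nat \<Rightarrow> real) \<Rightarrow> (nat \<Rightarrow> 'm) \<Rightarrow> ('m, 'e) tvec \<Rightarrow> ('m, 'e) tvec \<Rightarrow>
     (real \<Rightarrow> 'm) \<Rightarrow> bool" where
  "normal_extremum A g nabla \<sigma> V k Y N T xs v0 vN x \<longleftrightarrow>
     admissible_curve A N T xs v0 vN x \<and> satisfies_constraints A g k Y (T N) x \<and>
     (\<exists>\<mu>. (\<forall>j\<in>{1..k}. smooth_on {0..T N} (\<mu> j)) \<and>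
        (\<forall>e \<alpha>. admissible_variation A N T xs v0 vN x e \<alpha> \<longrightarrow>
           ((\<lambda>r. extended_functional A g nabla \<sigma> V k Y (T N) \<mu> (\<alpha> r))
              has_real_derivative 0) (at 0)))"

end

theory Submission
  imports Defs
begin

text \<open>
  The proof is the classical computation of a first variation, organised so that all analysis
  happens in one coordinate chart at a time.

  Suppose that \<open>\<alpha>\<close> is a variation of \<open>x\<close> with variation field \<open>W\<close>, let \<open>D\<close> be the covariant
  derivative along \<open>x\<close>, \<open>v = x'\<close> and \<open>a = Dv\<close>, and let \<open>\<mu>\<^sub>j\<close> be the multipliers of the extended
  functional. Exchanging the covariant derivatives in \<open>r\<close> and in \<open>t\<close> gives
  \<open>D\<^sub>r a = D\<^sup>2W + R(W, v)v\<close>, and \<open>\<partial>\<^sub>r(\<omega>\<^sub>j(v)) = d\<omega>\<^sub>j(W, v) + (\<omega>\<^sub>j(W))'\<close>. The symmetries of the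
  curvature move \<open>W\<close> to the free slot, \<open>\<langle>R(W, v)v, a\<rangle> = \<langle>R(a, v)v, W\<rangle>\<close>. Hence the \<open>r\<close>-derivative of
  the integrand at \<open>r = 0\<close> is, pointwise in \<open>t\<close>, the sum \<open>2 (B' + \<langle>EL, W\<rangle>)\<close> of an exact derivative
  and a pairing with \<open>W\<close>; here \<open>B = \<langle>a, DW\<rangle> - \<langle>Da, W\<rangle> + \<sigma> \<langle>v, W\<rangle> + \<Sum>\<^sub>j \<lambda>\<^sub>j \<langle>Y\<^sub>j, W\<rangle>\<close> with
  \<open>\<lambda>\<^sub>j = \<mu>\<^sub>j / 2\<close>, and \<open>EL\<close> is the right-hand side of the claimed equation (lemma
  \<open>lagrangian_variation\<close>).

  It is enough to use variations \<open>y + r \<phi> w\<close>, where \<open>y\<close> is \<open>x\<close> in a chart, \<open>w\<close> a constant vector and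
  \<open>\<phi>\<close> a smooth function with small support that vanishes at the interpolation times; these are
  admissible (\<open>Ck_into_vary\<close>, \<open>first_variation\<close>). If \<open>\<phi>\<close> is a bump inside a smooth piece, then \<open>B\<close>
  contributes nothing and the fundamental lemma gives \<open>EL = 0\<close> inside the piece, and by continuity
  up to its ends (\<open>euler_lagrange_piece\<close>). If \<open>\<phi>\<close> is \<open>t - T\<^sub>i\<close> times a bump around an interior
  breakpoint \<open>T\<^sub>i\<close>, then \<open>W\<close> vanishes at \<open>T\<^sub>i\<close> but \<open>DW = \<phi>'(T\<^sub>i) w\<close> does not, and the jump of \<open>B\<close> at
  \<open>T\<^sub>i\<close> is that of \<open>\<langle>a, w\<rangle>\<close> up to a positive factor. So \<open>a\<close> has no jump (\<open>acceleration_match\<close>), and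
  \<open>x\<close> is \<open>C\<^sup>2\<close> (\<open>C2_extremal\<close>).

  The remaining work connects the coordinate-free notions with coordinates: in a chart the metric
  and the connection become smooth families of bilinear maps \<open>G\<close> and \<open>\<Gamma>\<close> (\<open>coord_geometry_chart\<close>),
  and \<open>R\<close>, the gradient, \<open>S\<^sub>j\<close> and the iterated derivatives \<open>D\<^sup>nx/dt\<^sup>n\<close> get their usual coordinate
  expressions (\<open>curvature_chart\<close>, \<open>gradient_chart\<close>, \<open>ext_deriv_chart\<close>, \<open>curve_deriv_coords\<close>). Since
  all terms of the equation are tangent vectors, it suffices to check the equation in a single
  chart.
\<close>

section \<open>Calculus of \<open>C\<^sup>n\<close> maps on subsets of Euclidean spaces\<close>

lemma Ck_on_subset: "Ck_on n S f \<Longrightarrow> T \<subseteq> S \<Longrightarrow> Ck_on n T f"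
proof (induction n arbitrary: f)
  case 0
  then show ?case by (auto intro: continuous_on_subset)
next
  case (Suc n)
  then obtain f' where f': "\<forall>x\<in>S. (f has_derivative f' x) (at x within S)" "\<forall>v. Ck_on n S
      (\<lambda>x. f' x v)"
    by auto
  have "\<forall>x\<in>T. (f has_derivative f' x) (at x within T)"
    using f'(1) Suc.prems(2) by (blast intro: has_derivative_subset)
  moreover have "\<forall>v. Ck_on n T (\<lambda>x. f' x v)"
    using f'(2) Suc.IH Suc.prems(2) by blast
  ultimately show ?case by auto
qed

lemma Ck_on_cong:
  assumes "Ck_on n S f" and "\<And>x. x \<in> S \<Longrightarrow> g x = f x"
  shows "Ck_on n S g"
proof (cases n)
  case 0
  then show ?thesis using assms continuous_on_cong by (metis Ck_on.simps(1))
next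
  case (Suc m)
  then obtain f' where f': "\<forall>x\<in>S. (f has_derivative f' x) (at x within S)" "\<forall>v. Ck_on m S
      (\<lambda>x. f' x v)"
    using assms(1) by auto
  have "\<forall>x\<in>S. (g has_derivative f' x) (at x within S)"
    using f'(1) assms(2) by (blast intro: has_derivative_transform)
  then show ?thesis using f'(2) Suc by auto
qed

lemma Ck_on_SucD: "Ck_on (Suc n) S f \<Longrightarrow> Ck_on n S f"
proof (induction n arbitrary: f)
  case 0
  then show ?case
    by (auto simp: continuous_on_eq_continuous_within intro: has_derivative_continuous)
next
  case (Suc n)
  then obtain f' where f': "\<forall>x\<in>S. (f has_derivative f' x) (at x within S)" "\<forall>v. Ck_on (Suc n) S
      (\<lambda>x. f' x v)"
    unfolding Ck_on.simps by blast
  then have "\<forall>v. Ck_on n S (\<lambda>x. f' x v)" using Suc.IH by blast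
  then show ?case using f'(1) by auto
qed

lemma Ck_on_le: "Ck_on n S f \<Longrightarrow> m \<le> n \<Longrightarrow> Ck_on m S f"
  by (induction n) (metis Ck_on_SucD le_Suc_eq le_zero_eq)+

lemma Ck_on_imp_continuous_on: "Ck_on n S f \<Longrightarrow> continuous_on S f"
  using Ck_on_le[of n S f 0] by simp

lemma Ck_on_const: "Ck_on n S (\<lambda>x. c)"
proof (induction n arbitrary: c)
  case (Suc n)
  show ?case by (simp, rule exI[of _ "\<lambda>x h. 0"]) (use Suc in auto)
qed simp

lemma Ck_on_bounded_linear:
  assumes h: "bounded_linear h" and "Ck_on n S f"
  shows "Ck_on n S (\<lambda>x. h (f x))"
  using assms(2)
proof (induction n arbitrary: f)
  case 0
  then show ?case using bounded_linear.continuous_on[OF h] by simp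
next
  case (Suc n)
  then obtain f' where f': "\<forall>x\<in>S. (f has_derivative f' x) (at x within S)" "\<forall>v. Ck_on n S
      (\<lambda>x. f' x v)"
    by auto
  show ?case
    by (simp, rule exI[of _ "\<lambda>x v. h (f' x v)"])
      (use f' Suc.IH in \<open>auto intro: bounded_linear.has_derivative[OF h]\<close>)
qed

lemma Ck_on_id: "Ck_on n S (\<lambda>x. x)"
proof (cases n)
  case (Suc m)
  show ?thesis
    by (simp add: Suc, rule exI[of _ "\<lambda>x v. v"]) (auto simp: Ck_on_const)
qed simp

lemma Ck_on_linear: "bounded_linear h \<Longrightarrow> Ck_on n S h"
  using Ck_on_bounded_linear[OF _ Ck_on_id] .

lemma Ck_on_add: "Ck_on n S f \<Longrightarrow> Ck_on n S g \<Longrightarrow> Ck_on n S (\<lambda>x. f x + g x)"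
proof (induction n arbitrary: f g)
  case 0
  then show ?case by (simp add: continuous_on_add)
next
  case (Suc n)
  from Suc.prems obtain f' g' where
    f': "\<forall>x\<in>S. (f has_derivative f' x) (at x within S)" "\<forall>v. Ck_on n S (\<lambda>x. f' x v)" and
    g': "\<forall>x\<in>S. (g has_derivative g' x) (at x within S)" "\<forall>v. Ck_on n S (\<lambda>x. g' x v)"
    unfolding Ck_on.simps by blast
  show ?case
    by (simp, rule exI[of _ "\<lambda>x v. f' x v + g' x v"])
      (use f' g' Suc.IH in \<open>auto intro!: has_derivative_add\<close>)
qed

lemma Ck_on_minus: "Ck_on n S f \<Longrightarrow> Ck_on n S (\<lambda>x. - f x)"
  using Ck_on_bounded_linear[OF bounded_linear_minus[OF bounded_linear_ident]] .

lemma Ck_on_diff: "Ck_on n S f \<Longrightarrow> Ck_on n S g \<Longrightarrow> Ck_on n S (\<lambda>x. f x - g x)"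
  using Ck_on_add[OF _ Ck_on_minus, of n S f g] by simp

lemma Ck_on_sum: "(\<And>i. i \<in> F \<Longrightarrow> Ck_on n S (f i)) \<Longrightarrow> Ck_on n S (\<lambda>x. \<Sum>i\<in>F. f i x)"
  by (induction F rule: infinite_finite_induct) (auto simp: Ck_on_const intro: Ck_on_add)

lemma Ck_on_bilinear:
  assumes B: "bounded_bilinear B"
  shows "Ck_on n S f \<Longrightarrow> Ck_on n S g \<Longrightarrow> Ck_on n S (\<lambda>x. B (f x) (g x))"
proof (induction n arbitrary: f g)
  case 0
  then show ?case using bounded_bilinear.continuous_on[OF B] by auto
next
  case (Suc n)
  from Suc.prems obtain f' g' where
    f': "\<forall>x\<in>S. (f has_derivative f' x) (at x within S)" "\<forall>v. Ck_on n S (\<lambda>x. f' x v)" and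
    g': "\<forall>x\<in>S. (g has_derivative g' x) (at x within S)" "\<forall>v. Ck_on n S (\<lambda>x. g' x v)"
    unfolding Ck_on.simps by blast
  show ?case
    by (simp, rule exI[of _ "\<lambda>x v. B (f x) (g' x v) + B (f' x v) (g x)"])
      (use f' g' Suc.IH Suc.prems[THEN Ck_on_SucD]
        in \<open>auto intro!: Ck_on_add bounded_bilinear.FDERIV[OF B]\<close>)
qed

lemmas Ck_on_scaleR = Ck_on_bilinear[OF bounded_bilinear_scaleR]
  and Ck_on_mult = Ck_on_bilinear[OF bounded_bilinear_mult]
  and Ck_on_inner_left = Ck_on_bounded_linear[OF bounded_linear_inner_left]

lemmas Ck_on_intros = Ck_on_const Ck_on_id Ck_on_add Ck_on_minus Ck_on_diff Ck_on_sum Ck_on_scaleR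
  Ck_on_mult Ck_on_inner_left

lemma linear_basis_expansion:
  assumes "linear h"
  shows "h v = (\<Sum>b\<in>Basis. (v \<bullet> b) *\<^sub>R h (b::'a::euclidean_space))"
  by (subst euclidean_representation[of v, symmetric], unfold linear_sum[OF assms])
    (simp add: linear_cmul[OF assms])

text \<open>
  The chain rule gives \<open>g' (f x) (f' x v)\<close>, in which the varying vector \<open>f' x v\<close> stands in an
  argument of the derivative. Expanding it in the basis leaves only derivatives in fixed directions,
  to which the induction hypothesis applies.
\<close>

lemma Ck_on_compose:
  assumes "Ck_on n T g" and "Ck_on n S f" and "f ` S \<subseteq> T"
  shows "Ck_on n S (\<lambda>x. g (f x))"
  using assms
proof (induction n arbitrary: g)
  case 0
  then show ?case using continuous_on_compose2[of T g S f] by simp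
next
  case (Suc n)
  from Suc.prems(1,2) obtain f' g' where
    f': "\<forall>x\<in>S. (f has_derivative f' x) (at x within S)" "\<forall>v. Ck_on n S (\<lambda>x. f' x v)" and
    g': "\<forall>x\<in>T. (g has_derivative g' x) (at x within T)" "\<forall>v. Ck_on n T (\<lambda>x. g' x v)"
    unfolding Ck_on.simps by blast
  have D: "((\<lambda>x. g (f x)) has_derivative (\<lambda>v. g' (f x) (f' x v))) (at x within S)" if "x \<in> S" for x
  proof (rule has_derivative_in_compose[of f "f' x" x S g "g' (f x)"])
    show "(f has_derivative f' x) (at x within S)" using f'(1) that by blast
    have "f x \<in> T" using that \<open>f ` S \<subseteq> T\<close> by blast
    then show "(g has_derivative g' (f x)) (at (f x) within f ` S)"
      using g'(1) \<open>f ` S \<subseteq> T\<close> by (blast intro: has_derivative_subset)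
  qed
  have *: "g' (f x) (f' x v) = (\<Sum>b\<in>Basis. (f' x v \<bullet> b) *\<^sub>R g' (f x) b)" if "x \<in> S" for x v
    using g'(1) that \<open>f ` S \<subseteq> T\<close>
    by (intro linear_basis_expansion) (auto dest!: has_derivative_linear)
  have "Ck_on n S (\<lambda>x. \<Sum>b\<in>Basis. (f' x v \<bullet> b) *\<^sub>R g' (f x) b)" for v
    using f'(2) Suc.IH[OF g'(2)[rule_format] Ck_on_SucD[OF Suc.prems(2)] Suc.prems(3)]
    by (intro Ck_on_intros) blast+
  then have "Ck_on n S (\<lambda>x. g' (f x) (f' x v))" for v
    by (rule Ck_on_cong) (rule *)
  with D show ?case
    by (simp, intro exI[of _ "\<lambda>x v. g' (f x) (f' x v)"]) auto
qed

lemma continuous_on_locally: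
  fixes f :: "'a::t2_space \<Rightarrow> 'b::topological_space"
  assumes "\<And>z. z \<in> X \<Longrightarrow> \<exists>W. open W \<and> z \<in> W \<and> continuous_on (X \<inter> W) f"
  shows "continuous_on X f"
  unfolding continuous_on_eq_continuous_within
proof
  fix z assume z: "z \<in> X"
  then obtain W where W: "open W" "z \<in> W" "continuous_on (X \<inter> W) f" using assms by blast
  then have "continuous (at z within X \<inter> W) f"
    using z by (simp add: continuous_on_eq_continuous_within)
  moreover have "at z within (X \<inter> W) = at z within X"
    using W by (intro at_within_nhd[of _ W]) auto
  ultimately show "continuous (at z within X) f" by simp
qed

text \<open>
  In such a set every point can be approached along every coordinate axis, so derivatives within the
  set are unique. This makes differentiability classes local: derivatives chosen on the members of
  an open cover agree on the overlaps.
\<close>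

definition axis_accessible :: "'a::euclidean_space set \<Rightarrow> bool" where
  "axis_accessible S \<longleftrightarrow>
     (\<forall>x\<in>S. \<forall>i\<in>Basis. \<forall>e>0. \<exists>d. 0 < \<bar>d\<bar> \<and> \<bar>d\<bar> < e \<and> x + d *\<^sub>R i \<in> S)"

lemma axis_accessible_unique:
  assumes "axis_accessible S" "x \<in> S"
    and "(f has_derivative f') (at x within S)" "(f has_derivative f'') (at x within S)"
  shows "f' = f''"
  using assms unfolding axis_accessible_def by (intro frechet_derivative_unique_within) auto

lemma axis_accessible_open:
  assumes "axis_accessible S" "open W"
  shows "axis_accessible (S \<inter> W)"
  unfolding axis_accessible_def
proof (intro ballI allI impI)
  fix x i :: 'a and e :: real
  assume x: "x \<in> S \<inter> W" and i: "i \<in> Basis" and "0 < e"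
  obtain r where r: "r > 0" "ball x r \<subseteq> W" using assms(2) x openE by blast
  obtain d where d: "0 < \<bar>d\<bar>" "\<bar>d\<bar> < min e r" "x + d *\<^sub>R i \<in> S"
    using assms(1) x i \<open>0 < e\<close> r(1) unfolding axis_accessible_def by (metis IntD1 min_less_iff_conj)
  have "x + d *\<^sub>R i \<in> ball x r" using d i by (simp add: dist_norm)
  then show "\<exists>d. 0 < \<bar>d\<bar> \<and> \<bar>d\<bar> < e \<and> x + d *\<^sub>R i \<in> S \<inter> W" using d r by auto
qed

lemma axis_accessible_UNIV: "axis_accessible UNIV"
  unfolding axis_accessible_def
proof (intro ballI allI impI)
  fix x i :: 'a and e :: real assume "0 < e"
  then show "\<exists>d. 0 < \<bar>d\<bar> \<and> \<bar>d\<bar> < e \<and> x + d *\<^sub>R i \<in> UNIV" by (intro exI[of _ "e/2"]) auto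
qed

lemma axis_accessible_if_open: "open S \<Longrightarrow> axis_accessible S"
  using axis_accessible_open[OF axis_accessible_UNIV, of S] by simp

lemma axis_accessible_Icc: "a < b \<Longrightarrow> axis_accessible {a..b::real}"
  unfolding axis_accessible_def
proof (intro ballI allI impI)
  fix x i e :: real assume *: "a < b" "x \<in> {a..b}" "i \<in> Basis" "0 < e"
  show "\<exists>d. 0 < \<bar>d\<bar> \<and> \<bar>d\<bar> < e \<and> x + d *\<^sub>R i \<in> {a..b}"
  proof (cases "x < b")
    case True
    then show ?thesis using * by (intro exI[of _ "min (e/2) ((b
        - x)/2)"]) (auto simp: min_def field_simps)
  next
    case False
    then show ?thesis using * by (intro exI[of _ "- min (e/2) ((b
        - a)/2)"]) (auto simp: min_def field_simps)
  qed
qed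

lemma axis_accessible_Times:
  fixes S :: "'a::euclidean_space set" and T :: "'b::euclidean_space set"
  assumes "axis_accessible S" "axis_accessible T"
  shows "axis_accessible (S \<times> T)"
  unfolding axis_accessible_def
proof (intro ballI allI impI)
  fix x i :: "'a \<times> 'b" and e :: real
  assume x: "x \<in> S \<times> T" and i: "i \<in> Basis" and e: "0 < e"
  obtain s t where st: "x = (s, t)" "s \<in> S" "t \<in> T" using x by auto
  from i consider j where "i = (j, 0)" "j \<in> Basis" | j where "i = (0, j)" "j \<in> Basis"
    by (auto simp: Basis_prod_def)
  then show "\<exists>d. 0 < \<bar>d\<bar> \<and> \<bar>d\<bar> < e \<and> x + d *\<^sub>R i \<in> S \<times> T"
  proof cases
    case 1
    then obtain d where "0 < \<bar>d\<bar>" "\<bar>d\<bar> < e" "s + d *\<^sub>R j \<in> S"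
      using assms(1) st e unfolding axis_accessible_def by metis
    then show ?thesis using 1 st by (intro exI[of _ d]) auto
  next
    case 2
    then obtain d where "0 < \<bar>d\<bar>" "\<bar>d\<bar> < e" "t + d *\<^sub>R j \<in> T"
      using assms(2) st e unfolding axis_accessible_def by metis
    then show ?thesis using 2 st by (intro exI[of _ d]) auto
  qed
qed

lemma Ck_on_locally:
  assumes "axis_accessible S"
    and "\<And>x. x \<in> S \<Longrightarrow> \<exists>W. open W \<and> x \<in> W \<and> Ck_on n (S \<inter> W) f"
  shows "Ck_on n S f"
  using assms(2)
proof (induction n arbitrary: f)
  case 0
  then show ?case by (auto intro: continuous_on_locally)
next
  case (Suc n)
  have at: "at x within (S \<inter> W) = at x within S" if "open W" "x \<in> W" for x W
    using that by (intro at_within_nhd[of _ W]) auto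
  have "\<exists>f'. (f has_derivative f') (at x within S)" if x: "x \<in> S" for x
  proof -
    from Suc.prems[OF x] obtain W where W: "open W" "x \<in> W" "Ck_on (Suc n) (S \<inter> W) f" by blast
    then have "\<exists>f'. (f has_derivative f') (at x within S \<inter> W)" using x by auto
    then show ?thesis using at[OF W(1,2)] by simp
  qed
  then obtain f' where f': "\<And>x. x \<in> S \<Longrightarrow> (f has_derivative f' x) (at x within S)" by metis
  have "Ck_on n S (\<lambda>x. f' x v)" for v
  proof (rule Suc.IH)
    fix x assume x: "x \<in> S"
    from Suc.prems[OF x] obtain W where W: "open W" "x \<in> W" "Ck_on (Suc n) (S \<inter> W) f" by blast
    from W(3) obtain h where h: "\<forall>x\<in>S \<inter> W. (f has_derivative h x) (at x within S \<inter> W)"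
      "\<forall>v. Ck_on n (S \<inter> W) (\<lambda>x. h x v)" by auto
    have "h z = f' z" if z: "z \<in> S \<inter> W" for z
    proof (rule axis_accessible_unique[OF assms(1)])
      show "(f has_derivative h z) (at z within S)"
        using h(1)[rule_format, OF z] at[OF W(1), of z] z by simp
    qed (use z f' in auto)
    then have "Ck_on n (S \<inter> W) (\<lambda>x. f' x v)"
      by (intro Ck_on_cong[OF h(2)[rule_format, of v]]) auto
    then show "\<exists>W. open W \<and> x \<in> W \<and> Ck_on n (S \<inter> W) (\<lambda>x. f' x v)" using W by blast
  qed
  then show ?case using f' by auto
qed

lemma Ck_on_Suc_derivative:
  assumes "Ck_on (Suc n) S f" "axis_accessible S"
    and "\<And>x. x \<in> S \<Longrightarrow> (f has_derivative f' x) (at x within S)"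
  shows "Ck_on n S (\<lambda>x. f' x v)"
proof -
  from assms(1) obtain h where h: "\<forall>x\<in>S. (f has_derivative h x) (at x within S)"
      "\<forall>v. Ck_on n S (\<lambda>x. h x v)" by auto
  have "f' z = h z" if "z \<in> S" for z
    using that h(1) assms by (blast intro: axis_accessible_unique)
  then show ?thesis by (intro Ck_on_cong[OF h(2)[rule_format, of v]]) auto
qed

lemma Ck_on_Suc_frechet:
  assumes "Ck_on (Suc n) S f" "open S"
  shows "x \<in> S \<Longrightarrow> (f has_derivative frechet_derivative f (at x)) (at x)"
    and "Ck_on n S (\<lambda>x. frechet_derivative f (at x) v)"
proof -
  show *: "(f has_derivative frechet_derivative f (at x)) (at x)" if "x \<in> S" for x
    using assms that
    by (metis Ck_on.simps(2) at_within_open differentiableI frechet_derivative_works)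
  show "Ck_on n S (\<lambda>x. frechet_derivative f (at x) v)"
    by (rule Ck_on_Suc_derivative[OF assms(1) axis_accessible_if_open[OF assms(2)]])
      (use * assms(2) at_within_open in metis)
qed

lemma axis_accessible_not_bot:
  fixes S :: "real set"
  assumes "axis_accessible S" "t \<in> S"
  shows "at t within S \<noteq> bot"
proof -
  have "t islimpt S"
    unfolding islimpt_approachable
  proof (intro allI impI)
    fix e :: real assume "0 < e"
    then obtain d where "0 < \<bar>d\<bar>" "\<bar>d\<bar> < e" "t + d \<in> S"
      using assms unfolding axis_accessible_def by force
    then show "\<exists>x'\<in>S. x' \<noteq> t \<and> dist x' t < e"
      by (intro bexI[of _ "t + d"]) (auto simp: dist_real_def)
  qed
  then show ?thesis by (simp add: trivial_limit_within)
qed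

lemma Ck_on_real_derivative:
  fixes f :: "real \<Rightarrow> 'b::real_normed_vector"
  assumes "Ck_on (Suc n) S f" "axis_accessible S"
  shows "t \<in> S \<Longrightarrow> (f has_vector_derivative vector_derivative f (at t within S)) (at t within S)"
    and "Ck_on n S (\<lambda>t. vector_derivative f (at t within S))"
proof -
  show *: "(f has_vector_derivative vector_derivative f (at t within S)) (at t within S)"
    if "t \<in> S" for t
  proof -
    obtain f' where "\<forall>x\<in>S. (f has_derivative f' x) (at x within S)" using assms(1) by auto
    with that have "f differentiable (at t within S)" by (blast intro: differentiableI)
    then show ?thesis by (simp only: vector_derivative_works)
  qed
  show "Ck_on n S (\<lambda>t. vector_derivative f (at t within S))"
    using Ck_on_Suc_derivative[OF assms, of "\<lambda>t h. h *\<^sub>R vector_derivative f (at t within S)" 1,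
        OF *[unfolded has_vector_derivative_def]]
    by (simp only: scaleR_one)
qed

lemma Ck_on_real_SucI:
  fixes f :: "real \<Rightarrow> 'b::real_normed_vector"
  assumes "\<And>t. t \<in> S \<Longrightarrow> (f has_vector_derivative f' t) (at t within S)" "Ck_on n S f'"
  shows "Ck_on (Suc n) S f"
  unfolding Ck_on.simps
proof (intro exI[of _ "\<lambda>t h. h *\<^sub>R f' t"] conjI ballI allI)
  show "(f has_derivative (\<lambda>h. h *\<^sub>R f' t)) (at t within S)" if "t \<in> S" for t
    using assms(1)[OF that] unfolding has_vector_derivative_def .
  show "Ck_on n S (\<lambda>t. v *\<^sub>R f' t)" for v
    by (intro Ck_on_scaleR Ck_on_const assms(2))
qed

lemma smooth_onI: "(\<And>n. Ck_on n S f) \<Longrightarrow> smooth_on S f"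
  and smooth_onD: "smooth_on S f \<Longrightarrow> Ck_on n S f"
  by (auto simp: smooth_on_def)

lemma smooth_on_vector_derivative:
  fixes f :: "real \<Rightarrow> 'b::real_normed_vector"
  assumes "smooth_on I f" "axis_accessible I"
  shows "t \<in> I \<Longrightarrow> (f has_vector_derivative vector_derivative f (at t within I)) (at t within I)"
    and "smooth_on I (\<lambda>t. vector_derivative f (at t within I))"
  using Ck_on_real_derivative[OF smooth_onD[OF assms(1)] assms(2)] by (auto simp: smooth_on_def)

lemma vector_derivative_accessible:
  fixes f :: "real \<Rightarrow> 'b::real_normed_vector"
  assumes "(f has_vector_derivative f') (at t within I)" "axis_accessible I" "t \<in> I"
  shows "vector_derivative f (at t within I) = f'"
  using vector_derivative_within[OF axis_accessible_not_bot[OF assms(2,3)] assms(1)] .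

lemma has_vector_derivative_join:
  fixes f :: "real \<Rightarrow> 'b::real_normed_vector"
  assumes pm: "p < m" "m < q"
    and f1: "\<And>t. t \<in> {p..m} \<Longrightarrow> (f has_vector_derivative f1 t) (at t within {p..m})"
    and f2: "\<And>t. t \<in> {m..q} \<Longrightarrow> (f has_vector_derivative f2 t) (at t within {m..q})"
    and eq: "f1 m = f2 m" and t: "t \<in> {p..q}"
  shows "(f has_vector_derivative (if t \<le> m then f1 t else f2 t)) (at t within {p..q})"
proof -
  consider "t < m" | "t = m" | "t > m" by linarith
  then show ?thesis
  proof cases
    case 1
    have "at t within {p..q} = at t within {p..m}"
      using 1 pm by (intro at_within_nhd[of _ "{..<m}"]) auto
    then show ?thesis using 1 f1[of t] t by simp
  next
    case 3
    have "at t within {p..q} = at t within {m..q}"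
      using 3 pm by (intro at_within_nhd[of _ "{m<..}"]) auto
    then show ?thesis using 3 f2[of t] t by simp
  next
    case 2
    have "{p..q} = {p..m} \<union> {m..q}" using pm by auto
    then have at: "at m within {p..q} = sup (at m within {p..m}) (at m within {m..q})"
      using at_within_union by metis
    have "((\<lambda>y. (1 / norm (y - m)) *\<^sub>R (f y - (f m + (y - m) *\<^sub>R f1 m))) \<longlongrightarrow> 0) (at m within {p..q})"
      unfolding at using f1[of m] f2[of m] pm eq
      by (intro filterlim_sup) (simp_all add: has_vector_derivative_def has_derivative_within)
    then show ?thesis using 2
      by (simp add: has_vector_derivative_def has_derivative_within bounded_linear_scaleR_left)
  qed
qed

section \<open>Bilinear and linear maps depending on a point\<close>

lemma bilinear_basis_expansion:
  assumes "bilinear h"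
  shows "h u v = (\<Sum>a\<in>Basis. \<Sum>b\<in>Basis. ((u \<bullet> a) * (v \<bullet> b)) *\<^sub>R h (a::'a::euclidean_space)
      (b::'c::euclidean_space))"
proof -
  have 1: "linear (\<lambda>u. h u v)" "linear (h w)" for v w using assms by (auto simp: bilinear_def)
  have "h u v = (\<Sum>a\<in>Basis. (u \<bullet> a) *\<^sub>R h a v)"
    by (rule linear_basis_expansion[OF 1(1)])
  also have "\<dots> = (\<Sum>a\<in>Basis. (u \<bullet> a) *\<^sub>R (\<Sum>b\<in>Basis. (v \<bullet> b) *\<^sub>R h a b))"
    by (intro sum.cong refl arg_cong2[where f=scaleR] linear_basis_expansion[OF 1(2)])
  finally show ?thesis by (simp add: scaleR_sum_right)
qed

text \<open>
  Smoothness of a family of bilinear maps is only given for fixed arguments; expanding the arguments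
  in the basis allows them to vary.
\<close>

lemma Ck_on_bilinear_field:
  fixes B :: "'a::euclidean_space \<Rightarrow> 'b::euclidean_space \<Rightarrow> 'c::euclidean_space \<Rightarrow>
      'd::real_normed_vector"
  assumes "\<And>z. z \<in> U \<Longrightarrow> bilinear (B z)" "\<And>u v. Ck_on n U (\<lambda>z. B z u v)"
    and "Ck_on n S y" "Ck_on n S u" "Ck_on n S v" "y ` S \<subseteq> U"
  shows "Ck_on n S (\<lambda>s. B (y s) (u s) (v s))"
proof -
  have "Ck_on n S (\<lambda>s. \<Sum>a\<in>Basis. \<Sum>b\<in>Basis. ((u s \<bullet> a) * (v s \<bullet> b)) *\<^sub>R B (y s) a b)"
    using assms(4,5) Ck_on_compose[OF assms(2,3,6)] by (intro Ck_on_intros)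
  then show ?thesis
    by (rule Ck_on_cong) (use assms in \<open>auto intro!: bilinear_basis_expansion\<close>)
qed

lemma Ck_on_linear_field:
  fixes B :: "'a::euclidean_space \<Rightarrow> 'b::euclidean_space \<Rightarrow> 'd::real_normed_vector"
  assumes "\<And>z. z \<in> U \<Longrightarrow> linear (B z)" "\<And>u. Ck_on n U (\<lambda>z. B z u)"
    and "Ck_on n S y" "Ck_on n S u" "y ` S \<subseteq> U"
  shows "Ck_on n S (\<lambda>s. B (y s) (u s))"
proof -
  have "Ck_on n S (\<lambda>s. \<Sum>a\<in>Basis. (u s \<bullet> a) *\<^sub>R B (y s) a)"
    using assms(4) Ck_on_compose[OF assms(2,3,5)] by (intro Ck_on_intros)
  then show ?thesis
    by (rule Ck_on_cong) (use assms in \<open>auto intro!: linear_basis_expansion\<close>)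
qed

lemma linear_derivative:
  assumes U: "open U" "z \<in> U" and lin: "\<And>z. z \<in> U \<Longrightarrow> linear (B z)"
    and B': "\<And>u. ((\<lambda>z. B z u) has_derivative B' u) (at z)"
  shows "linear (\<lambda>u. B' u h)"
proof (rule linearI)
  have "B' (u + w) = (\<lambda>h. B' u h + B' w h)" for u w
    by (rule has_derivative_unique[OF B'])
      (rule has_derivative_transform_within_open[OF has_derivative_add[OF B' B'] U],
        simp add: linear_add[OF lin])
  then show "B' (u + w) h = B' u h + B' w h" for u w by simp
  have "B' (a *\<^sub>R u) = (\<lambda>h. a *\<^sub>R B' u h)" for a u
    by (rule has_derivative_unique[OF B'])
      (rule has_derivative_transform_within_open[OF has_derivative_scaleR_right[OF B'] U],
        simp add: linear_cmul[OF lin])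
  then show "B' (a *\<^sub>R u) h = a *\<^sub>R B' u h" for a u by simp
qed

lemma bilinear_derivative:
  assumes "open U" "z \<in> U" and "\<And>z. z \<in> U \<Longrightarrow> bilinear (B z)"
    and "\<And>u v. ((\<lambda>z. B z u v) has_derivative B' u v) (at z)"
  shows "bilinear (\<lambda>u v. B' u v h)"
  unfolding bilinear_def
proof (intro conjI allI)
  show "linear (\<lambda>v. B' u v h)" for u
    by (rule linear_derivative[OF assms(1,2), where B = "\<lambda>z. B z u"])
      (use assms(3,4) in \<open>auto simp: bilinear_def\<close>)
  show "linear (\<lambda>u. B' u v h)" for v
    by (rule linear_derivative[OF assms(1,2), where B = "\<lambda>z u. B z u v"])
      (use assms(3,4) in \<open>auto simp: bilinear_def\<close>)
qed

text \<open>
  The Leibniz rule for a bilinear map whose base point moves as well. In a basis it is the product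
  rule for real functions.
\<close>

lemma has_vector_derivative_bilinear_field:
  fixes B :: "'a::euclidean_space \<Rightarrow> 'b::euclidean_space \<Rightarrow> 'c::euclidean_space \<Rightarrow>
      'd::real_normed_vector"
  assumes U: "open U" "y t \<in> U" and bil: "\<And>z. z \<in> U \<Longrightarrow> bilinear (B z)"
    and B': "\<And>u v. ((\<lambda>z. B z u v) has_derivative B' u v) (at (y t))"
    and y: "(y has_vector_derivative y') (at t within I)"
    and u: "(u has_vector_derivative u') (at t within I)"
    and v: "(v has_vector_derivative v') (at t within I)"
    and t: "t \<in> I"
  shows "((\<lambda>s. B (y s) (u s) (v s)) has_vector_derivative
    B' (u t) (v t) y' + B (y t) u' (v t) + B (y t) (u t) v') (at t within I)"
proof -
  let ?S = "\<lambda>f. \<Sum>a\<in>Basis. \<Sum>b\<in>Basis. f a b :: 'd"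
  have 1: "((\<lambda>s. B (y s) a b) has_vector_derivative B' a b y') (at t within I)" for a b
    using has_derivative_compose[OF y[unfolded has_vector_derivative_def] B']
      linear_cmul[OF has_derivative_linear[OF B']] by (simp add: has_vector_derivative_def)
  have 2: "((\<lambda>s. (u s \<bullet> a) * (v s \<bullet> b)) has_real_derivative
      (u t \<bullet> a) * (v' \<bullet> b) + (u' \<bullet> a) * (v t \<bullet> b)) (at t within I)" for a b
    unfolding has_real_derivative_iff_has_vector_derivative
    by (intro has_vector_derivative_mult bounded_linear.has_vector_derivative[OF
        bounded_linear_inner_left] u v)
  have "((\<lambda>s. ?S (\<lambda>a b. ((u s \<bullet> a) * (v s \<bullet> b)) *\<^sub>R B (y s) a b)) has_vector_derivative
      ?S (\<lambda>a b. ((u t \<bullet> a) * (v t \<bullet> b)) *\<^sub>R B' a b y'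
        + ((u t \<bullet> a) * (v' \<bullet> b) + (u' \<bullet> a) * (v t \<bullet> b)) *\<^sub>R B (y t) a b)) (at t within I)"
    by (intro has_vector_derivative_sum has_vector_derivative_scaleR 1 2)
  also have "?S (\<lambda>a b. ((u t \<bullet> a) * (v t \<bullet> b)) *\<^sub>R B' a b y'
        + ((u t \<bullet> a) * (v' \<bullet> b) + (u' \<bullet> a) * (v t \<bullet> b)) *\<^sub>R B (y t) a b)
      = B' (u t) (v t) y' + B (y t) u' (v t) + B (y t) (u t) v'"
    using bilinear_basis_expansion[OF bilinear_derivative[OF U bil B',
        where h = y'], of "u t" "v t"]
    unfolding bilinear_basis_expansion[OF bil[OF U(2)], of u'
        "v t"] bilinear_basis_expansion[OF bil[OF U(2)], of "u t" v']
    by (simp add: sum.distrib algebra_simps)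
  finally have D: "((\<lambda>s. ?S (\<lambda>a b. ((u s \<bullet> a) * (v s \<bullet> b)) *\<^sub>R B (y s) a b)) has_vector_derivative
      B' (u t) (v t) y' + B (y t) u' (v t) + B (y t) (u t) v') (at t within I)" .
  have "eventually (\<lambda>s. y s \<in> U) (at t within I)"
    using U has_vector_derivative_continuous[OF y]
    by (auto simp: continuous_within intro: topological_tendstoD)
  then show ?thesis
    unfolding has_vector_derivative_def
    by (intro has_derivative_transform_eventually[OF D[unfolded has_vector_derivative_def] _ _ t])
      (use U(2) bilinear_basis_expansion[OF bil] in \<open>auto elim!: eventually_mono\<close>)
qed

lemma has_vector_derivative_linear_field:
  fixes B :: "'a::euclidean_space \<Rightarrow> 'b::euclidean_space \<Rightarrow> 'd::real_normed_vector"
  assumes U: "open U" "y t \<in> U" and lin: "\<And>z. z \<in> U \<Longrightarrow> linear (B z)"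
    and B': "\<And>u. ((\<lambda>z. B z u) has_derivative B' u) (at (y t))"
    and "(y has_vector_derivative y') (at t within I)"
    and "(u has_vector_derivative u') (at t within I)" and "t \<in> I"
  shows "((\<lambda>s. B (y s) (u s)) has_vector_derivative B' (u t) y' + B (y t) u') (at t within I)"
proof -
  have "bilinear (\<lambda>u r :: real. r *\<^sub>R B z u)" if "z \<in> U" for z
    using linear_compose_scale_right[OF lin[OF that]]
    by (auto simp: bilinear_def linear_iff scaleR_add_left)
  from has_vector_derivative_bilinear_field[OF U this has_derivative_scaleR_right[OF B']
      assms(5,6) has_vector_derivative_const[of 1] assms(7)]
  show ?thesis by simp
qed

section \<open>Symmetry of second derivatives\<close>

lemma has_real_derivative_along_line:
  fixes g :: "'a::real_normed_vector \<Rightarrow> real"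
  assumes "(g has_derivative g') (at (y + s *\<^sub>R u + c))"
  shows "((\<lambda>s. g (y + s *\<^sub>R u + c)) has_real_derivative g' u) (at s)"
proof -
  have "((\<lambda>s. y + s *\<^sub>R u + c) has_derivative (\<lambda>k. k *\<^sub>R u)) (at s)"
    by (auto intro!: derivative_eq_intros)
  from has_derivative_compose[OF this assms] show ?thesis
    using has_derivative_linear[OF assms]
    by (simp add: has_field_derivative_def linear_cmul mult_commute_abs)
qed

text \<open>
  The mean value theorem, applied in both variables, writes the second difference of \<open>f\<close> over a
  small parallelogram as a value of the mixed second derivative. The second difference does not
  depend on the order of the two sides.
\<close>

lemma second_difference_mean_value:
  fixes f :: "'a::euclidean_space \<Rightarrow> real"
  assumes U: "open U" and f: "Ck_on 2 U f" and h: "0 < h"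
    and in_U: "\<And>s t. s \<in> {0..h} \<Longrightarrow> t \<in> {0..h} \<Longrightarrow> y + s *\<^sub>R u + t *\<^sub>R v \<in> U"
  shows "\<exists>s\<in>{0..h}. \<exists>t\<in>{0..h}. f (y + h *\<^sub>R u + h *\<^sub>R v) - f (y + h *\<^sub>R u) - f (y + h *\<^sub>R v) + f y
    = h * h * frechet_derivative (\<lambda>z. frechet_derivative f (at z) u) (at (y + s *\<^sub>R u + t *\<^sub>R v)) v"
proof -
  let ?F = "\<lambda>z. frechet_derivative f (at z)"
  let ?D = "\<lambda>z. frechet_derivative (\<lambda>z. ?F z u) (at z)"
  have f': "Ck_on (Suc (Suc 0)) U f" using f by (simp add: numeral_2_eq_2)
  have d1: "((\<lambda>s. f (y + s *\<^sub>R u + c)) has_real_derivative ?F (y + s *\<^sub>R u + c) u) (at s)"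
    if "y + s *\<^sub>R u + c \<in> U" for s c
    by (rule has_real_derivative_along_line[OF Ck_on_Suc_frechet(1)[OF f' U that]])
  have d2: "((\<lambda>t. ?F (y + s *\<^sub>R u + t *\<^sub>R v) u) has_real_derivative ?D (y + s *\<^sub>R u
      + t *\<^sub>R v) v) (at t)"
    if "y + s *\<^sub>R u + t *\<^sub>R v \<in> U" for s t
    using has_real_derivative_along_line[of "\<lambda>z. ?F z u" _ "y + s *\<^sub>R u" t v 0]
      Ck_on_Suc_frechet(1)[OF Ck_on_Suc_frechet(2)[OF f' U] U that] by simp
  have "\<exists>s. 0 < s \<and> s < h \<and>
      (f (y + h *\<^sub>R u + h *\<^sub>R v) - f (y + h *\<^sub>R u + 0)) - (f (y + 0 *\<^sub>R u + h *\<^sub>R v) - f (y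
          + 0 *\<^sub>R u + 0))
      = (h - 0) * (?F (y + s *\<^sub>R u + h *\<^sub>R v) u - ?F (y + s *\<^sub>R u + 0) u)"
    using h in_U[of _ h] in_U[of _ 0]
        by (intro MVT2) (auto intro!: DERIV_diff d1 d1[where c=0, simplified])
  then obtain s where s: "0 < s" "s < h" and
    1: "f (y + h *\<^sub>R u + h *\<^sub>R v) - f (y + h *\<^sub>R u) - f (y + h *\<^sub>R v) + f y
      = h * (?F (y + s *\<^sub>R u + h *\<^sub>R v) u - ?F (y + s *\<^sub>R u) u)" by (auto simp: algebra_simps)
  have "\<exists>t. 0 < t \<and> t < h \<and> ?F (y + s *\<^sub>R u + h *\<^sub>R v) u - ?F (y + s *\<^sub>R u + 0 *\<^sub>R v) u
      = (h - 0) * ?D (y + s *\<^sub>R u + t *\<^sub>R v) v"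
    using h s in_U[of s] by (intro MVT2) (auto intro!: d2)
  then obtain t where "0 < t" "t < h" "?F (y + s *\<^sub>R u + h *\<^sub>R v) u - ?F (y + s *\<^sub>R u) u
      = h * ?D (y + s *\<^sub>R u + t *\<^sub>R v) v" by auto
  with s 1 show ?thesis by (intro bexI[of _ s] bexI[of _ t]) auto
qed

lemma second_derivative_symmetric:
  fixes f :: "'a::euclidean_space \<Rightarrow> real"
  assumes U: "open U" "y \<in> U" and f: "Ck_on 2 U f"
  shows "frechet_derivative (\<lambda>z. frechet_derivative f (at z) u) (at y) v
    = frechet_derivative (\<lambda>z. frechet_derivative f (at z) v) (at y) u"
proof (rule ccontr)
  let ?D = "\<lambda>u v z. frechet_derivative (\<lambda>z. frechet_derivative f (at z) u) (at z) v"
  have f': "Ck_on (Suc (Suc 0)) U f" using f by (simp add: numeral_2_eq_2)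
  assume neq: "?D u v y \<noteq> ?D v u y"
  define \<epsilon> where "\<epsilon> = \<bar>?D u v y - ?D v u y\<bar> / 2"
  have "\<epsilon> > 0" using neq by (simp add: \<epsilon>_def)
  have "continuous_on U (?D u v)" for u v
    using Ck_on_Suc_frechet(2)[OF Ck_on_Suc_frechet(2)[OF f' U(1)] U(1)] by simp
  then have "isCont (?D u v) y" for u v using U continuous_on_eq_continuous_at by blast
  then have near: "\<exists>d>0. \<forall>z. dist z y < d \<longrightarrow> dist (?D u v z) (?D u v y) < \<epsilon>" for u v
    using \<open>\<epsilon> > 0\<close> unfolding continuous_at_eps_delta by blast
  obtain d1 where d1: "d1 > 0" "\<And>z. dist z y < d1 \<Longrightarrow> dist (?D u v z) (?D u v y) < \<epsilon>"
    using near by blast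
  obtain d2 where d2: "d2 > 0" "\<And>z. dist z y < d2 \<Longrightarrow> dist (?D v u z) (?D v u y) < \<epsilon>"
    using near by blast
  obtain d3 where d3: "d3 > 0" "ball y d3 \<subseteq> U" using U openE by blast
  define d where "d = min d1 (min d2 d3)"
  define h where "h = d / (2 * (norm u + norm v + 1))"
  have "d > 0" using d1 d2 d3 by (simp add: d_def)
  then have "h > 0" by (simp add: h_def add_nonneg_pos)
  have close: "dist (y + s *\<^sub>R a + t *\<^sub>R b) y < d"
    if "s \<in> {0..h}" "t \<in> {0..h}" "norm a + norm b = norm u + norm v" for s t a b
  proof -
    have "norm (s *\<^sub>R a + t *\<^sub>R b) \<le> s * norm a + t * norm b"
      using norm_triangle_ineq[of "s *\<^sub>R a" "t *\<^sub>R b"] that by simp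
    also have "\<dots> \<le> h * norm a + h * norm b"
      using that by (intro add_mono mult_right_mono) auto
    also have "\<dots> = h * (norm u + norm v)" using that by (simp add: algebra_simps flip: that(3))
    also have "\<dots> < h * (2 * (norm u + norm v + 1))"
    proof (rule mult_strict_left_mono[OF _ \<open>h > 0\<close>])
      show "norm u + norm v < 2 * (norm u + norm v + 1)"
        using add_nonneg_nonneg[OF norm_ge_zero[of u] norm_ge_zero[of v]] unfolding distrib_left
            by linarith
    qed
    also have "\<dots> = d"
    proof -
      have "norm u + norm v + 1 > 0" using norm_ge_zero[of u] norm_ge_zero[of v] by linarith
      then show ?thesis unfolding h_def by simp
    qed
    finally show ?thesis by (simp add: dist_norm add.assoc)
  qed
  have in_U: "y + s *\<^sub>R a + t *\<^sub>R b \<in> U"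
      if "s \<in> {0..h}" "t \<in> {0..h}" "norm a + norm b = norm u + norm v" for s t a b
    using close[OF that] d3(2) by (auto simp: d_def dist_commute)
  obtain s t where st: "s \<in> {0..h}" "t \<in> {0..h}"
    "f (y + h *\<^sub>R u + h *\<^sub>R v) - f (y + h *\<^sub>R u) - f (y + h *\<^sub>R v) + f y = h * h * ?D u v (y
        + s *\<^sub>R u + t *\<^sub>R v)"
    using second_difference_mean_value[OF U(1) f \<open>h > 0\<close> in_U, of u v] by auto
  obtain s' t' where st': "s' \<in> {0..h}" "t' \<in> {0..h}"
    "f (y + h *\<^sub>R v + h *\<^sub>R u) - f (y + h *\<^sub>R v) - f (y + h *\<^sub>R u) + f y = h * h * ?D v u (y
        + s' *\<^sub>R v + t' *\<^sub>R u)"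
    using second_difference_mean_value[OF U(1) f \<open>h > 0\<close> in_U, of v u] by auto
  have "h * h * ?D u v (y + s *\<^sub>R u + t *\<^sub>R v) = h * h * ?D v u (y + s' *\<^sub>R v + t' *\<^sub>R u)"
  proof -
    show ?thesis unfolding st(3)[symmetric] st'(3)[symmetric] by (simp add: ac_simps)
  qed
  then have eq: "?D u v (y + s *\<^sub>R u + t *\<^sub>R v) = ?D v u (y + s' *\<^sub>R v + t' *\<^sub>R u)"
    using \<open>h > 0\<close> by simp
  have "dist (?D u v (y + s *\<^sub>R u + t *\<^sub>R v)) (?D u v y) < \<epsilon>"
    using close[OF st(1,2), of u v] by (intro d1) (simp add: d_def)
  moreover have "dist (?D v u (y + s' *\<^sub>R v + t' *\<^sub>R u)) (?D v u y) < \<epsilon>"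
    using close[OF st'(1,2), of v u] by (intro d2) (simp add: d_def)
  ultimately have "\<bar>?D u v y - ?D v u y\<bar> < 2 * \<epsilon>"
    using eq by (simp add: dist_real_def)
  then show False by (simp add: \<epsilon>_def)
qed

section \<open>Smooth bump functions and the fundamental lemma of the calculus of variations\<close>

text \<open>
  The functions \<open>(1/t)\<^sup>k exp (-1/t)\<close>, extended by \<open>0\<close>, are smooth because their derivatives are
  combinations of functions of the same kind.
\<close>

definition flat_exp :: "nat \<Rightarrow> real \<Rightarrow> real" where
  "flat_exp k t = (if t > 0 then (1 / t) ^ k * exp (- (1 / t)) else 0)"

lemma flat_exp_tendsto_0: "(flat_exp k \<longlongrightarrow> 0) (at 0)"
proof -
  have "((\<lambda>t. (inverse t) ^ k / exp (inverse t)) \<longlongrightarrow> (0::real)) (at_right 0)"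
    by (rule filterlim_compose[OF tendsto_power_div_exp_0 filterlim_inverse_at_top_right])
  moreover have "eventually (\<lambda>t. flat_exp k t = (inverse t) ^ k / exp (inverse t)) (at_right 0)"
    by (auto simp: eventually_at_filter flat_exp_def exp_minus field_simps)
  ultimately have "(flat_exp k \<longlongrightarrow> 0) (at_right 0)" by (simp add: tendsto_cong)
  moreover have "(flat_exp k \<longlongrightarrow> 0) (at_left 0)"
    by (rule tendsto_eventually) (auto simp: eventually_at_filter flat_exp_def)
  ultimately show ?thesis by (simp add: filterlim_at_split)
qed

lemma flat_exp_derivative:
  "(flat_exp k has_real_derivative flat_exp (k + 2) t - k * flat_exp (k + 1) t) (at t)"
proof -
  consider "t > 0" | "t < 0" | "t = 0" by linarith
  then show ?thesis
  proof cases
    case 1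
    have *: "((\<lambda>t. (1 / t) ^ k * exp (- (1 / t))) has_real_derivative
       (1 / t) ^ (k + 2) * exp (- (1 / t)) - k * ((1 / t) ^ (k + 1) * exp (- (1 / t)))) (at t)"
    proof (cases k)
      case 0
      show ?thesis unfolding 0 using 1
        by (auto intro!: derivative_eq_intros simp: power2_eq_square)
    next
      case (Suc j)
      have u: "((\<lambda>t. 1 / t) has_real_derivative - ((1 / t)\<^sup>2)) (at t)"
        using 1 by (auto intro!: derivative_eq_intros simp: power2_eq_square)
      have e: "((\<lambda>t. exp (- (1 / t))) has_real_derivative exp (- (1 / t)) * (1 / t)\<^sup>2) (at t)"
        using 1 by (auto intro!: derivative_eq_intros simp: power2_eq_square)
      show ?thesis unfolding Suc
        by (rule DERIV_cong[OF DERIV_mult[OF DERIV_power_Suc[OF u] e]])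
          (simp add: algebra_simps power2_eq_square)
    qed
    have "(flat_exp k has_real_derivative
       (1 / t) ^ (k + 2) * exp (- (1 / t)) - k * ((1 / t) ^ (k + 1) * exp (- (1 / t)))) (at t)"
      by (rule DERIV_cong_ev[THEN iffD1, OF refl _ refl *])
        (use 1 in \<open>auto simp: flat_exp_def intro: eventually_mono[OF eventually_nhds_in_open[of
            "{0<..}"]]\<close>)
    then show ?thesis using 1 by (simp add: flat_exp_def)
  next
    case 2
    have "(flat_exp k has_real_derivative 0) (at t)"
      by (rule DERIV_cong_ev[THEN iffD1, OF refl _ refl DERIV_const[of 0]])
        (use 2 in \<open>auto simp: flat_exp_def intro: eventually_mono[OF eventually_nhds_in_open[of
            "{..<0}"]]\<close>)
    then show ?thesis using 2 by (simp add: flat_exp_def)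
  next
    case 3
    have "(\<lambda>h. (flat_exp k (0 + h) - flat_exp k 0) / h) = flat_exp (Suc k)"
      by (auto simp: flat_exp_def)
    then have "(flat_exp k has_real_derivative 0) (at 0)"
      using flat_exp_tendsto_0[of "Suc k"] by (simp add: DERIV_def)
    then show ?thesis using 3 by (simp add: flat_exp_def)
  qed
qed

lemma Ck_on_flat_exp: "Ck_on n S (flat_exp k)"
proof (induction n arbitrary: k)
  case 0
  show ?case
    by (auto intro!: continuous_at_imp_continuous_on DERIV_isCont[OF flat_exp_derivative])
next
  case (Suc n)
  show ?case
  proof (rule Ck_on_real_SucI)
    show "(flat_exp k has_vector_derivative flat_exp (k + 2) t - k * flat_exp (k
        + 1) t) (at t within S)" for t
      using flat_exp_derivative[of k t] has_vector_derivative_at_within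
      by (auto simp: has_real_derivative_iff_has_vector_derivative)
    show "Ck_on n S (\<lambda>t. flat_exp (k + 2) t - k * flat_exp (k + 1) t)"
      using Suc by (intro Ck_on_intros) auto
  qed
qed

definition bump :: "real \<Rightarrow> real \<Rightarrow> real \<Rightarrow> real" where
  "bump p q t = flat_exp 0 (t - p) * flat_exp 0 (q - t)"

lemma bump_pos: "p < t \<Longrightarrow> t < q \<Longrightarrow> bump p q t > 0"
  and bump_zero: "t \<notin> {p<..<q} \<Longrightarrow> bump p q t = 0"
  by (auto simp: bump_def flat_exp_def)

lemma bump_nonneg: "bump p q t \<ge> 0"
  by (auto simp: bump_def flat_exp_def)

lemma Ck_on_bump: "Ck_on n S (bump p q)"
proof -
  have "Ck_on n S (\<lambda>t. t - p)" "Ck_on n S (\<lambda>t. q - t)"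
    by (intro Ck_on_diff Ck_on_const Ck_on_id)+
  from this[THEN Ck_on_compose[OF Ck_on_flat_exp, where T=UNIV]] show ?thesis
    unfolding bump_def by (intro Ck_on_mult) auto
qed

text \<open>
  Near a point where \<open>h\<close> does not vanish its sign is constant, and the integral against a bump
  supported there cannot be zero.
\<close>

lemma fundamental_lemma_of_variations:
  fixes h :: "real \<Rightarrow> real"
  assumes h: "continuous_on {a..b} h" and "a < b"
    and zero: "\<And>p q. a < p \<Longrightarrow> p < q \<Longrightarrow> q < b \<Longrightarrow> integral {a..b} (\<lambda>t. h t * bump p q t) = 0"
    and t: "t \<in> {a..b}"
  shows "h t = 0"
proof -
  have inner: "h t = 0" if t: "t \<in> {a<..<b}" for t
  proof (rule ccontr)
    assume "h t \<noteq> 0"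
    have "isCont h t" using h t by (simp add: continuous_on_interior)
    then have "\<exists>d>0. \<forall>s. dist s t < d \<longrightarrow> dist (h s) (h t) < \<bar>h t\<bar>"
      using \<open>h t \<noteq> 0\<close> unfolding continuous_at_eps_delta by simp
    then obtain d where d: "d > 0" "\<And>s. dist s t < d \<Longrightarrow> dist (h s) (h t) < \<bar>h t\<bar>" by blast
    define p where "p = max (t - d) ((a + t) / 2)"
    define q where "q = min (t + d) ((t + b) / 2)"
    have pq: "a < p" "p < t" "t < q" "q < b" using t d
        by (auto simp: p_def q_def less_max_iff_disj min_less_iff_disj)
    have sign: "h s * sgn (h t) \<ge> 0" if "p < s" "s < q" for s
    proof -
      have "\<bar>h s - h t\<bar> < \<bar>h t\<bar>" using d(2)[of s] that by (auto simp: p_def q_def dist_real_def)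
      then show ?thesis by (auto simp: sgn_if)
    qed
    let ?f = "\<lambda>t'. sgn (h t) * (h t' * bump p q t')"
    have "continuous_on {a..b} ?f"
      by (intro continuous_intros h Ck_on_imp_continuous_on[OF Ck_on_bump])
    moreover have "?f s \<ge> 0" for s
    proof (cases "s \<in> {p<..<q}")
      case True
      then have "(h s * sgn (h t)) * bump p q s \<ge> 0"
        using mult_nonneg_nonneg[OF sign[of s] bump_nonneg[of p q s]] by simp
      then show ?thesis by (simp add: ac_simps)
    qed (simp add: bump_zero)
    moreover have "integral {a..b} ?f = 0"
      using zero[of p q] pq by simp
    ultimately have "?f t = 0"
      using integral_eq_0_iff[of a b ?f] \<open>a < b\<close> t by auto
    then show False using \<open>h t \<noteq> 0\<close> bump_pos[of p t q] pq by (simp add: sgn_if split: if_splits)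
  qed
  have "closure {a<..<b} = {a..b}" using \<open>a < b\<close> by simp
  then show ?thesis using continuous_constant_on_closure[of "{a<..<b}" h 0 t] h inner t by auto
qed

section \<open>Differentiation of integrals depending on a parameter\<close>

text \<open>
  Being \<open>C\<^sup>1\<close> jointly in both variables provides the continuous partial derivative which the Leibniz
  integral rule asks for; the value of the derivative is needed at \<open>r = 0\<close> only.
\<close>

lemma integral_parameter_derivative:
  fixes f :: "real \<Rightarrow> real \<Rightarrow> real"
  assumes e: "e > 0" and pq: "p < q"
    and f: "Ck_on 1 ({-e<..<e} \<times> {p..q}) (\<lambda>(r, t). f r t)"
    and f': "\<And>t. t \<in> {p..q} \<Longrightarrow> ((\<lambda>r. f r t) has_real_derivative f' t) (at 0)"
  shows "((\<lambda>r. integral {p..q} (f r)) has_real_derivative integral {p..q} f') (at 0)"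
proof -
  let ?S = "{-e<..<e} \<times> {p..q}"
  from f obtain D where
    D: "\<And>z. z \<in> ?S \<Longrightarrow> ((\<lambda>(r, t). f r t) has_derivative D z) (at z within ?S)"
    "\<And>v. continuous_on ?S (\<lambda>z. D z v)"
    by (auto simp del: case_prod_conv)
  have part: "((\<lambda>r. f r t) has_real_derivative D (r, t) (1, 0)) (at r)" if "(r, t) \<in> ?S" for r t
  proof -
    have 1: "((\<lambda>r. (\<lambda>(r, t). f r t) (r, t)) has_derivative (\<lambda>h. D (r, t) (h,
        0))) (at r within {-e<..<e})"
      by (rule has_derivative_in_compose2[OF D(1)])
        (use that in \<open>auto intro!: derivative_eq_intros\<close>)
    have 2: "(\<lambda>h. D (r, t) (h, 0)) = (*) (D (r, t) (1, 0))"
    proof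
      show "D (r, t) (h, 0) = D (r, t) (1, 0) * h" for h
        using linear_cmul[OF has_derivative_linear[OF D(1)[OF that]], of h "(1, 0)"]
        by (simp add: mult.commute)
    qed
    have 3: "at r within {-e<..<e} = at r" using that by (intro at_within_open) auto
    show ?thesis
      using 1 unfolding 2 3 has_field_derivative_def by (simp only: case_prod_conv)
  qed
  have cont: "continuous_on {p..q} (f r)" if "r \<in> {-e<..<e}" for r
  proof -
    have "continuous_on ?S (\<lambda>(r, t). f r t)" using Ck_on_imp_continuous_on[OF f] .
    then have "continuous_on {p..q} (\<lambda>t. (\<lambda>(r, t). f r t) (r, t))"
      by (rule continuous_on_compose2) (use that in \<open>auto intro!: continuous_intros\<close>)
    then show ?thesis by simp
  qed
  have "((\<lambda>r. integral (cbox p q) (f r)) has_real_derivative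
      integral (cbox p q) ((\<lambda>r t. D (r, t) (1, 0)) 0)) (at 0 within {-e<..<e})"
  proof (rule leibniz_rule_field_derivative[where fx = "\<lambda>r t. D (r, t) (1, 0)"])
    show "((\<lambda>r. f r t) has_real_derivative D (r, t) (1, 0)) (at r within {-e<..<e})"
      if "r \<in> {-e<..<e}" "t \<in> cbox p q" for r t
      using part[of r t] that has_field_derivative_at_within by force
    show "f r integrable_on cbox p q" if "r \<in> {-e<..<e}" for r
      using cont[OF that] by (auto intro: integrable_continuous_real)
    show "continuous_on ({-e<..<e} \<times> cbox p q) (\<lambda>(r, t). D (r, t) (1, 0))"
      using D(2)[of "(1, 0)"] by (auto simp: split_beta)
  qed (use e in auto)
  moreover have "at 0 within {-e<..<e} = at 0" using e by (intro at_within_open) auto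
  moreover have "integral {p..q} (\<lambda>t. D (0, t) (1, 0)) = integral {p..q} f'"
    by (rule integral_cong) (use part[of 0] f' e in \<open>auto intro: DERIV_unique\<close>)
  ultimately show ?thesis by simp
qed

section \<open>Riemannian geometry in coordinates\<close>

lemma frechet_derivative_cong_open:
  assumes "open U" "z \<in> U" "\<And>z. z \<in> U \<Longrightarrow> f z = g z"
  shows "frechet_derivative f (at z) = frechet_derivative g (at z)"
proof -
  have "(f has_derivative D) (at z) \<longleftrightarrow> (g has_derivative D) (at z)" for D
    using assms has_derivative_transform_within_open by metis
  then show ?thesis by (simp add: frechet_derivative_def)
qed

text \<open>
  A Riemannian metric \<open>G\<close> and its Levi-Civita connection on an open set of the model space;
  \<open>\<Gamma> z u v\<close> is the covariant derivative at \<open>z\<close> of the constant field \<open>v\<close> in the direction \<open>u\<close> (the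
  Christoffel symbols). All bilinear maps are kept as functions of two vectors, without indices.
\<close>

locale coord_geometry =
  fixes U :: "'e::euclidean_space set"
    and G :: "'e \<Rightarrow> 'e \<Rightarrow> 'e \<Rightarrow> real"
    and \<Gamma> :: "'e \<Rightarrow> 'e \<Rightarrow> 'e \<Rightarrow> 'e"
  assumes open_U: "open U"
    and bil_G: "\<And>z. z \<in> U \<Longrightarrow> bilinear (G z)"
    and sym_G: "\<And>z u v. z \<in> U \<Longrightarrow> G z u v = G z v u"
    and pos_G: "\<And>z u. z \<in> U \<Longrightarrow> u \<noteq> 0 \<Longrightarrow> 0 < G z u u"
    and smooth_G: "\<And>n u v. Ck_on n U (\<lambda>z. G z u v)"
    and bil_\<Gamma>: "\<And>z. z \<in> U \<Longrightarrow> bilinear (\<Gamma> z)"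
    and sym_\<Gamma>: "\<And>z u v. z \<in> U \<Longrightarrow> \<Gamma> z u v = \<Gamma> z v u"
    and smooth_\<Gamma>: "\<And>n u v. Ck_on n U (\<lambda>z. \<Gamma> z u v)"
    and compat: "\<And>z u v w. z \<in> U \<Longrightarrow>
      frechet_derivative (\<lambda>z. G z u v) (at z) w = G z (\<Gamma> z w u) v + G z u (\<Gamma> z w v)"
begin

lemmas G_lin = bilinear_ladd[OF bil_G] bilinear_radd[OF bil_G] bilinear_lsub[OF bil_G]
  bilinear_rsub[OF bil_G] bilinear_lmul[OF bil_G] bilinear_rmul[OF bil_G]
  bilinear_lneg[OF bil_G] bilinear_rneg[OF bil_G] bilinear_lzero[OF bil_G] bilinear_rzero[OF bil_G]
lemmas \<Gamma>_lin = bilinear_ladd[OF bil_\<Gamma>] bilinear_radd[OF bil_\<Gamma>] bilinear_lsub[OF bil_\<Gamma>]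
  bilinear_rsub[OF bil_\<Gamma>] bilinear_lmul[OF bil_\<Gamma>] bilinear_rmul[OF bil_\<Gamma>]
  bilinear_lneg[OF bil_\<Gamma>] bilinear_rneg[OF bil_\<Gamma>] bilinear_lzero[OF bil_\<Gamma>] bilinear_rzero[OF bil_\<Gamma>]

lemma G_sum_left: "z \<in> U \<Longrightarrow> G z (\<Sum>j\<in>J. f j) u = (\<Sum>j\<in>J. G z (f j) u)"
  using bil_G[of z] by (simp add: bilinear_def linear_sum[of "\<lambda>x. G z x u"])

abbreviation d\<Gamma> :: "'e \<Rightarrow> 'e \<Rightarrow> 'e \<Rightarrow> 'e \<Rightarrow> 'e" where
  "d\<Gamma> z u v h \<equiv> frechet_derivative (\<lambda>z. \<Gamma> z u v) (at z) h"

text \<open>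
  The curvature \<open>R(u, v)w\<close> of constant fields, whose Lie brackets vanish.
\<close>

definition Rm :: "'e \<Rightarrow> 'e \<Rightarrow> 'e \<Rightarrow> 'e \<Rightarrow> 'e" where
  "Rm z u v w = d\<Gamma> z v w u - d\<Gamma> z u w v + \<Gamma> z u (\<Gamma> z v w) - \<Gamma> z v (\<Gamma> z u w)"

lemma G_derivative:
  assumes z: "z \<in> U"
  shows "((\<lambda>z. G z u v) has_derivative (\<lambda>w. G z (\<Gamma> z w u) v + G z u (\<Gamma> z w v))) (at z)"
proof -
  have "frechet_derivative (\<lambda>z. G z u v) (at z) = (\<lambda>w. G z (\<Gamma> z w u) v + G z u (\<Gamma> z w v))"
    using compat[OF z] by (intro ext)
  then show ?thesis using Ck_on_Suc_frechet(1)[OF smooth_G open_U z, of u v] by simp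
qed

lemma \<Gamma>_derivative: "z \<in> U \<Longrightarrow> ((\<lambda>z. \<Gamma> z u v) has_derivative d\<Gamma> z u v) (at z)"
  using Ck_on_Suc_frechet(1)[OF smooth_\<Gamma> open_U] .

lemma d\<Gamma>_sym: "z \<in> U \<Longrightarrow> d\<Gamma> z u v h = d\<Gamma> z v u h"
  using frechet_derivative_cong_open[OF open_U, of z "\<lambda>z. \<Gamma> z u v" "\<lambda>z. \<Gamma> z v u"] sym_\<Gamma> by simp

lemma bil_d\<Gamma>: "z \<in> U \<Longrightarrow> bilinear (\<lambda>u v. d\<Gamma> z u v h)"
  by (rule bilinear_derivative[OF open_U _ bil_\<Gamma> \<Gamma>_derivative])

lemma smooth_d\<Gamma>: "Ck_on n U (\<lambda>z. d\<Gamma> z u v h)"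
  using Ck_on_Suc_frechet(2)[OF smooth_\<Gamma> open_U] .

text \<open>
  Differentiating the compatibility equation once more expresses the second derivatives of \<open>G\<close>;
  their symmetry is the skew-symmetry of the curvature operators.
\<close>

lemma G_second_derivative:
  assumes z: "z \<in> U"
  shows "frechet_derivative (\<lambda>z. frechet_derivative (\<lambda>z. G z a b) (at z) w) (at z) u
    = G z (\<Gamma> z u (\<Gamma> z w a)) b + G z (\<Gamma> z w a) (\<Gamma> z u b) + G z (d\<Gamma> z w a u) b
      + G z (\<Gamma> z u a) (\<Gamma> z w b) + G z a (\<Gamma> z u (\<Gamma> z w b)) + G z a (d\<Gamma> z w b u)"
proof -
  \<comment> \<open>The right-hand side of the compatibility equation is differentiated along a line.\<close>
  let ?y = "\<lambda>s::real. z + s *\<^sub>R u"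
  have y: "(?y has_vector_derivative u) (at 0 within UNIV)"
    by (auto intro!: derivative_eq_intros simp: has_vector_derivative_def)
  have \<Gamma>': "((\<lambda>s. \<Gamma> (?y s) w c) has_vector_derivative d\<Gamma> z w c u) (at 0)" for c
    using has_vector_derivative_bilinear_field[OF open_U, of ?y 0 \<Gamma>, OF _ bil_\<Gamma> _ y, of
        "\<lambda>u v. d\<Gamma> z u v" "\<lambda>_. w" 0 "\<lambda>_. c" 0]
      z \<Gamma>_derivative \<Gamma>_lin by simp
  have 1: "((\<lambda>s. G (?y s) (\<Gamma> (?y s) w a) b) has_vector_derivative
      (G z (\<Gamma> z u (\<Gamma> z w a)) b + G z (\<Gamma> z w a) (\<Gamma> z u b)) + G z (d\<Gamma> z w a u) b
          + G z (\<Gamma> z w a) 0) (at 0)"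
    using has_vector_derivative_bilinear_field[OF open_U, of ?y 0 G, OF _ bil_G _ y,
        of "\<lambda>a b w. G z (\<Gamma> z w a) b + G z a (\<Gamma> z w b)" "\<lambda>s. \<Gamma> (?y s) w a" "d\<Gamma> z w a u" "\<lambda>_. b" 0]
      z G_derivative \<Gamma>' by simp
  have 2: "((\<lambda>s. G (?y s) a (\<Gamma> (?y s) w b)) has_vector_derivative
      (G z (\<Gamma> z u a) (\<Gamma> z w b) + G z a (\<Gamma> z u (\<Gamma> z w b))) + G z 0 (\<Gamma> z w b)
          + G z a (d\<Gamma> z w b u)) (at 0)"
    using has_vector_derivative_bilinear_field[OF open_U, of ?y 0 G, OF _ bil_G _ y,
        of "\<lambda>a b w. G z (\<Gamma> z w a) b + G z a (\<Gamma> z w b)" "\<lambda>_. a" 0 "\<lambda>s. \<Gamma> (?y s) w b" "d\<Gamma> z w b u"]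
      z G_derivative \<Gamma>' by simp
  let ?F = "\<lambda>z. frechet_derivative (\<lambda>z. G z a b) (at z) w"
  have "Ck_on (Suc 0) U ?F" using Ck_on_Suc_frechet(2)[OF smooth_G open_U] .
  note F = Ck_on_Suc_frechet(1)[OF this open_U z]
  have 3: "((\<lambda>s. ?F (?y s)) has_vector_derivative frechet_derivative ?F (at z) u) (at 0)"
    using has_real_derivative_along_line[of ?F _ z 0 u 0] F
    by (simp add: has_real_derivative_iff_has_vector_derivative)
  have "open (?y -` U)" by (intro open_vimage open_U continuous_intros)
  then have 4: "((\<lambda>s. ?F (?y s)) has_vector_derivative
      ((G z (\<Gamma> z u (\<Gamma> z w a)) b + G z (\<Gamma> z w a) (\<Gamma> z u b)) + G z (d\<Gamma> z w a u) b + G z (\<Gamma> z w a) 0)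
    + ((G z (\<Gamma> z u a) (\<Gamma> z w b) + G z a (\<Gamma> z u (\<Gamma> z w b))) + G z 0 (\<Gamma> z w b)
        + G z a (d\<Gamma> z w b u))) (at 0)"
    by (intro has_vector_derivative_transform_within_open[OF has_vector_derivative_add[OF 1 2]])
      (use z compat in auto)
  show ?thesis
    using vector_derivative_unique_at[OF 3 4] z by (simp add: G_lin)
qed

lemma Rm_skew:
  assumes z: "z \<in> U"
  shows "G z (Rm z u w a) b = - G z (Rm z u w b) a"
proof -
  have "Ck_on 2 U (\<lambda>z. G z a b)" by (rule smooth_G)
  from second_derivative_symmetric[OF open_U z this, of w u]
  show ?thesis
    unfolding G_second_derivative[OF z] Rm_def
    using z sym_G[OF z, of a] by (simp add: G_lin sym_G[OF z, of a] sym_G[OF z, of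
        "\<Gamma> z w b"] sym_G[OF z, of "\<Gamma> z u b"])
qed

lemma Rm_antisym: "Rm z u v w = - Rm z v u w"
  by (simp add: Rm_def)

lemma Rm_bianchi: "z \<in> U \<Longrightarrow> Rm z u v w + Rm z v w u + Rm z w u v = 0"
  using d\<Gamma>_sym[of z u v w] d\<Gamma>_sym[of z v w u] d\<Gamma>_sym[of z w u v] sym_\<Gamma>[of z u v] sym_\<Gamma>[of z v w]
      sym_\<Gamma>[of z w u]
  by (simp add: Rm_def)

text \<open>
  The usual octahedron argument: add up the four Bianchi identities that arise from cyclic
  permutations of the arguments; the skew-symmetries cancel all but two pairs of terms.
\<close>

lemma Rm_pair:
  assumes z: "z \<in> U"
  shows "G z (Rm z u v w) x = G z (Rm z w x u) v"
proof -
  let ?K = "\<lambda>u v w x. G z (Rm z u v w) x"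
  have a: "?K u v w x = - ?K v u w x" for u v w x
    using Rm_antisym[of z u v w] z by (simp add: G_lin)
  have s: "?K u v w x = - ?K u v x w" for u v w x using Rm_skew[OF z] .
  have b: "?K u v w x + ?K v w u x + ?K w u v x = 0" for u v w x
    using Rm_bianchi[OF z, of u v w] z by (simp add: G_lin flip: G_lin(1))
  show ?thesis
    using b[of u v w x] b[of v w x u] b[of w x u v] b[of x u v w]
      a[of u v w x] a[of v w u x] a[of w u v x] a[of w x u v] a[of u v x w] a[of x u v w] a[of x u w
          v]
      a[of v w x u] a[of x v w u] a[of w x v u] a[of u x w v] a[of u w x v] a[of v x u w]
      s[of u v w x] s[of v w u x] s[of w u v x] s[of w x u v] s[of x u v w] s[of v x u w] s[of w v x
          u]
    by linarith
qed

text \<open>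
  This turns \<open>\<langle>R(W, v)v, a\<rangle>\<close>, which comes out of the variation, into a pairing of a fixed vector
  with \<open>W\<close>.
\<close>

lemma jacobi_operator_sym: "z \<in> U \<Longrightarrow> G z (Rm z w v v) a = G z (Rm z a v v) w"
  using Rm_pair[of z w v v a] Rm_antisym[of z v a w] Rm_skew[of z a v w v] by (simp add: G_lin)

end

section \<open>The first variation in coordinates\<close>

text \<open>
  A smooth curve in coordinates on a set \<open>I\<close> of times, which may contain boundary points; all
  derivatives are taken within \<open>I\<close>. \<open>D\<close> is the covariant derivative along the curve.
\<close>

locale coord_curve = coord_geometry U G \<Gamma>
  for U :: "'e::euclidean_space set" and G and \<Gamma> +
  fixes I :: "real set" and y :: "real \<Rightarrow> 'e"
  assumes acc: "axis_accessible I"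
    and smooth_y: "smooth_on I y"
    and y_in: "t \<in> I \<Longrightarrow> y t \<in> U"
begin

abbreviation vd :: "(real \<Rightarrow> 'b::real_normed_vector) \<Rightarrow> real \<Rightarrow> 'b" where
  "vd u t \<equiv> vector_derivative u (at t within I)"

definition v :: "real \<Rightarrow> 'e" where "v t = vd y t"

definition D :: "(real \<Rightarrow> 'e) \<Rightarrow> real \<Rightarrow> 'e" where
  "D u t = vd u t + \<Gamma> (y t) (v t) (u t)"

lemma y_image: "y ` I \<subseteq> U" using y_in by auto

lemma smooth_vd: "smooth_on I (u :: real \<Rightarrow> 'b::real_normed_vector) \<Longrightarrow> smooth_on I (vd u)"
  using smooth_on_vector_derivative(2)[OF _ acc, of u] .

lemma has_vd:
  "smooth_on I (u :: real \<Rightarrow> 'b::real_normed_vector) \<Longrightarrow> t \<in> I \<Longrightarrow>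
    (u has_vector_derivative vd u t) (at t within I)"
  using smooth_on_vector_derivative(1)[OF _ acc] .

lemma smooth_v: "smooth_on I v"
  using smooth_vd[OF smooth_y] by (simp add: v_def[abs_def])

lemma has_v: "t \<in> I \<Longrightarrow> (y has_vector_derivative v t) (at t within I)"
  using has_vd[OF smooth_y] by (simp add: v_def)

lemma smooth_D: "smooth_on I u \<Longrightarrow> smooth_on I (D u)"
  unfolding D_def[abs_def]
  by (intro smooth_onI Ck_on_add smooth_onD[OF smooth_vd]
      Ck_on_bilinear_field[OF bil_\<Gamma> smooth_\<Gamma> smooth_onD[OF smooth_y] smooth_onD[OF smooth_v] _
          y_image])
    (auto intro: smooth_onD)

lemma smooth_G_along: "smooth_on I u \<Longrightarrow> smooth_on I w \<Longrightarrow> smooth_on I (\<lambda>t. G (y t) (u t) (w t))"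
  by (intro smooth_onI Ck_on_bilinear_field[OF bil_G smooth_G smooth_onD[OF smooth_y] _ _ y_image])
    (auto intro: smooth_onD)

lemma G_product_rule:
  assumes "smooth_on I u" "smooth_on I w" "t \<in> I"
  shows "((\<lambda>s. G (y s) (u s) (w s)) has_vector_derivative
    G (y t) (D u t) (w t) + G (y t) (u t) (D w t)) (at t within I)"
  using has_vector_derivative_bilinear_field[where B=G and y=y and u=u and v=w and t=t and I=I,
      OF open_U y_in bil_G G_derivative has_v has_vd has_vd] assms y_in[OF assms(3)]
  by (simp add: D_def G_lin algebra_simps)

lemma \<Gamma>_product_rule:
  assumes "smooth_on I u" "smooth_on I w" "t \<in> I"
  shows "vd (\<lambda>s. \<Gamma> (y s) (u s) (w s)) t
    = d\<Gamma> (y t) (u t) (w t) (v t) + \<Gamma> (y t) (vd u t) (w t) + \<Gamma> (y t) (u t) (vd w t)"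
  using has_vector_derivative_bilinear_field[where B=\<Gamma> and y=y and u=u and v=w and t=t and I=I,
      OF open_U y_in bil_\<Gamma> \<Gamma>_derivative has_v has_vd has_vd] assms acc y_in[OF assms(3)]
  by (intro vector_derivative_accessible) auto

lemma D_D:
  assumes W: "smooth_on I W" and t: "t \<in> I"
  shows "D (D W) t = vd (vd W) t + d\<Gamma> (y t) (v t) (W t) (v t) + \<Gamma> (y t) (vd v t) (W t)
     + 2 *\<^sub>R \<Gamma> (y t) (v t) (vd W t) + \<Gamma> (y t) (v t) (\<Gamma> (y t) (v t) (W t))"
proof -
  have s\<Gamma>: "smooth_on I (\<lambda>s. \<Gamma> (y s) (v s) (W s))"
    by (intro smooth_onI Ck_on_bilinear_field[OF bil_\<Gamma> smooth_\<Gamma> smooth_onD[OF smooth_y] _ _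
        y_image])
      (auto intro: smooth_onD smooth_v W)
  have "vd (D W) t = vd (vd W) t + vd (\<lambda>s. \<Gamma> (y s) (v s) (W s)) t"
    unfolding D_def[abs_def]
    by (intro vector_derivative_accessible[OF _ acc t] has_vector_derivative_add has_vd
        smooth_vd W s\<Gamma> t)
  then show ?thesis
    unfolding D_def[of "D W"] \<Gamma>_product_rule[OF smooth_v W t]
    using y_in[OF t] by (simp add: D_def \<Gamma>_lin algebra_simps scaleR_2)
qed

end

text \<open>
  The data of the variational problem in coordinates: \<open>Y j\<close> are the constraint fields, and \<open>S j\<close>
  represents the exterior derivative of the form dual to \<open>Y j\<close>. Its defining equation is stated for
  constant fields, which is enough because the exterior derivative is a tensor.
\<close>

locale coord_lagrangian = coord_curve U G \<Gamma> I y
  for U :: "'e::euclidean_space set" and G and \<Gamma> and I and y +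
  fixes \<sigma> :: real and V :: "'e \<Rightarrow> real" and gradV :: "'e \<Rightarrow> 'e"
    and J :: "nat set" and \<mu> :: "nat \<Rightarrow> real \<Rightarrow> real" and Y :: "nat \<Rightarrow> 'e \<Rightarrow> 'e"
    and S :: "nat \<Rightarrow> 'e \<Rightarrow> 'e \<Rightarrow> 'e"
  assumes V: "Ck_on 2 U V"
    and gradV: "z \<in> U \<Longrightarrow> G z (gradV z) h = frechet_derivative V (at z) h"
    and smooth_\<mu>: "j \<in> J \<Longrightarrow> smooth_on I (\<mu> j)"
    and smooth_Y: "j \<in> J \<Longrightarrow> Ck_on n U (Y j)"
    and S: "j \<in> J \<Longrightarrow> z \<in> U \<Longrightarrow> G z (S j z u) h =
      frechet_derivative (\<lambda>z. G z (Y j z) h) (at z) u - frechet_derivative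
          (\<lambda>z. G z (Y j z) u) (at z) h"
begin

text \<open>
  \<open>lagr\<close> is twice the density of the action, so the multipliers enter \<open>EL\<close> and \<open>boundary\<close> with a
  factor \<open>1/2\<close>. Its last two arguments are the ordinary first and second derivatives of the curve;
  \<open>u' + \<Gamma>(u, u)\<close> is the covariant acceleration.
\<close>

definition lagr :: "real \<Rightarrow> 'e \<Rightarrow> 'e \<Rightarrow> 'e \<Rightarrow> real" where
  "lagr t z u u' = G z (u' + \<Gamma> z u u) (u' + \<Gamma> z u u) + \<sigma> * G z u u + V z
    + (\<Sum>j\<in>J. \<mu> j t * G z (Y j z) u)"

definition EL :: "real \<Rightarrow> 'e" where
  "EL t = D (D (D v)) t + Rm (y t) (D v t) (v t) (v t) - \<sigma> *\<^sub>R D v t + (1 / 2) *\<^sub>R gradV (y t)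
    - (\<Sum>j\<in>J. (vd (\<mu> j) t / 2) *\<^sub>R Y j (y t)) - (\<Sum>j\<in>J. (\<mu> j t / 2) *\<^sub>R S j (y t) (v t))"

definition boundary :: "(real \<Rightarrow> 'e) \<Rightarrow> real \<Rightarrow> real" where
  "boundary W t = G (y t) (D v t) (D W t) - G (y t) (D (D v) t) (W t) + \<sigma> * G (y t) (v t) (W t)
    + (\<Sum>j\<in>J. \<mu> j t / 2 * G (y t) (Y j (y t)) (W t))"

abbreviation d\<omega> :: "nat \<Rightarrow> 'e \<Rightarrow> 'e \<Rightarrow> 'e \<Rightarrow> real" where
  "d\<omega> j z u h \<equiv> frechet_derivative (\<lambda>z. G z (Y j z) u) (at z) h"

lemma smooth_\<omega>: "j \<in> J \<Longrightarrow> Ck_on n U (\<lambda>z. G z (Y j z) u)"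
  by (intro Ck_on_bilinear_field[OF bil_G smooth_G Ck_on_id smooth_Y Ck_on_const]) auto

lemma \<omega>_derivative: "j \<in> J \<Longrightarrow> z \<in> U \<Longrightarrow> ((\<lambda>z. G z (Y j z) u) has_derivative d\<omega> j z u) (at z)"
  using Ck_on_Suc_frechet(1)[OF smooth_\<omega> open_U] .

lemma linear_\<omega>: "z \<in> U \<Longrightarrow> linear (\<lambda>u. G z (Y j z) u)"
  using bil_G[of z] by (simp add: bilinear_def)

text \<open>
  Here \<open>W'' + d\<Gamma>(v, v)[W] + 2 \<Gamma>(v, W')\<close> is the derivative of the coordinates of the acceleration
  \<open>a = Dv\<close> under the variation \<open>W\<close>, and \<open>\<Gamma>(W, a)\<close> makes it covariant. Exchanging the covariant
  derivatives along the curve and along the variation costs a curvature term.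
\<close>

lemma acceleration_variation:
  assumes W: "smooth_on I W" and t: "t \<in> I"
  shows "vd (vd W) t + (d\<Gamma> (y t) (v t) (v t) (W t) + \<Gamma> (y t) (vd W t) (v t)
      + \<Gamma> (y t) (v t) (vd W t))
      + \<Gamma> (y t) (W t) (D v t)
    = D (D W) t + Rm (y t) (W t) (v t) (v t)"
proof -
  note z = y_in[OF t]
  have "D v t = vd v t + \<Gamma> (y t) (v t) (v t)" by (simp add: D_def)
  then show ?thesis
    unfolding D_D[OF W t] Rm_def
    using z sym_\<Gamma>[OF z, of "vd W t" "v t"] sym_\<Gamma>[OF z, of "W t" "v t"]
      d\<Gamma>_sym[OF z, of "W t" "v t" "v t"] sym_\<Gamma>[OF z, of "vd v t" "W t"]
    by (simp add: \<Gamma>_lin scaleR_2)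
qed

text \<open>
  The heart of the computation. With \<open>W\<close> the variation field, the metric terms give
  \<open>2 \<langle>a, D\<^sup>2W + R(W, v)v\<rangle> + 2 \<sigma> \<langle>v, DW\<rangle>\<close>, the potential \<open>\<langle>grad V, W\<rangle>\<close>, and the constraint terms
  \<open>\<mu>\<^sub>j (d\<omega>\<^sub>j(W, v) + (\<omega>\<^sub>j(W))')\<close>. Integrating by parts, here in the form of the product rule for
  \<open>boundary\<close>, moves all derivatives off \<open>W\<close>.
\<close>

lemma lagrangian_variation:
  assumes W: "smooth_on I W" and t: "t \<in> I"
  shows "\<exists>B'. (boundary W has_vector_derivative B') (at t within I) \<and>
    ((\<lambda>r. lagr t (y t + r *\<^sub>R W t) (v t + r *\<^sub>R vd W t) (vd v t + r *\<^sub>R vd (vd W) t))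
      has_real_derivative 2 * (B' + G (y t) (EL t) (W t))) (at 0)"
proof -
  note z = y_in[OF t]
  have lin: "((\<lambda>r::real. b + r *\<^sub>R c) has_vector_derivative c) (at 0)" for b c :: 'e
    by (auto intro!: derivative_eq_intros simp: has_vector_derivative_def)
  let ?y = "\<lambda>r. y t + r *\<^sub>R W t" and ?v = "\<lambda>r. v t + r *\<^sub>R vd W t"
    and ?y2 = "\<lambda>r. vd v t + r *\<^sub>R vd (vd W) t"
  let ?A = "\<lambda>r. ?y2 r + \<Gamma> (?y r) (?v r) (?v r)"
  define A' where "A' = vd (vd W) t + (d\<Gamma> (y t) (v t) (v t) (W t) + \<Gamma> (y t) (vd W t) (v t)
      + \<Gamma> (y t) (v t) (vd W t))"
  have a: "?A 0 = D v t" by (simp add: D_def)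
  have A: "(?A has_vector_derivative A') (at 0)"
    unfolding A'_def
    using has_vector_derivative_bilinear_field[where B=\<Gamma> and y="?y" and u="?v" and v="?v" and t=0
        and I=UNIV,
        OF open_U _ bil_\<Gamma> \<Gamma>_derivative lin lin lin] z
    by (intro has_vector_derivative_add lin) simp
  note GD = has_vector_derivative_bilinear_field[where B=G and y="?y" and t=0 and I=UNIV,
        OF open_U _ bil_G G_derivative lin]
  have "((\<lambda>r. G (?y r) (?A r) (?A r)) has_vector_derivative
      (G (y t) (\<Gamma> (y t) (W t) (D v t)) (D v t) + G (y t) (D v t) (\<Gamma> (y t) (W t) (D v t)))
      + G (y t) A' (D v t) + G (y t) (D v t) A') (at 0)"
    using GD[of ?A A' ?A A'] A z a by simp
  also have "(G (y t) (\<Gamma> (y t) (W t) (D v t)) (D v t) + G (y t) (D v t) (\<Gamma> (y t) (W t) (D v t)))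
      + G (y t) A' (D v t) + G (y t) (D v t) A' = 2 * G (y t) (A' + \<Gamma> (y t) (W t) (D v t)) (D v t)"
    using z sym_G[OF z, of "D v t"] by (simp add: G_lin)
  also have "\<dots> = 2 * G (y t) (D v t) (D (D W) t) + 2 * G (y t) (Rm (y t) (D v t) (v t) (v t)) (W t)"
    unfolding A'_def acceleration_variation[OF W t]
    using z jacobi_operator_sym[OF z, of "W t" "v t" "D v t"] sym_G[OF z, of "D v t"]
        by (simp add: G_lin)
  finally have 1: "((\<lambda>r. G (?y r) (?A r) (?A r)) has_vector_derivative
     2 * G (y t) (D v t) (D (D W) t) + 2 * G (y t) (Rm (y t) (D v t) (v t) (v t)) (W t)) (at 0)" .
  have "((\<lambda>r. G (?y r) (?v r) (?v r)) has_vector_derivative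
      (G (y t) (\<Gamma> (y t) (W t) (v t)) (v t) + G (y t) (v t) (\<Gamma> (y t) (W t) (v t)))
      + G (y t) (vd W t) (v t) + G (y t) (v t) (vd W t)) (at 0)"
    using GD[of ?v "vd W t" ?v "vd W t"] lin z by simp
  also have "(G (y t) (\<Gamma> (y t) (W t) (v t)) (v t) + G (y t) (v t) (\<Gamma> (y t) (W t) (v t)))
      + G (y t) (vd W t) (v t) + G (y t) (v t) (vd W t) = 2 * G (y t) (v t) (D W t)"
    using z sym_G[OF z, of "v t"] sym_\<Gamma>[OF z, of "W t" "v t"] by (simp add: G_lin D_def)
  finally have 2: "((\<lambda>r. G (?y r) (?v r) (?v r))
      has_vector_derivative 2 * G (y t) (v t) (D W t)) (at 0)" .
  have "Ck_on (Suc 0) U V" using Ck_on_le[OF V, of "Suc 0"] by simp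
  from has_real_derivative_along_line[of V _ "y t" 0 "W t" 0] Ck_on_Suc_frechet(1)[OF this open_U z]
  have 3: "((\<lambda>r. V (?y r)) has_vector_derivative G (y t) (gradV (y t)) (W t)) (at 0)"
    by (simp add: gradV[OF z] has_real_derivative_iff_has_vector_derivative)
  have 4: "((\<lambda>r. G (?y r) (Y j (?y r)) (?v r)) has_vector_derivative
      d\<omega> j (y t) (v t) (W t) + G (y t) (Y j (y t)) (vd W t)) (at 0)" if "j \<in> J" for j
    using has_vector_derivative_linear_field[where B="\<lambda>z. G z (Y j z)" and y="?y" and t=0
        and I=UNIV,
        OF open_U _ linear_\<omega> \<omega>_derivative[OF that] lin lin, of "v t" "vd W t"] z by simp
  have 5: "((\<lambda>s. G (y s) (Y j (y s)) (W s)) has_vector_derivative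
      d\<omega> j (y t) (W t) (v t) + G (y t) (Y j (y t)) (vd W t)) (at t within I)" if "j \<in> J" for j
    using has_vector_derivative_linear_field[where B="\<lambda>z. G z (Y j z)" and y=y and t=t and I=I,
        OF open_U z linear_\<omega> \<omega>_derivative[OF that] has_v has_vd[OF W]] z t by simp
  define B' where "B' = (G (y t) (D (D v) t) (D W t) + G (y t) (D v t) (D (D W) t))
      - (G (y t) (D (D (D v)) t) (W t) + G (y t) (D (D v) t) (D W t))
      + \<sigma> * (G (y t) (D v t) (W t) + G (y t) (v t) (D W t))
      + (\<Sum>j\<in>J. \<mu> j t / 2 * (d\<omega> j (y t) (W t) (v t) + G (y t) (Y j (y t)) (vd W t))
          + vd (\<mu> j) t / 2 * G (y t) (Y j (y t)) (W t))"
  have "(boundary W has_vector_derivative B') (at t within I)"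
    unfolding boundary_def[abs_def] B'_def
    by (intro has_vector_derivative_add has_vector_derivative_diff has_vector_derivative_sum
        has_vector_derivative_mult has_vector_derivative_mult_right G_product_rule
        has_vector_derivative_divide 5 has_vd smooth_\<mu> smooth_D smooth_v W t)
  moreover have "((\<lambda>r. lagr t (?y r) (?v r) (?y2 r)) has_vector_derivative
       (2 * G (y t) (D v t) (D (D W) t) + 2 * G (y t) (Rm (y t) (D v t) (v t) (v t)) (W t))
     + \<sigma> * (2 * G (y t) (v t) (D W t)) + G (y t) (gradV (y t)) (W t)
     + (\<Sum>j\<in>J. \<mu> j t * (d\<omega> j (y t) (v t) (W t) + G (y t) (Y j (y t)) (vd W t)))) (at 0)"
    unfolding lagr_def
    by (intro has_vector_derivative_add has_vector_derivative_sum
        has_vector_derivative_mult_right 1 2 3 4)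
  moreover have "(2 * G (y t) (D v t) (D (D W) t)
      + 2 * G (y t) (Rm (y t) (D v t) (v t) (v t)) (W t))
     + \<sigma> * (2 * G (y t) (v t) (D W t)) + G (y t) (gradV (y t)) (W t)
     + (\<Sum>j\<in>J. \<mu> j t * (d\<omega> j (y t) (v t) (W t) + G (y t) (Y j (y t)) (vd W t)))
     = 2 * (B' + G (y t) (EL t) (W t))"
  proof -
    have sums: "(\<Sum>j\<in>J. \<mu> j t * (d\<omega> j (y t) (v t) (W t) + G (y t) (Y j (y t)) (vd W t)))
      = 2 * ((\<Sum>j\<in>J. \<mu> j t / 2 * (d\<omega> j (y t) (W t) (v t) + G (y t) (Y j (y t)) (vd W t))
          + vd (\<mu> j) t / 2 * G (y t) (Y j (y t)) (W t))
        - (\<Sum>j\<in>J. vd (\<mu> j) t / 2 * G (y t) (Y j (y t)) (W t))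
        - (\<Sum>j\<in>J. \<mu> j t / 2 * G (y t) (S j (y t) (v t)) (W t)))"
      unfolding sum_distrib_left sum_subtractf[symmetric]
      by (intro sum.cong) (simp_all add: S[OF _ z] algebra_simps)
    have GE: "G (y t) (EL t) (W t) = G (y t) (D (D (D v)) t) (W t)
        + G (y t) (Rm (y t) (D v t) (v t) (v t)) (W t) - \<sigma> * G (y t) (D v t) (W t)
        + G (y t) (gradV (y t)) (W t) / 2
        - (\<Sum>j\<in>J. vd (\<mu> j) t / 2 * G (y t) (Y j (y t)) (W t))
        - (\<Sum>j\<in>J. \<mu> j t / 2 * G (y t) (S j (y t) (v t)) (W t))"
      unfolding EL_def using z by (simp add: G_lin G_sum_left)
    show ?thesis unfolding sums GE B'_def by (simp add: algebra_simps)
  qed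
  ultimately show ?thesis
    by (intro exI[of _ B']) (simp add: has_real_derivative_iff_has_vector_derivative)
qed

lemma smooth_d\<omega>: 
  assumes "j \<in> J" "smooth_on I u" "smooth_on I h"
  shows "smooth_on I (\<lambda>t. d\<omega> j (y t) (u t) (h t))"
proof -
  have bil: "bilinear (\<lambda>u h. d\<omega> j z u h)" if z: "z \<in> U" for z
    unfolding bilinear_def
    using has_derivative_linear[OF \<omega>_derivative[OF assms(1) z]]
      linear_derivative[OF open_U z linear_\<omega> \<omega>_derivative[OF assms(1) z]] by blast
  show ?thesis
    by (intro smooth_onI Ck_on_bilinear_field[OF bil Ck_on_Suc_frechet(2)[OF smooth_\<omega>[OF assms(1)]
        open_U]
          smooth_onD[OF smooth_y] smooth_onD[OF assms(2)] smooth_onD[OF assms(3)] y_image])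
qed

text \<open>
  The direction of differentiation in \<open>d\<Gamma>\<close> is expanded in the basis, which leaves families of
  bilinear maps.
\<close>

lemma smooth_Rm:
  assumes "smooth_on I a" "smooth_on I b" "smooth_on I c"
  shows "smooth_on I (\<lambda>t. Rm (y t) (a t) (b t) (c t))"
proof -
  have d: "Ck_on n I (\<lambda>t. d\<Gamma> (y t) (u t) (w t) (h t))"
    if "smooth_on I u" "smooth_on I w" "smooth_on I h" for u w h n
  proof -
    have "Ck_on n I (\<lambda>t. \<Sum>e\<in>Basis. (h t \<bullet> e) *\<^sub>R d\<Gamma> (y t) (u t) (w t) e)"
      by (intro Ck_on_sum Ck_on_scaleR Ck_on_inner_left
          Ck_on_bilinear_field[OF bil_d\<Gamma> smooth_d\<Gamma> smooth_onD[OF smooth_y] _ _ y_image])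
        (use that in \<open>auto intro: smooth_onD\<close>)
    then show ?thesis
      by (rule Ck_on_cong)
        (intro linear_basis_expansion has_derivative_linear[OF \<Gamma>_derivative] y_in)
  qed
  have g: "smooth_on I (\<lambda>t. \<Gamma> (y t) (u t) (w t))" if "smooth_on I u" "smooth_on I w" for u w
    by (intro smooth_onI Ck_on_bilinear_field[OF bil_\<Gamma> smooth_\<Gamma> smooth_onD[OF smooth_y] _ _
        y_image])
      (use that in \<open>auto intro: smooth_onD\<close>)
  show ?thesis
    unfolding Rm_def
    by (intro smooth_onI Ck_on_add Ck_on_diff d smooth_onD[OF g] g assms)
qed

lemma continuous_on_EL:
  assumes W: "smooth_on I W"
  shows "continuous_on I (\<lambda>t. G (y t) (EL t) (W t))"
proof -
  have "Ck_on (Suc 0) U V" using Ck_on_le[OF V, of "Suc 0"] by simp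
  note dV = Ck_on_Suc_frechet[OF this open_U]
  have dVc: "Ck_on 0 I (\<lambda>t. frechet_derivative V (at (y t)) (W t))"
    by (rule Ck_on_linear_field[OF has_derivative_linear[OF dV(1)] dV(2)
        smooth_onD[OF smooth_y] smooth_onD[OF W] y_image])
  have c: "continuous_on I f" if "smooth_on I f" for f :: "real \<Rightarrow> real"
    using Ck_on_imp_continuous_on[OF smooth_onD[OF that]] .
  have Yy: "smooth_on I (\<lambda>t. Y j (y t))" if "j \<in> J" for j
    by (rule smooth_onI) (rule Ck_on_compose[OF smooth_Y[OF that] smooth_onD[OF smooth_y] y_image])
  have "continuous_on I (\<lambda>t. G (y t) (D (D (D v)) t) (W t)
        + G (y t) (Rm (y t) (D v t) (v t) (v t)) (W t) - \<sigma> * G (y t) (D v t) (W t)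
        + frechet_derivative V (at (y t)) (W t) / 2
        - (\<Sum>j\<in>J. vd (\<mu> j) t / 2 * G (y t) (Y j (y t)) (W t))
        - (\<Sum>j\<in>J. \<mu> j t / 2 * (d\<omega> j (y t) (W t) (v t) - d\<omega> j (y t) (v t) (W t))))"
    by (intro continuous_on_add continuous_on_diff continuous_on_sum continuous_on_mult
        continuous_on_const continuous_on_divide dVc[unfolded Ck_on.simps] c[OF smooth_G_along]
        c[OF smooth_d\<omega>] c[OF smooth_vd] c[OF smooth_\<mu>] smooth_\<mu> smooth_D smooth_v smooth_Rm W Yy)
            auto
  then show ?thesis
    by (rule continuous_on_eq)
      (use y_in in \<open>simp add: EL_def G_lin G_sum_left gradV S\<close>)
qed

lemma Ck_on_lagr:
  assumes W: "smooth_on I W"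
    and in_U: "\<And>r t. r \<in> {-e<..<e} \<Longrightarrow> t \<in> I \<Longrightarrow> y t + r *\<^sub>R W t \<in> U"
  shows "Ck_on 1 ({-e<..<e} \<times> I)
    (\<lambda>(r, t). lagr t (y t + r *\<^sub>R W t) (v t + r *\<^sub>R vd W t) (vd v t + r *\<^sub>R vd (vd W) t))"
proof -
  let ?S = "{-e<..<e} \<times> I"
  have s: "Ck_on n ?S (\<lambda>z. f (snd z))" if "smooth_on I f"
      for n and f :: "real \<Rightarrow> 'b::real_normed_vector"
    by (rule Ck_on_compose[OF smooth_onD[OF that] Ck_on_linear[OF bounded_linear_snd]]) auto
  have lin: "Ck_on n ?S (\<lambda>z. f (snd z) + fst z *\<^sub>R h (snd z))" if "smooth_on I f" "smooth_on I h"
    for n and f h :: "real \<Rightarrow> 'e"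
    by (intro Ck_on_add Ck_on_scaleR s that Ck_on_linear[OF bounded_linear_fst])
  have im: "(\<lambda>z. y (snd z) + fst z *\<^sub>R W (snd z)) ` ?S \<subseteq> U" using in_U by auto
  note sy = lin[OF smooth_y W] and sv = lin[OF smooth_v smooth_vd[OF W]]
    and sy2 = lin[OF smooth_vd[OF smooth_v] smooth_vd[OF smooth_vd[OF W]]]
  have "Ck_on 1 U V" using Ck_on_le[OF V, of 1] by simp
  then show ?thesis
    unfolding lagr_def split_beta
    by (intro Ck_on_add Ck_on_mult Ck_on_sum Ck_on_const Ck_on_bilinear_field[OF bil_G smooth_G sy _
        _ im]
        Ck_on_bilinear_field[OF bil_\<Gamma> smooth_\<Gamma> sy _ _ im] sy2 sv s smooth_\<mu>
        Ck_on_compose[OF _ sy im] smooth_Y)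
qed

text \<open>
  The pointwise identity, integrated: differentiation under the integral sign, and the fundamental
  theorem of calculus for the boundary term.
\<close>

lemma action_variation:
  assumes I: "I = {p..q}" "p < q" and W: "smooth_on I W" and e: "e > 0"
    and in_U: "\<And>r t. r \<in> {-e<..<e} \<Longrightarrow> t \<in> I \<Longrightarrow> y t + r *\<^sub>R W t \<in> U"
  shows "((\<lambda>r. integral I (\<lambda>t. lagr t (y t + r *\<^sub>R W t) (v t + r *\<^sub>R vd W t) (vd v t
      + r *\<^sub>R vd (vd W) t)))
    has_real_derivative 2 * (boundary W q - boundary W p + integral I
        (\<lambda>t. G (y t) (EL t) (W t)))) (at 0)"
proof -
  define L where "L = (\<lambda>r t. lagr t (y t + r *\<^sub>R W t) (v t + r *\<^sub>R vd W t) (vd v t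
      + r *\<^sub>R vd (vd W) t))"
  have "\<forall>t\<in>I. \<exists>B'. (boundary W has_vector_derivative B') (at t within I) \<and>
      ((\<lambda>r. L r t) has_real_derivative 2 * (B' + G (y t) (EL t) (W t))) (at 0)"
    unfolding L_def using lagrangian_variation[OF W] by (intro ballI)
  from bchoice[OF this] obtain B' where B': "\<forall>t\<in>I. (boundary W
      has_vector_derivative B' t) (at t within I) \<and>
      ((\<lambda>r. L r t) has_real_derivative 2 * (B' t + G (y t) (EL t) (W t))) (at 0)"
    by (elim exE)
  have "Ck_on 1 ({-e<..<e} \<times> {p..q}) (\<lambda>(r, t). L r t)"
    using Ck_on_lagr[OF W in_U] by (simp add: L_def I(1))
  then have 1: "((\<lambda>r. integral {p..q} (L r)) has_real_derivative
      integral {p..q} (\<lambda>t. 2 * (B' t + G (y t) (EL t) (W t)))) (at 0)"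
    by (rule integral_parameter_derivative[OF e I(2)]) (use B' I(1) in auto)
  have "(B' has_integral boundary W q - boundary W p) {p..q}"
    using I(2) B' unfolding I(1) by (intro fundamental_theorem_of_calculus) auto
  moreover have "((\<lambda>t. G (y t) (EL t) (W t)) has_integral integral {p..q}
      (\<lambda>t. G (y t) (EL t) (W t))) {p..q}"
    using continuous_on_EL[OF W] unfolding I(1)
    by (intro integrable_integral integrable_continuous_real)
  ultimately have "((\<lambda>t. 2 * (B' t + G (y t) (EL t) (W t))) has_integral
      2 * (boundary W q - boundary W p + integral {p..q} (\<lambda>t. G (y t) (EL t) (W t)))) {p..q}"
    by (intro has_integral_mult_right has_integral_add)
  from 1[unfolded integral_unique[OF this]] show ?thesis
    unfolding L_def I(1)[symmetric] .
qed

end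

section \<open>Charts and tangent vectors\<close>

lemma coords_simps [simp]:
  "coords (0 :: ('m, 'e::real_vector) tvec) c = 0"
  "coords (u + w) c = coords u c + coords w c"
  "coords (- u) c = - coords u c"
  "coords (u - w) c = coords u c - coords w c"
  "coords (a *\<^sub>R u) c = a *\<^sub>R coords u c"
  by (simp_all add: zero_tvec_def plus_tvec_def uminus_tvec_def minus_tvec_def scaleR_tvec_def)

lemma coords_sum [simp]:
  "coords (\<Sum>i\<in>F. w i :: ('m, 'e::real_vector) tvec) c = (\<Sum>i\<in>F. coords (w i) c)"
  by (induction F rule: infinite_finite_induct) auto

lemma charts_at_iff: "c \<in> charts_at A p \<longleftrightarrow> c \<in> A \<and> p \<in> cdom c"
  by (auto simp: charts_at_def)

locale smooth_mfd =
  fixes A :: "('m::{t2_space,second_countable_topology}, 'e::euclidean_space) chart set"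
  assumes mfd: "smooth_manifold A"
begin

abbreviation range_of :: "('m, 'e) chart \<Rightarrow> 'e set" where
  "range_of c \<equiv> cmap c ` cdom c"

text \<open>
  The change of coordinates for tangent vectors at \<open>p\<close>. The two composition laws below make all the
  chart-wise definitions of tangent vectors consistent.
\<close>

definition J :: "('m, 'e) chart \<Rightarrow> ('m, 'e) chart \<Rightarrow> 'm \<Rightarrow> 'e \<Rightarrow> 'e" where
  "J c d p = frechet_derivative (cmap d \<circ> cinv c) (at (cmap c p))"

abbreviation E :: "('m, 'e) chart \<Rightarrow> 'e \<Rightarrow> ('m, 'e) vfield" where
  "E \<equiv> coord_vfield A"

lemma ex_chart: "\<exists>c. c \<in> charts_at A p"
  using mfd by (fastforce simp: smooth_manifold_def charts_at_iff)

context
  fixes c assumes c: "c \<in> A"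
begin

lemma chart: "is_chart c"
  using mfd c by (auto simp: smooth_manifold_def)

lemma open_cdom: "open (cdom c)" and open_range: "open (range_of c)"
  using chart by (auto simp: is_chart_def)

lemma cinv_cmap: "p \<in> cdom c \<Longrightarrow> cinv c (cmap c p) = p"
  and cmap_cinv: "z \<in> range_of c \<Longrightarrow> cmap c (cinv c z) = z"
  and continuous_cmap: "continuous_on (cdom c) (cmap c)"
  and continuous_cinv: "continuous_on (range_of c) (cinv c)"
  using chart by (auto simp: is_chart_def homeomorphism_def)

lemma cinv_in: "z \<in> range_of c \<Longrightarrow> cinv c z \<in> cdom c"
  using cinv_cmap by auto

lemma open_cmap_image: "open W \<Longrightarrow> open (cmap c ` (W \<inter> cdom c))"
proof -
  assume "open W"
  moreover have "cmap c ` (W \<inter> cdom c) = cinv c -` W \<inter> range_of c"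
    using cinv_cmap by force
  ultimately show ?thesis
    using continuous_on_open_vimage[OF open_range] continuous_cinv by metis
qed

end

lemma smooth_trans:
  "c \<in> A \<Longrightarrow> d \<in> A \<Longrightarrow> Ck_on n (cmap c ` (cdom c \<inter> cdom d)) (cmap d \<circ> cinv c)"
  using mfd by (auto simp: smooth_manifold_def smooth_transition_def smooth_on_def)

lemma open_overlap: "c \<in> A \<Longrightarrow> d \<in> A \<Longrightarrow> open (cmap c ` (cdom c \<inter> cdom d))"
  using open_cmap_image[of c "cdom d"] open_cdom[of d] by (simp add: Int_commute)

lemma trans_derivative:
  assumes "c \<in> charts_at A p" "d \<in> charts_at A p"
  shows "((cmap d \<circ> cinv c) has_derivative J c d p) (at (cmap c p))"
  unfolding J_def using assms
  by (intro Ck_on_Suc_frechet(1)[OF smooth_trans open_overlap]) (auto simp: charts_at_iff)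

lemma linear_J: "c \<in> charts_at A p \<Longrightarrow> d \<in> charts_at A p \<Longrightarrow> linear (J c d p)"
  using has_derivative_linear[OF trans_derivative] .

lemma J_comp:
  assumes c: "c \<in> charts_at A p" and d: "d \<in> charts_at A p" and e: "e \<in> charts_at A p"
  shows "J d e p (J c d p u) = J c e p u"
proof -
  have p: "cinv c (cmap c p) = p" using c cinv_cmap[of c] by (simp add: charts_at_iff)
  have "((cmap e \<circ> cinv d) \<circ> (cmap d \<circ> cinv c) has_derivative J d e p \<circ> J c d p) (at (cmap c p))"
    using diff_chain_at[OF trans_derivative[OF c d]] trans_derivative[OF d e] p by simp
  then have "((cmap e \<circ> cinv c) has_derivative J d e p \<circ> J c d p) (at (cmap c p))"
    by (rule has_derivative_transform_within_open[OF _ open_overlap[of c d]])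
      (use c d cinv_cmap[of c] cinv_cmap[of d] in \<open>auto simp: charts_at_iff\<close>)
  from has_derivative_unique[OF this trans_derivative[OF c e]] show ?thesis
    by (metis comp_apply)
qed

lemma J_refl:
  assumes c: "c \<in> charts_at A p"
  shows "J c c p u = u"
proof -
  have "((\<lambda>x. x) has_derivative (\<lambda>x. x)) (at (cmap c p))" by (rule has_derivative_ident)
  then have "((cmap c \<circ> cinv c) has_derivative (\<lambda>x. x)) (at (cmap c p))"
    by (rule has_derivative_transform_within_open[OF _ open_range[of c]])
      (use c cmap_cinv[of c] in \<open>auto simp: charts_at_iff\<close>)
  from has_derivative_unique[OF this trans_derivative[OF c c]] show ?thesis by metis
qed

lemma coords_E: "coords (E c u p) d = (if c \<in> charts_at A p \<and> d
    \<in> charts_at A p then J c d p u else 0)"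
  by (simp add: coord_vfield_def J_def)

lemma coords_E_same: "c \<in> charts_at A p \<Longrightarrow> coords (E c u p) c = u"
  by (simp add: coords_E J_refl)

lemma tangent_iff: "w \<in> tangent_space A p \<longleftrightarrow>
    (\<forall>c\<in>charts_at A p. \<forall>d\<in>charts_at A p. coords w d = J c d p (coords w c)) \<and>
    (\<forall>c. c \<notin> charts_at A p \<longrightarrow> coords w c = 0)"
  by (simp add: tangent_space_def J_def)

lemma tangentI:
  assumes "\<And>c d. c \<in> charts_at A p \<Longrightarrow> d \<in> charts_at A p \<Longrightarrow> coords w d = J c d p (coords w c)"
    and "\<And>c. c \<notin> charts_at A p \<Longrightarrow> coords w c = 0"
  shows "w \<in> tangent_space A p"
  using assms unfolding tangent_iff by blast

lemma tangentD:
  assumes "w \<in> tangent_space A p"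
  shows "c \<in> charts_at A p \<Longrightarrow> d \<in> charts_at A p \<Longrightarrow> coords w d = J c d p (coords w c)"
    and "c \<notin> charts_at A p \<Longrightarrow> coords w c = 0"
  using assms unfolding tangent_iff by blast+

lemma subspace_tangent: "subspace (tangent_space A p)"
proof (rule subspaceI)
  show "0 \<in> tangent_space A p"
    by (rule tangentI) (simp_all add: linear_0[OF linear_J])
  show "x + y \<in> tangent_space A p" if "x \<in> tangent_space A p" "y \<in> tangent_space A p" for x y
  proof (rule tangentI)
    fix c d assume cd: "c \<in> charts_at A p" "d \<in> charts_at A p"
    show "coords (x + y) d = J c d p (coords (x + y) c)"
      unfolding coords_simps linear_add[OF linear_J[OF cd]]
      using tangentD(1)[OF that(1) cd] tangentD(1)[OF that(2) cd] by (rule arg_cong2)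
  qed (simp add: tangentD(2)[OF that(1)] tangentD(2)[OF that(2)])
  show "a *\<^sub>R x \<in> tangent_space A p" if "x \<in> tangent_space A p" for x a
  proof (rule tangentI)
    fix c d assume cd: "c \<in> charts_at A p" "d \<in> charts_at A p"
    show "coords (a *\<^sub>R x) d = J c d p (coords (a *\<^sub>R x) c)"
      unfolding coords_simps linear_cmul[OF linear_J[OF cd]]
      using tangentD(1)[OF that cd] by (rule arg_cong)
  qed (simp add: tangentD(2)[OF that(1)])
qed

lemmas tangent_intros = subspace_add[OF subspace_tangent] subspace_diff[OF subspace_tangent]
  subspace_scale[OF subspace_tangent] subspace_0[OF subspace_tangent] subspace_sum[OF
      subspace_tangent]

text \<open>
  This is why equations between tangent vectors can be checked in one chart.
\<close>

lemma tangent_eqI: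
  assumes "u \<in> tangent_space A p" "w \<in> tangent_space A p" "c \<in> charts_at A p" "coords u c
      = coords w c"
  shows "u = w"
proof (rule tvec.expand, rule ext)
  show "coords u d = coords w d" for d
    using assms(4) tangentD(1)[OF assms(1,3)] tangentD(1)[OF assms(2,3)]
      tangentD(2)[OF assms(1)] tangentD(2)[OF assms(2)]
    by (cases "d \<in> charts_at A p") metis+
qed

lemma E_tangent: "E c u p \<in> tangent_space A p"
proof (cases "c \<in> charts_at A p")
  case True
  then show ?thesis by (intro tangentI) (simp_all add: coords_E J_comp)
next
  case False
  then have "E c u p = 0" by (intro tvec.expand ext) (simp add: coords_E)
  then show ?thesis using tangent_intros by simp
qed

lemma E_coords: "w \<in> tangent_space A p \<Longrightarrow> c \<in> charts_at A p \<Longrightarrow> E c (coords w c) p = w"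
  by (rule tangent_eqI[OF E_tangent]) (auto simp: coords_E_same)

lemma E_add: "E c (u + w) p = E c u p + E c w p"
  and E_scale: "E c (a *\<^sub>R u) p = a *\<^sub>R E c u p"
proof -
  show "E c (u + w) p = E c u p + E c w p"
    by (intro tvec.expand ext) (simp add: coords_E linear_add[OF linear_J])
  show "E c (a *\<^sub>R u) p = a *\<^sub>R E c u p"
    by (intro tvec.expand ext) (simp add: coords_E linear_cmul[OF linear_J])
qed

lemma range_chart: "c \<in> A \<Longrightarrow> z \<in> range_of c \<Longrightarrow> c \<in> charts_at A (cinv c z)"
  by (simp add: charts_at_iff cinv_in)

text \<open>
  Differentiability classes refer to all charts of the atlas, but inside the domain of a chart this
  chart suffices, as the transition maps are smooth. The same holds for vector fields below.
\<close>

lemma Ck_fun_onI: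
  assumes c: "c \<in> A" and W: "W \<subseteq> cdom c" and f: "Ck_on n (cmap c ` W) (f \<circ> cinv c)"
  shows "Ck_fun_on A n W f"
  unfolding Ck_fun_on_def
proof
  fix d assume d: "d \<in> A"
  have "Ck_on n (cmap d ` (W \<inter> cdom d)) (\<lambda>z. (f \<circ> cinv c) ((cmap c \<circ> cinv d) z))"
    using W cinv_cmap[OF d]
    by (intro Ck_on_compose[OF f] Ck_on_subset[OF smooth_trans[OF d c]]) auto
  then show "Ck_on n (cmap d ` (W \<inter> cdom d)) (f \<circ> cinv d)"
    by (rule Ck_on_cong) (use W cinv_cmap[OF d] cinv_cmap[OF c] in \<open>auto simp: subset_iff\<close>)
qed

lemma smooth_vfield_onI:
  assumes c: "c \<in> A" and W: "W \<subseteq> cdom c" and T: "\<And>p. p \<in> W \<Longrightarrow> X p \<in> tangent_space A p"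
    and X: "\<And>n. Ck_on n (cmap c ` W) (\<lambda>z. coords (X (cinv c z)) c)"
  shows "smooth_vfield_on A W X"
  unfolding smooth_vfield_on_def
proof (intro conjI ballI T)
  fix d assume d: "d \<in> A"
  let ?Z = "cmap d ` (W \<inter> cdom d)" and ?f = "cmap c \<circ> cinv d"
  show "smooth_on ?Z (\<lambda>z. coords (X (cinv d z)) d)"
  proof (rule smooth_onI)
    fix n
    have f: "Ck_on n ?Z ?f"
      by (rule Ck_on_subset[OF smooth_trans[OF d c]]) (use W in auto)
    have im: "?f ` ?Z \<subseteq> cmap c ` (cdom c \<inter> cdom d)"
      using W cinv_cmap[OF d] by auto
    have "Ck_on n ?Z (\<lambda>z. (\<lambda>z. coords (X (cinv c z)) c) (?f z))"
      by (rule Ck_on_compose[OF X f]) (use W cinv_cmap[OF d] in auto)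
    then have Xc: "Ck_on n ?Z (\<lambda>z. coords (X (cinv d z)) c)"
      by (rule Ck_on_cong) (use W cinv_cmap[OF d] cinv_cmap[OF c] in \<open>auto simp: subset_iff\<close>)
    have "Ck_on n ?Z (\<lambda>z. frechet_derivative (cmap d \<circ> cinv c) (at (?f z)) (coords (X (cinv d z))
        c))"
    proof (rule Ck_on_linear_field[OF _ _ f Xc im])
      show "linear (frechet_derivative (cmap d \<circ> cinv c) (at z))"
          if "z \<in> cmap c ` (cdom c \<inter> cdom d)" for z
        using has_derivative_linear[OF Ck_on_Suc_frechet(1)[OF smooth_trans open_overlap that]] c d
            by blast
      show "Ck_on n (cmap c ` (cdom c \<inter> cdom d))
          (\<lambda>z. frechet_derivative (cmap d \<circ> cinv c) (at z) u)" for u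
        using Ck_on_Suc_frechet(2)[OF smooth_trans open_overlap] c d by blast
    qed
    then show "Ck_on n ?Z (\<lambda>z. coords (X (cinv d z)) d)"
    proof (rule Ck_on_cong)
      fix z assume "z \<in> ?Z"
      then obtain p where p: "p \<in> W" "p \<in> cdom d" "z = cmap d p" by auto
      then have "c \<in> charts_at A p" "d \<in> charts_at A p" "cinv d z = p"
        using c d W cinv_cmap[OF d] by (auto simp: charts_at_iff)
      then show "coords (X (cinv d z)) d = frechet_derivative (cmap d \<circ> cinv c) (at (?f z)) (coords
          (X (cinv d z)) c)"
        using tangentD(1)[OF T[OF p(1)], of c d] by (simp add: J_def)
    qed
  qed
qed

lemma smooth_vfield_coords:
  assumes "smooth_vfield_on A W X" "c \<in> A"
  shows "Ck_on n (cmap c ` (W \<inter> cdom c)) (\<lambda>z. coords (X (cinv c z)) c)"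
  using assms by (auto simp: smooth_vfield_on_def smooth_on_def)

lemma smooth_vfield_tangent: "smooth_vfield_on A W X \<Longrightarrow> p \<in> W \<Longrightarrow> X p \<in> tangent_space A p"
  by (auto simp: smooth_vfield_on_def)

lemma smooth_E: "c \<in> A \<Longrightarrow> smooth_vfield_on A (cdom c) (E c u)"
proof (rule smooth_vfield_onI)
  show "Ck_on n (range_of c) (\<lambda>z. coords (E c u (cinv c z)) c)" if "c \<in> A" for n
    by (rule Ck_on_cong[OF Ck_on_const[of _ _ u]]) (use that range_chart in \<open>auto simp:
        coords_E_same\<close>)
qed (auto simp: E_tangent)

lemma smooth_vfield_subset: "smooth_vfield_on A W X \<Longrightarrow> W' \<subseteq> W \<Longrightarrow> smooth_vfield_on A W' X"
  unfolding smooth_vfield_on_def smooth_on_def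
  by (meson Ck_on_subset Int_mono image_mono order_refl subsetD)

lemma dir_deriv_chart:
  assumes c: "c \<in> charts_at A p" and w: "w \<in> tangent_space A p"
    and f: "(f \<circ> cinv c has_derivative f') (at (cmap c p))"
  shows "dir_deriv A p w f = f' (coords w c)"
proof -
  define d where "d = (SOME c. c \<in> charts_at A p)"
  have d: "d \<in> charts_at A p" unfolding d_def using ex_chart by (rule someI_ex)
  have p: "cinv d (cmap d p) = p" using d cinv_cmap[of d] by (simp add: charts_at_iff)
  have "((f \<circ> cinv c) \<circ> (cmap c \<circ> cinv d) has_derivative f' \<circ> J d c p) (at (cmap d p))"
    using diff_chain_at[OF trans_derivative[OF d c]] f p by simp
  then have "(f \<circ> cinv d has_derivative f' \<circ> J d c p) (at (cmap d p))"
    by (rule has_derivative_transform_within_open[OF _ open_overlap[of d c]])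
      (use c d cinv_cmap[of c] cinv_cmap[of d] in \<open>auto simp: charts_at_iff\<close>)
  then have "frechet_derivative (f \<circ> cinv d) (at (cmap d p)) = f' \<circ> J d c p"
    by (rule frechet_derivative_at[symmetric])
  then show ?thesis
    using tangentD(1)[OF w d c] by (simp add: dir_deriv_def Let_def flip: d_def)
qed

end

section \<open>Metric, connection and curvature in a chart\<close>

locale riemannian_mfd = smooth_mfd A
  for A :: "('m::{t2_space,second_countable_topology}, 'e::euclidean_space) chart set" +
  fixes g :: "('m, 'e) metric" and nabla :: "('m, 'e) connection"
  assumes metric: "riemannian_metric A g"
    and levi_civita: "levi_civita_connection A g nabla"
begin

lemma g_sym: "u \<in> tangent_space A p \<Longrightarrow> w \<in> tangent_space A p \<Longrightarrow> g p u w = g p w u"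
  using conjunct1[OF metric[unfolded riemannian_metric_def]] by blast

lemma g_lin: "u \<in> tangent_space A p \<Longrightarrow> u' \<in> tangent_space A p \<Longrightarrow> w \<in> tangent_space A p \<Longrightarrow>
    g p (a *\<^sub>R u + b *\<^sub>R u') w = a * g p u w + b * g p u' w"
  using conjunct1[OF conjunct2[OF metric[unfolded riemannian_metric_def]]] by blast

lemma g_pos: "u \<in> tangent_space A p \<Longrightarrow> u \<noteq> 0 \<Longrightarrow> 0 < g p u u"
  using conjunct1[OF conjunct2[OF conjunct2[OF metric[unfolded riemannian_metric_def]]]] by blast

lemma g_smooth: "open W \<Longrightarrow> smooth_vfield_on A W X \<Longrightarrow> smooth_vfield_on A W Z \<Longrightarrow>
    smooth_fun_on A W (\<lambda>p. g p (X p) (Z p))"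
  using conjunct2[OF conjunct2[OF conjunct2[OF metric[unfolded riemannian_metric_def]]]] by blast

lemma g_zero:
  assumes "w \<in> tangent_space A p"
  shows "g p 0 w = 0"
proof -
  have "0 \<in> tangent_space A p" by (intro tangent_intros)
  from g_lin[OF this this assms, where a = 0 and b = 0] show ?thesis by simp
qed

lemma tangent_eq_0I:
  assumes c: "c \<in> charts_at A p" and u: "u \<in> tangent_space A p" and z: "\<And>w. g p u (E c w p) = 0"
  shows "u = 0"
proof (rule ccontr)
  assume "u \<noteq> 0"
  then have "0 < g p u u" by (rule g_pos[OF u])
  then show False using z[of "coords u c"] E_coords[OF u c] by simp
qed

lemma torsion: "open W \<Longrightarrow> smooth_vfield_on A W X \<Longrightarrow> smooth_vfield_on A W Y \<Longrightarrow> p \<in> W \<Longrightarrow>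
    nabla p (X p) Y - nabla p (Y p) X = lie_bracket A X Y p"
  using conjunct1[OF conjunct2[OF levi_civita[unfolded levi_civita_connection_def]]] by blast

lemma metric_compat: "open W \<Longrightarrow> smooth_vfield_on A W X \<Longrightarrow> smooth_vfield_on A W Y \<Longrightarrow>
    smooth_vfield_on A W Z \<Longrightarrow> p \<in> W \<Longrightarrow> dir_deriv A p (X p) (\<lambda>q. g q (Y q) (Z q))
      = g p (nabla p (X p) Y) (Z p) + g p (Y p) (nabla p (X p) Z)"
  using conjunct2[OF conjunct2[OF levi_civita[unfolded levi_civita_connection_def]]] by blast

lemmas connection = conjunct1[OF levi_civita[unfolded levi_civita_connection_def],
    unfolded affine_connection_def, rule_format]

lemma nabla_smooth: "open W \<Longrightarrow> smooth_vfield_on A W X \<Longrightarrow> smooth_vfield_on A W Y \<Longrightarrow>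
    smooth_vfield_on A W (\<lambda>p. nabla p (X p) Y)"
  using conjunct1[OF connection] by blast

lemma nabla_linear: "open W \<Longrightarrow> smooth_vfield_on A W Y \<Longrightarrow> p \<in> W \<Longrightarrow> u \<in> tangent_space A p \<Longrightarrow>
    w \<in> tangent_space A p \<Longrightarrow> nabla p (a *\<^sub>R u + b *\<^sub>R w) Y = a *\<^sub>R nabla p u Y + b *\<^sub>R nabla p w Y"
  using conjunct1[OF conjunct2[OF connection]] by blast

lemma nabla_add: "open W \<Longrightarrow> smooth_vfield_on A W Y \<Longrightarrow> smooth_vfield_on A W Z \<Longrightarrow> p \<in> W \<Longrightarrow>
    u \<in> tangent_space A p \<Longrightarrow> nabla p u (\<lambda>q. Y q + Z q) = nabla p u Y + nabla p u Z"
  using conjunct1[OF conjunct2[OF conjunct2[OF connection]]] by blast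

lemma nabla_scale: "open W \<Longrightarrow> smooth_fun_on A W f \<Longrightarrow> smooth_vfield_on A W Y \<Longrightarrow> p \<in> W \<Longrightarrow>
    u \<in> tangent_space A p \<Longrightarrow> nabla p u (\<lambda>q. f q *\<^sub>R Y q) = dir_deriv A p u f *\<^sub>R Y p
        + f p *\<^sub>R nabla p u Y"
  using conjunct2[OF conjunct2[OF conjunct2[OF connection]]] by blast

lemma dir_deriv_const:
  assumes W: "open W" "p \<in> W" and u: "u \<in> tangent_space A p" and f: "\<And>q. q \<in> W \<Longrightarrow> f q = k"
  shows "dir_deriv A p u f = 0"
proof -
  obtain c where c: "c \<in> charts_at A p" using ex_chart by blast
  then have cA: "c \<in> A" "p \<in> cdom c" by (auto simp: charts_at_iff)
  have "(f \<circ> cinv c has_derivative (\<lambda>h. 0)) (at (cmap c p))"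
    by (rule has_derivative_transform_within_open[OF
        has_derivative_const[of k] open_cmap_image[OF cA(1) W(1)]])
      (use W cA f cinv_cmap[OF cA(1)] in auto)
  from dir_deriv_chart[OF c u this] show ?thesis .
qed

lemma smooth_fun_const:
  assumes "\<And>q. q \<in> W \<Longrightarrow> f q = k"
  shows "smooth_fun_on A W f"
  unfolding smooth_fun_on_def Ck_fun_on_def
proof (intro allI ballI)
  fix n c assume "c \<in> A"
  then show "Ck_on n (cmap c ` (W \<inter> cdom c)) (f \<circ> cinv c)"
    by (intro Ck_on_cong[OF Ck_on_const[of _ _ k]]) (use assms cinv_cmap[of c] in auto)
qed

text \<open>
  A connection is local: multiplying by the indicator function of an open set makes fields equal
  that agree on this set only, and changes no derivative inside it.
\<close>

lemma nabla_local:
  assumes W: "open W" "p \<in> W" and Y: "smooth_vfield_on A W Y" and Z: "smooth_vfield_on A W Z"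
    and u: "u \<in> tangent_space A p" and eq: "\<And>q. q \<in> W \<Longrightarrow> Y q = Z q"
  shows "nabla p u Y = nabla p u Z"
proof -
  \<comment> \<open>The two fields may differ outside \<open>W\<close>, but not after multiplication by this function.\<close>
  define f :: "'m \<Rightarrow> real" where "f q = (if q \<in> W then 1 else 0)" for q
  have f: "smooth_fun_on A W f" "dir_deriv A p u f = 0"
    using smooth_fun_const[of W f 1] dir_deriv_const[OF W u, of f 1] by (auto simp: f_def)
  have "nabla p u Y = nabla p u (\<lambda>q. f q *\<^sub>R Y q)"
    using nabla_scale[OF W(1) f(1) Y W(2) u] f(2) W(2) by (simp add: f_def)
  also have "(\<lambda>q. f q *\<^sub>R Y q) = (\<lambda>q. f q *\<^sub>R Z q)"
    using eq by (auto simp: f_def)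
  also have "nabla p u (\<lambda>q. f q *\<^sub>R Z q) = nabla p u Z"
    using nabla_scale[OF W(1) f(1) Z W(2) u] f(2) W(2) by (simp add: f_def)
  finally show ?thesis .
qed

lemma smooth_vfieldI:
  assumes "\<And>p. p \<in> W \<Longrightarrow> X p \<in> tangent_space A p"
    and "\<And>c n. c \<in> A \<Longrightarrow> Ck_on n (cmap c ` (W \<inter> cdom c)) (\<lambda>z. coords (X (cinv c z)) c)"
  shows "smooth_vfield_on A W X"
  using assms unfolding smooth_vfield_on_def smooth_on_def by blast

lemma smooth_vfield_zero: "smooth_vfield_on A W (\<lambda>q. 0)"
  by (rule smooth_vfieldI) (simp_all add: tangent_intros Ck_on_const)

lemma smooth_vfield_add:
  "smooth_vfield_on A W X \<Longrightarrow> smooth_vfield_on A W Y \<Longrightarrow> smooth_vfield_on A W (\<lambda>q. X q + Y q)"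
  by (rule smooth_vfieldI)
    (simp_all add: tangent_intros smooth_vfield_tangent Ck_on_add smooth_vfield_coords)

lemma smooth_vfield_scale:
  assumes "smooth_fun_on A W f" "smooth_vfield_on A W X"
  shows "smooth_vfield_on A W (\<lambda>q. f q *\<^sub>R X q)"
proof (rule smooth_vfieldI)
  show "f p *\<^sub>R X p \<in> tangent_space A p" if "p \<in> W" for p
    using smooth_vfield_tangent[OF assms(2) that] by (rule tangent_intros)
  fix c n assume c: "c \<in> A"
  have "Ck_on n (cmap c ` (W \<inter> cdom c)) (f \<circ> cinv c)"
    using assms(1) c unfolding smooth_fun_on_def Ck_fun_on_def by blast
  from Ck_on_scaleR[OF this smooth_vfield_coords[OF assms(2) c]]
  show "Ck_on n (cmap c ` (W \<inter> cdom c)) (\<lambda>z. coords (f (cinv c z) *\<^sub>R X (cinv c z)) c)" by simp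
qed

lemma nabla_sum:
  assumes W: "open W" "p \<in> W" and u: "u \<in> tangent_space A p"
    and "finite B" "\<And>b. b \<in> B \<Longrightarrow> smooth_fun_on A W (f b)" "\<And>b. b \<in> B \<Longrightarrow> smooth_vfield_on A W (X b)"
  shows "smooth_vfield_on A W (\<lambda>q. \<Sum>b\<in>B. f b q *\<^sub>R X b q) \<and>
    nabla p u (\<lambda>q. \<Sum>b\<in>B. f b q *\<^sub>R X b q) = (\<Sum>b\<in>B. dir_deriv A p u (f b) *\<^sub>R X b p
        + f b p *\<^sub>R nabla p u (X b))"
  using assms(4-6)
proof (induction B rule: finite_induct)
  case empty
  have "nabla p u (\<lambda>q. 0 *\<^sub>R 0) = 0"
    using nabla_scale[OF W(1) smooth_fun_const[of W "\<lambda>q. 0" 0] smooth_vfield_zero W(2) u] by simp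
  then show ?case using smooth_vfield_zero by simp
next
  case (insert b B)
  have sb: "smooth_vfield_on A W (\<lambda>q. f b q *\<^sub>R X b q)"
    using insert by (intro smooth_vfield_scale) auto
  have sB: "smooth_vfield_on A W (\<lambda>q. \<Sum>b\<in>B. f b q *\<^sub>R X b q)" using insert by auto
  show ?case
    using insert smooth_vfield_add[OF sb sB] nabla_add[OF W(1) sb sB W(2) u]
      nabla_scale[OF W(1) _ _ W(2) u, of "f b" "X b"] by simp
qed

text \<open>
  Metric and connection in the chart \<open>c\<close>, evaluated on coordinate fields.
\<close>

definition Gc :: "('m, 'e) chart \<Rightarrow> 'e \<Rightarrow> 'e \<Rightarrow> 'e \<Rightarrow> real" where
  "Gc c z u w = g (cinv c z) (E c u (cinv c z)) (E c w (cinv c z))"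

definition \<Gamma>c :: "('m, 'e) chart \<Rightarrow> 'e \<Rightarrow> 'e \<Rightarrow> 'e \<Rightarrow> 'e" where
  "\<Gamma>c c z u w = coords (nabla (cinv c z) (E c u (cinv c z)) (E c w)) c"

lemma g_chart:
  assumes "c \<in> charts_at A p" "u \<in> tangent_space A p" "w \<in> tangent_space A p"
  shows "g p u w = Gc c (cmap c p) (coords u c) (coords w c)"
  using assms cinv_cmap[of c p] by (simp add: Gc_def E_coords charts_at_iff)

text \<open>
  The axioms of a connection speak of a field of directions; a single vector \<open>u\<close> extends to the
  coordinate field with the same coordinates.
\<close>

lemma nabla_tangent:
  assumes W: "open W" "p \<in> W" and Z: "smooth_vfield_on A W Z" and u: "u \<in> tangent_space A p"
  shows "nabla p u Z \<in> tangent_space A p"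
proof -
  obtain c where c: "c \<in> charts_at A p" using ex_chart by blast
  then have cA: "c \<in> A" "p \<in> cdom c" by (auto simp: charts_at_iff)
  have "smooth_vfield_on A (W \<inter> cdom c) (\<lambda>q. nabla q (E c (coords u c) q) Z)"
    using W Z smooth_E[OF cA(1)] open_cdom[OF cA(1)]
    by (intro nabla_smooth) (auto intro: smooth_vfield_subset)
  from smooth_vfield_tangent[OF this, of p] show ?thesis
    using E_coords[OF u c] W cA by simp
qed

lemma \<Gamma>c_chart:
  assumes "c \<in> charts_at A p" "u \<in> tangent_space A p"
  shows "coords (nabla p u (E c w)) c = \<Gamma>c c (cmap c p) (coords u c) w"
  using assms cinv_cmap[of c p] by (simp add: \<Gamma>c_def E_coords charts_at_iff)

lemma \<Gamma>c_bilinear: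
  assumes c: "c \<in> A" and z: "z \<in> range_of c"
  shows "bilinear (\<Gamma>c c z)"
proof -
  let ?p = "cinv c z"
  have p: "?p \<in> cdom c" using cinv_in[OF c z] .
  note O = open_cdom[OF c] and sE = smooth_E[OF c]
  have l: "nabla ?p (E c (u + u') ?p) (E c w) = nabla ?p (E c u ?p) (E c w)
      + nabla ?p (E c u' ?p) (E c w)" for u u' w
    using nabla_linear[OF O sE p E_tangent E_tangent, of 1 c u 1 c u' w] by (simp add: E_add)
  have l': "nabla ?p (E c (a *\<^sub>R u) ?p) (E c w) = a *\<^sub>R nabla ?p (E c u ?p) (E c w)" for a u w
    using nabla_linear[OF O sE p E_tangent E_tangent, of a c u 0 c u w] by (simp add: E_scale)
  have "E c (w + w') = (\<lambda>q. E c w q + E c w' q)" "E c (a *\<^sub>R w) = (\<lambda>q. a *\<^sub>R E c w q)" for w w' a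
    by (auto simp: E_add E_scale)
  then have r: "nabla ?p (E c u ?p) (E c (w + w')) = nabla ?p (E c u ?p) (E c w)
      + nabla ?p (E c u ?p) (E c w')"
    "nabla ?p (E c u ?p) (E c (a *\<^sub>R w)) = a *\<^sub>R nabla ?p (E c u ?p) (E c w)" for u w w' a
    using nabla_add[OF O sE sE p E_tangent] nabla_scale[OF O smooth_fun_const[of _
        "\<lambda>q. a" a] sE p E_tangent]
      dir_deriv_const[OF O p E_tangent, of "\<lambda>q. a" a] by simp_all
  show ?thesis by (auto simp: bilinear_def linear_iff \<Gamma>c_def l l' r)
qed

text \<open>
  Near \<open>p\<close> the field is \<open>Z = (\<Sum>b. Z\<^sub>b E\<^sub>b)\<close> with smooth coefficients and coordinate fields \<open>E\<^sub>b\<close>. In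
  the Leibniz rule the derivatives of the \<open>Z\<^sub>b\<close> make up the first summand, and those of the \<open>E\<^sub>b\<close>
  the second.
\<close>

lemma nabla_coords:
  assumes W: "open W" "p \<in> W" and Z: "smooth_vfield_on A W Z" and c: "c \<in> charts_at A p"
    and u: "u \<in> tangent_space A p"
  shows "coords (nabla p u Z) c = frechet_derivative
      (\<lambda>z. coords (Z (cinv c z)) c) (at (cmap c p)) (coords u c)
    + \<Gamma>c c (cmap c p) (coords u c) (coords (Z p) c)"
proof -
  have cA: "c \<in> A" "p \<in> cdom c" using c by (auto simp: charts_at_iff)
  let ?W = "W \<inter> cdom c"
  let ?Z = "\<lambda>z. coords (Z (cinv c z)) c"
  let ?D = "frechet_derivative ?Z (at (cmap c p))"
  have W': "open ?W" "p \<in> ?W" using W cA open_cdom[OF cA(1)] by auto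
  define f where "f b q = coords (Z q) c \<bullet> b" for b q
  have sZ: "Ck_on n (cmap c ` ?W) ?Z" for n using smooth_vfield_coords[OF Z cA(1)] .
  have f: "smooth_fun_on A ?W (f b)" for b
    unfolding smooth_fun_on_def using sZ
    by (auto intro!: Ck_fun_onI[OF cA(1)] Ck_on_inner_left simp: f_def comp_def)
  note sE = smooth_vfield_subset[OF smooth_E[OF cA(1)], of ?W]
  have D: "(?Z has_derivative ?D) (at (cmap c p))"
    using Ck_on_Suc_frechet(1)[OF sZ open_cmap_image[OF cA(1) W(1)]] W cA by auto
  have df: "dir_deriv A p u (f b) = ?D (coords u c) \<bullet> b" for b
    by (rule dir_deriv_chart[OF c u])
      (use has_derivative_inner_left[OF D] in \<open>auto simp: f_def comp_def\<close>)
  have Zq: "Z q = (\<Sum>b\<in>Basis. f b q *\<^sub>R E c b q)" if q: "q \<in> ?W" for q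
  proof (rule tangent_eqI)
    show cq: "c \<in> charts_at A q" using cA q by (simp add: charts_at_iff)
    show "Z q \<in> tangent_space A q" using smooth_vfield_tangent[OF Z] q by auto
    show "(\<Sum>b\<in>Basis. f b q *\<^sub>R E c b q) \<in> tangent_space A q"
      by (intro tangent_intros E_tangent)
    show "coords (Z q) c = coords (\<Sum>b\<in>Basis. f b q *\<^sub>R E c b q) c"
      by (simp add: coords_E_same[OF cq] f_def euclidean_representation)
  qed
  note ns = nabla_sum[OF W' u finite_Basis, of f "E c", OF f sE]
  have "nabla p u Z = nabla p u (\<lambda>q. \<Sum>b\<in>Basis. f b q *\<^sub>R E c b q)"
    using conjunct1[OF ns] smooth_vfield_subset[OF Z] Zq by (intro nabla_local[OF W' _ _ u]) auto
  also have "\<dots> = (\<Sum>b\<in>Basis. dir_deriv A p u (f b) *\<^sub>R E c b p + f b p *\<^sub>R nabla p u (E c b))"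
    using ns by auto
  finally have "coords (nabla p u Z) c = (\<Sum>b\<in>Basis. (?D (coords u c) \<bullet> b) *\<^sub>R b)
    + (\<Sum>b\<in>Basis. (coords (Z p) c \<bullet> b) *\<^sub>R \<Gamma>c c (cmap c p) (coords u c) b)"
    by (simp add: df coords_E_same[OF c] \<Gamma>c_chart[OF c u] f_def sum.distrib)
  moreover have "linear (\<Gamma>c c (cmap c p) (coords u c))"
    using \<Gamma>c_bilinear[OF cA(1), of "cmap c p"] cA by (simp add: bilinear_def)
  ultimately show ?thesis
    using linear_basis_expansion[of "\<Gamma>c c (cmap c p) (coords u c)" "coords (Z p) c"]
    by (simp add: euclidean_representation)
qed

lemma lie_bracket_E: 
  assumes c: "c \<in> charts_at A p"
  shows "lie_bracket A (E c u) (E c w) p = 0"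
proof (rule tangent_eqI[OF _ _ c])
  have cA: "c \<in> A" "p \<in> cdom c" using c by (auto simp: charts_at_iff)
  note O = open_cdom[OF cA(1)] and sE = smooth_E[OF cA(1)]
  show "lie_bracket A (E c u) (E c w) p \<in> tangent_space A p"
    using torsion[OF O sE sE cA(2), of u w, symmetric] nabla_tangent[OF O cA(2) sE E_tangent]
    by (simp add: tangent_intros)
  have "frechet_derivative (\<lambda>z. coords (E c u (cinv c z)) c) (at (cmap c p)) = (\<lambda>h. 0)" for u
  proof -
    have "((\<lambda>z. coords (E c u (cinv c z)) c) has_derivative (\<lambda>h. 0)) (at (cmap c p))"
      by (rule has_derivative_transform_within_open[OF has_derivative_const open_range[OF cA(1)]])
        (use cA range_chart in \<open>auto simp: coords_E_same\<close>)
    then show ?thesis by (rule frechet_derivative_at[symmetric])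
  qed
  then show "coords (lie_bracket A (E c u) (E c w) p) c = coords 0 c"
    using c by (simp add: lie_bracket_def)
qed (rule tangent_intros)

text \<open>
  Symmetry of \<open>\<Gamma>\<close> is torsion-freeness for commuting coordinate fields, and the derivative of \<open>G\<close> is
  the metric property for coordinate fields.
\<close>

lemma coord_geometry_chart:
  assumes c: "c \<in> A"
  shows "coord_geometry (range_of c) (Gc c) (\<Gamma>c c)"
proof
  note O = open_cdom[OF c] and sE = smooth_E[OF c]
  show "open (range_of c)" using open_range[OF c] .
  fix z u w :: 'e and n :: nat
  let ?p = "cinv c z"
  have sG: "Ck_on n (range_of c) ((\<lambda>p. g p (E c u p) (E c w p)) \<circ> cinv c)" for u w n
  proof -
    have "Ck_on n (cmap c ` (cdom c \<inter> cdom c)) ((\<lambda>p. g p (E c u p) (E c w p)) \<circ> cinv c)"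
      using g_smooth[OF O sE sE, of u w] c unfolding smooth_fun_on_def Ck_fun_on_def by blast
    then show ?thesis by simp
  qed
  then show "Ck_on n (range_of c) (\<lambda>z. Gc c z u w)" 
    by (simp add: Gc_def[abs_def] comp_def)
  show "Ck_on n (range_of c) (\<lambda>z. \<Gamma>c c z u w)"
    using smooth_vfield_coords[OF nabla_smooth[OF O sE sE] c, of n u w] by (simp add: \<Gamma>c_def)
  assume z: "z \<in> range_of c"
  note cz = range_chart[OF c z] and p = cinv_in[OF c z]
  note cc = cmap_cinv[OF c z]
  show "Gc c z u w = Gc c z w u" unfolding Gc_def by (intro g_sym E_tangent)
  have l: "Gc c z (a *\<^sub>R u + b *\<^sub>R u') w = a * Gc c z u w + b * Gc c z u' w" for u u' w a b
    using g_lin[OF E_tangent E_tangent E_tangent] by (simp add: Gc_def E_add E_scale)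
  have s: "Gc c z u w = Gc c z w u" for u w unfolding Gc_def by (intro g_sym E_tangent)
  have lin: "linear (\<lambda>u. Gc c z u w)" for w
    using l[of 1 _ 1] l[of _ _ 0 0] by (intro linearI) auto
  then show "bilinear (Gc c z)"
    unfolding bilinear_def using s by auto
  show "0 < Gc c z u u" if "u \<noteq> 0"
  proof -
    have "E c u ?p \<noteq> 0" using coords_E_same[OF cz, of u] that by auto
    then show ?thesis unfolding Gc_def by (intro g_pos E_tangent)
  qed
  show "bilinear (\<Gamma>c c z)" using \<Gamma>c_bilinear[OF c z] .
  show "\<Gamma>c c z u w = \<Gamma>c c z w u"
    using torsion[OF O sE sE p, of u w] lie_bracket_E[OF cz] by (simp add: \<Gamma>c_def)
  fix h
  have "((\<lambda>z. Gc c z u w) has_derivative frechet_derivative (\<lambda>z. Gc c z u w) (at z)) (at z)"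
    using Ck_on_Suc_frechet(1)[OF sG open_range[OF c] z] by (simp add: Gc_def comp_def)
  then have "((\<lambda>p. g p (E c u p) (E c w p)) \<circ> cinv c has_derivative frechet_derivative
      (\<lambda>z. Gc c z u w) (at z)) (at (cmap c ?p))"
    by (simp add: Gc_def comp_def cc)
  from dir_deriv_chart[OF cz E_tangent this, of c h] 
  have "frechet_derivative (\<lambda>z. Gc c z u w) (at z) h = dir_deriv A ?p (E c h ?p)
      (\<lambda>p. g p (E c u p) (E c w p))"
    by (simp add: coords_E_same[OF cz])
  also have "\<dots> = g ?p (nabla ?p (E c h ?p) (E c u)) (E c w ?p)
      + g ?p (E c u ?p) (nabla ?p (E c h ?p) (E c w))"
    using metric_compat[OF O sE sE sE p] .
  also have "\<dots> = Gc c z (\<Gamma>c c z h u) w + Gc c z u (\<Gamma>c c z h w)"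
    using nabla_tangent[OF O p sE E_tangent]
    by (simp add: g_chart[OF cz] E_tangent coords_E_same[OF cz] cc \<Gamma>c_def)
  finally show "frechet_derivative (\<lambda>z. Gc c z u w) (at z) h = Gc c z (\<Gamma>c c z h u) w
      + Gc c z u (\<Gamma>c c z h w)" .
qed

text \<open>
  The defining property of the curvature tensor is applied to the coordinate fields with the given
  values at \<open>p\<close>; their Lie bracket vanishes, and the second covariant derivatives are computed with
  \<open>nabla_coords\<close>.
\<close>

lemma curvature_chart:
  assumes R: "curvature_tensor A nabla R" and c: "c \<in> charts_at A p"
    and "u \<in> tangent_space A p" "w \<in> tangent_space A p" "x \<in> tangent_space A p"
  shows "R p u w x \<in> tangent_space A p"
    and "coords (R p u w x) c = coord_geometry.Rm (\<Gamma>c c) (cmap c p) (coords u c) (coords w c)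
        (coords x c)"
proof -
  have cA: "c \<in> A" "p \<in> cdom c" using c by (auto simp: charts_at_iff)
  interpret coord_geometry "range_of c" "Gc c" "\<Gamma>c c" by (rule coord_geometry_chart[OF cA(1)])
  note O = open_cdom[OF cA(1)] and sE = smooth_E[OF cA(1)]
  let ?X = "E c (coords u c)" and ?Y = "E c (coords w c)" and ?Z = "E c (coords x c)"
  let ?YZ = "\<lambda>q. nabla q (?Y q) ?Z" and ?XZ = "\<lambda>q. nabla q (?X q) ?Z"
  have eq: "?X p = u" "?Y p = w" "?Z p = x" using assms E_coords by auto
  have sN: "smooth_vfield_on A (cdom c) (\<lambda>q. nabla q (E c a q) (E c b))" for a b
    using nabla_smooth[OF O sE sE] .
  have zero: "nabla p 0 ?Z = 0"
    using nabla_linear[OF O sE cA(2) E_tangent E_tangent, of 0 c 0 0 c 0] by simp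
  have R': "R p u w x = nabla p u ?YZ - nabla p w ?XZ"
    using R[unfolded curvature_tensor_def, rule_format, OF O sE sE sE cA(2), of "coords u c"
        "coords w c" "coords x c"]
      lie_bracket_E[OF c] zero by (simp add: eq)
  show "R p u w x \<in> tangent_space A p"
    unfolding R' using assms by (intro tangent_intros nabla_tangent[OF O cA(2) sN])
  have N: "coords (nabla p u (\<lambda>q. nabla q (E c a q) (E c b))) c
      = d\<Gamma> (cmap c p) a b (coords u c) + \<Gamma>c c (cmap c p) (coords u c) (\<Gamma>c c (cmap c p) a b)"
    if "u \<in> tangent_space A p" for u a b
    unfolding nabla_coords[OF O cA(2) sN c that] \<Gamma>c_chart[OF c E_tangent] coords_E_same[OF c]
    by (simp add: \<Gamma>c_def[abs_def])
  show "coords (R p u w x) c = Rm (cmap c p) (coords u c) (coords w c) (coords x c)"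
    unfolding R' Rm_def using assms by (simp add: N)
qed

text \<open>
  That the definite description in the gradient denotes something is the finite-dimensional Riesz
  theorem: by definiteness \<open>u \<mapsto> G(u, \<cdot>)\<close> is injective, hence surjective.
\<close>

lemma gradient_chart:
  assumes V: "Ck_fun_on A 2 UNIV V" and c: "c \<in> charts_at A p"
  shows "gradient A g V p \<in> tangent_space A p"
    and "Gc c (cmap c p) (coords (gradient A g V p) c) h
        = frechet_derivative (V \<circ> cinv c) (at (cmap c p)) h"
proof -
  have cA: "c \<in> A" "p \<in> cdom c" using c by (auto simp: charts_at_iff)
  interpret coord_geometry "range_of c" "Gc c" "\<Gamma>c c" by (rule coord_geometry_chart[OF cA(1)])
  let ?z = "cmap c p" and ?D = "frechet_derivative (V \<circ> cinv c) (at (cmap c p))"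
  have z: "?z \<in> range_of c" using cA by simp
  have "Ck_on (Suc 1) (range_of c) (V \<circ> cinv c)"
    using V cA by (auto simp: Ck_fun_on_def numeral_2_eq_2)
  note D = Ck_on_Suc_frechet(1)[OF this open_U z]
  have dd: "dir_deriv A p w V = ?D (coords w c)" if "w \<in> tangent_space A p" for w
    using dir_deriv_chart[OF c that D] .
  let ?f = "\<lambda>u. \<Sum>b\<in>Basis. Gc c ?z u b *\<^sub>R b"
  have "linear ?f" by (rule linearI) (simp_all add: G_lin z scaleR_add_left sum.distrib
      scaleR_sum_right)
  have fb: "?f u \<bullet> b = Gc c ?z u b" if "b \<in> Basis" for u b
    using that by (simp add: inner_sum_left inner_Basis if_distrib cong: if_cong)
  have Gz: "Gc c ?z u w = ?f u \<bullet> w" for u w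
    using linear_basis_expansion[of "Gc c ?z u" w] bil_G[OF z]
    by (simp add: bilinear_def inner_sum_left inner_sum_right inner_commute mult.commute)
  have "u = 0" if "?f u = 0" for u
    using pos_G[OF z, of u] Gz[of u u] that by auto
  then have "surj ?f"
    using \<open>linear ?f\<close> by (intro linear_injective_imp_surjective) (auto simp: linear_injective_0)
  from surjD[OF this, of "\<Sum>b\<in>Basis. ?D b *\<^sub>R b"]
  obtain u where u: "(\<Sum>b\<in>Basis. ?D b *\<^sub>R b) = ?f u" by (elim exE)
  have Gu: "Gc c ?z u w = ?D w" for w
    using trans[OF Gz arg_cong[where f="\<lambda>x. x \<bullet> w", OF u[symmetric]]]
      linear_basis_expansion[OF has_derivative_linear[OF D], of w]
    by (simp add: inner_sum_left inner_sum_right inner_commute mult.commute)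
  let ?P = "\<lambda>u. u \<in> tangent_space A p \<and> (\<forall>w\<in>tangent_space A p. g p u w = dir_deriv A p w V)"
  have P: "?P (E c u p)"
    by (auto simp: E_tangent g_chart[OF c] dd coords_E_same[OF c] Gu)
  have uniq: "u' = E c u p" if "?P u'" for u'
  proof (rule ccontr)
    let ?d = "u' - E c u p"
    have t: "?d \<in> tangent_space A p" "u' \<in> tangent_space A p" using that
        by (simp_all add: tangent_intros E_tangent)
    assume "u' \<noteq> E c u p"
    then have "0 < g p ?d ?d" using t by (intro g_pos) auto
    also have "g p ?d ?d = g p u' ?d - g p (E c u p) ?d"
      using g_lin[OF t(2) E_tangent t(1), of 1 "-1"] by simp
    also have "\<dots> = 0" using that P t by simp
    finally show False by simp
  qed
  have "?P (gradient A g V p)"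
    unfolding gradient_def by (rule theI[of ?P, OF P uniq])
  then have grad: "gradient A g V p = E c u p" by (rule uniq)
  show "gradient A g V p \<in> tangent_space A p" unfolding grad by (rule E_tangent)
  show "Gc c ?z (coords (gradient A g V p) c) h = ?D h"
    by (simp add: grad coords_E_same[OF c] Gu)
qed

lemma ext_deriv_chart:
  assumes \<omega>: "\<And>p w. w \<in> tangent_space A p \<Longrightarrow> \<omega> p w = g p (Y p) w"
    and Y: "smooth_vfield_on A UNIV Y" and S: "ext_deriv_tensor A g \<omega> S"
    and c: "c \<in> charts_at A p" and u: "u \<in> tangent_space A p"
  shows "Gc c (cmap c p) (coords (S p u) c) h =
      frechet_derivative (\<lambda>z. Gc c z (coords (Y (cinv c z)) c) h) (at (cmap c p)) (coords u c)
    - frechet_derivative (\<lambda>z. Gc c z (coords (Y (cinv c z)) c) (coords u c)) (at (cmap c p)) h"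
proof -
  have cA: "c \<in> A" "p \<in> cdom c" using c by (auto simp: charts_at_iff)
  interpret coord_geometry "range_of c" "Gc c" "\<Gamma>c c" by (rule coord_geometry_chart[OF cA(1)])
  note O = open_cdom[OF cA(1)] and sE = smooth_E[OF cA(1)]
  have z: "cmap c p \<in> range_of c" using cA by simp
  have sY: "Ck_on n (range_of c) (\<lambda>z. coords (Y (cinv c z)) c)" for n
    using smooth_vfield_coords[OF Y cA(1)] by simp
  let ?w = "\<lambda>b z. Gc c z (coords (Y (cinv c z)) c) b"
  have "Ck_on (Suc 0) (range_of c) (?w b)" for b
    by (intro Ck_on_bilinear_field[OF bil_G smooth_G Ck_on_id sY Ck_on_const]) auto
  note D = Ck_on_Suc_frechet(1)[OF this open_U z]
  have Yt: "Y q \<in> tangent_space A q" for q using smooth_vfield_tangent[OF Y] by simp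
  have dd: "dir_deriv A p w (\<lambda>q. \<omega> q (E c b q)) = frechet_derivative (?w b) (at (cmap c p)) (coords
      w c)"
    if "w \<in> tangent_space A p" for w b
  proof (rule dir_deriv_chart[OF c that])
    show "((\<lambda>q. \<omega> q (E c b q)) \<circ> cinv c has_derivative frechet_derivative (?w b) (at (cmap c p)))
        (at (cmap c p))"
      by (rule has_derivative_transform_within_open[OF D open_U z])
        (simp add: \<omega> E_tangent g_chart[OF range_chart[OF cA(1)]] Yt coords_E_same[OF range_chart[OF
            cA(1)]]
          cmap_cinv[OF cA(1)])
  qed
  have "\<omega> p 0 = 0"
    by (simp add: \<omega> tangent_intros g_chart[OF c] Yt G_lin z)
  then have "g p (S p u) (E c h p) = frechet_derivative (?w h) (at (cmap c p)) (coords u c)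
    - frechet_derivative (?w (coords u c)) (at (cmap c p)) h"
    using S[unfolded ext_deriv_tensor_def, THEN conjunct2, rule_format, OF O sE sE cA(2), of
        "coords u c" h]
    by (simp add: E_coords[OF u c] ext_deriv_def dd u E_tangent lie_bracket_E[OF c] coords_E_same[OF
        c])
  moreover have "S p u \<in> tangent_space A p" using S u by (auto simp: ext_deriv_tensor_def)
  ultimately show ?thesis
    by (simp add: g_chart[OF c] E_tangent coords_E_same[OF c])
qed

end

section \<open>Covariant derivatives along smooth curves\<close>

lemma curve_deriv_simps:
  "curve_deriv A nabla I x 2 = cov_deriv_along A nabla I x (velocity A I x)"
  "curve_deriv A nabla I x 4 = cov_deriv_along A nabla I x (cov_deriv_along A nabla I x
     (cov_deriv_along A nabla I x (velocity A I x)))"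
  by (simp_all add: curve_deriv_def eval_nat_numeral)

context smooth_mfd
begin

text \<open>
  The parameters at which the map runs in the domain of the chart. For a continuous map this is a
  relatively open subset, so derivatives within it agree with derivatives within the whole parameter
  set.
\<close>

abbreviation part :: "'a::euclidean_space set \<Rightarrow> ('a \<Rightarrow> 'm) \<Rightarrow> ('m, 'e) chart \<Rightarrow> 'a set" where
  "part S f c \<equiv> S \<inter> f -` cdom c"

lemma part_open:
  assumes "c \<in> A" "continuous_on S f"
  shows "\<exists>W. open W \<and> part S f c = S \<inter> W"
  using assms(2)[unfolded continuous_on_open_invariant, rule_format, OF open_cdom[OF assms(1)]]
  by (metis Int_commute)

lemma chart_window:
  fixes x :: "real \<Rightarrow> 'm"
  assumes x: "continuous_on I x" and t: "t \<in> I" and c: "c \<in> charts_at A (x t)"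
  shows "\<exists>d>0. x ` (I \<inter> {t - d..t + d}) \<subseteq> cdom c"
proof -
  have cA: "c \<in> A" "x t \<in> cdom c" using c by (auto simp: charts_at_iff)
  obtain W where W: "open W" "part I x c = I \<inter> W" using part_open[OF cA(1) x] by blast
  then have "t \<in> W" using t cA by auto
  then obtain d where d: "d > 0" "cball t d \<subseteq> W" using W(1) open_contains_cball by blast
  have "x s \<in> cdom c" if "s \<in> I" "s \<in> {t - d..t + d}" for s
  proof -
    have "s \<in> W" using d that by (auto simp: subset_iff dist_real_def abs_le_iff)
    then show ?thesis using W(2) that(1) by auto
  qed
  then show ?thesis using d(1) by blast
qed

lemma at_part:
  assumes "c \<in> A" "continuous_on S f" "t \<in> part S f c"
  shows "at t within part S f c = at t within S"
proof -
  obtain W where W: "open W" "part S f c = S \<inter> W" using part_open assms(1,2) by blast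
  then show ?thesis using assms(3) unfolding W(2) by (intro at_within_nhd[of _ W]) auto
qed

lemma axis_accessible_part:
  assumes "c \<in> A" "continuous_on S f" "axis_accessible S"
  shows "axis_accessible (part S f c)"
  using part_open[OF assms(1,2)] axis_accessible_open[OF assms(3)] by metis

lemma Ck_into_D: "Ck_into A n S f \<Longrightarrow> continuous_on S f"
  "Ck_into A n S f \<Longrightarrow> c \<in> A \<Longrightarrow> Ck_on n (part S f c) (cmap c \<circ> f)"
  by (auto simp: Ck_into_def)

lemma Ck_into_subset:
  assumes "Ck_into A n S f" "S' \<subseteq> S"
  shows "Ck_into A n S' f"
  unfolding Ck_into_def
proof (intro conjI ballI)
  show "continuous_on S' f" using Ck_into_D(1)[OF assms(1)] assms(2) by (rule continuous_on_subset)
  show "Ck_on n (part S' f c) (cmap c \<circ> f)" if "c \<in> A" for c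
    using Ck_into_D(2)[OF assms(1) that] by (rule Ck_on_subset) (use assms(2) in auto)
qed

lemma smooth_into_D: "smooth_into A S f \<Longrightarrow> Ck_into A n S f"
  by (auto simp: smooth_into_def)

lemma velocity_coords:
  "c \<in> charts_at A (x t) \<Longrightarrow> coords (velocity A I x t) c
      = vector_derivative (cmap c \<circ> x) (at t within I)"
  by (simp add: velocity_def)

lemma has_velocity:
  assumes "Ck_into A 1 I x" "axis_accessible I" "t \<in> I" "c \<in> charts_at A (x t)"
  shows "(cmap c \<circ> x has_vector_derivative coords (velocity A I x t) c) (at t within I)"
proof -
  have c: "c \<in> A" "t \<in> part I x c" using assms by (auto simp: charts_at_iff)
  note co = Ck_into_D(1)[OF assms(1)]
  have "Ck_on (Suc 0) (part I x c) (cmap c \<circ> x)" using Ck_into_D(2)[OF assms(1) c(1)] by simp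
  from Ck_on_real_derivative(1)[OF this axis_accessible_part[OF c(1) co assms(2)] c(2)]
  show ?thesis unfolding at_part[OF c(1) co c(2)] velocity_coords[of c x t I, OF assms(4)] .
qed

lemma velocity_tangent:
  assumes x: "Ck_into A 1 I x" "axis_accessible I" and t: "t \<in> I"
  shows "velocity A I x t \<in> tangent_space A (x t)"
proof (rule tangentI)
  fix c d assume c: "c \<in> charts_at A (x t)" and d: "d \<in> charts_at A (x t)"
  have cA: "c \<in> A" "x t \<in> cdom c" using c by (auto simp: charts_at_iff)
  note co = Ck_into_D(1)[OF x(1)]
  have tr: "(cmap d \<circ> cinv c has_derivative J c d (x t)) (at ((cmap c \<circ> x) t))"
    using trans_derivative[OF c d] by simp
  have "((\<lambda>s. (cmap d \<circ> cinv c) ((cmap c \<circ> x) s)) has_derivative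
      (\<lambda>h. J c d (x t) (h *\<^sub>R coords (velocity A I x t) c))) (at t within I)"
    using has_derivative_compose[OF has_velocity[OF x t c, unfolded has_vector_derivative_def] tr] .
  then have "((\<lambda>s. (cmap d \<circ> cinv c) ((cmap c \<circ> x) s)) has_vector_derivative
      J c d (x t) (coords (velocity A I x t) c)) (at t within part I x c)"
    unfolding has_vector_derivative_def linear_cmul[OF linear_J[OF c d]]
    by (rule has_derivative_subset) auto
  then have "(cmap d \<circ> x has_vector_derivative J c d (x t) (coords (velocity A I x t) c)) (at t
      within part I x c)"
    unfolding has_vector_derivative_def
    by (rule has_derivative_transform[rotated 2]) (use cA t cinv_cmap[OF cA(1)] in auto)
  then have "(cmap d \<circ> x has_vector_derivative J c d (x t) (coords (velocity A I x t) c)) (at t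
      within I)"
    using at_part[OF cA(1) co, of t] cA t by auto
  from vector_derivative_accessible[OF this x(2) t]
  show "coords (velocity A I x t) d = J c d (x t) (coords (velocity A I x t) c)"
    unfolding velocity_coords[of d x t I, OF d] .
qed (simp add: velocity_def)

definition smooth_field_along :: "real set \<Rightarrow> (real \<Rightarrow> 'm) \<Rightarrow> (real \<Rightarrow> ('m, 'e) tvec) \<Rightarrow> bool" where
  "smooth_field_along I x W \<longleftrightarrow> (\<forall>t\<in>I. W t \<in> tangent_space A (x t)) \<and>
    (\<forall>c\<in>A. smooth_on (part I x c) (\<lambda>t. coords (W t) c))"

end

locale smooth_curve = riemannian_mfd A g nabla
  for A :: "('m::{t2_space,second_countable_topology}, 'e::euclidean_space) chart set" and g
      and nabla +
  fixes I :: "real set" and x :: "real \<Rightarrow> 'm"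
  assumes acc_I: "axis_accessible I" and smooth_x: "smooth_into A I x"
begin

lemma cont_x: "continuous_on I x"
  using Ck_into_D(1)[OF smooth_into_D[OF smooth_x]] .

lemma coord_curve_chart:
  assumes c: "c \<in> A"
  shows "coord_curve (range_of c) (Gc c) (\<Gamma>c c) (part I x c) (cmap c \<circ> x)"
proof -
  interpret coord_geometry "range_of c" "Gc c" "\<Gamma>c c" by (rule coord_geometry_chart[OF c])
  show ?thesis
    by unfold_locales (use axis_accessible_part[OF c cont_x acc_I] Ck_into_D(2)[OF smooth_into_D[OF
        smooth_x] c]
        in \<open>auto simp: smooth_on_def\<close>)
qed

lemma velocity_v:
  assumes c: "c \<in> A" and t: "t \<in> part I x c"
  shows "coords (velocity A I x t) c = coord_curve.v (part I x c) (cmap c \<circ> x) t"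
proof -
  interpret coord_curve "range_of c" "Gc c" "\<Gamma>c c" "part I x c" "cmap c \<circ> x"
      by (rule coord_curve_chart[OF c])
  have "c \<in> charts_at A (x t)" using c t by (auto simp: charts_at_iff)
  then show ?thesis unfolding v_def at_part[OF c cont_x t] by (rule velocity_coords[of c x t I])
qed

lemma C1_x: "Ck_into A 1 I x" using smooth_into_D[OF smooth_x] .

lemma smooth_velocity: "smooth_field_along I x (velocity A I x)"
  unfolding smooth_field_along_def
proof (intro conjI ballI)
  show "velocity A I x t \<in> tangent_space A (x t)" if "t \<in> I" for t
    using velocity_tangent[OF C1_x acc_I that] .
  fix c assume c: "c \<in> A"
  interpret coord_curve "range_of c" "Gc c" "\<Gamma>c c" "part I x c" "cmap c \<circ> x"
      by (rule coord_curve_chart[OF c])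
  show "smooth_on (part I x c) (\<lambda>t. coords (velocity A I x t) c)"
    by (rule smooth_onI, rule Ck_on_cong[OF smooth_onD[OF smooth_v]]) (rule velocity_v[OF c])
qed

lemma cov_deriv_D:
  assumes c: "c \<in> A" and t: "t \<in> part I x c"
  shows "coords (cov_deriv_along A nabla I x W t) c
    = coord_curve.D (\<Gamma>c c) (part I x c) (cmap c \<circ> x) (\<lambda>s. coords (W s) c) t"
proof -
  interpret coord_curve "range_of c" "Gc c" "\<Gamma>c c" "part I x c" "cmap c \<circ> x"
      by (rule coord_curve_chart[OF c])
  have ct: "c \<in> charts_at A (x t)" using c t by (auto simp: charts_at_iff)
  have z: "(cmap c \<circ> x) t \<in> range_of c" using y_in[OF t] .
  have "coords (nabla (x t) (velocity A I x t) (E c b)) c = \<Gamma>c c ((cmap c \<circ> x) t) (v t) b" for b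
    using \<Gamma>c_chart[OF ct velocity_tangent[OF C1_x acc_I]] velocity_v[OF c t] t by auto
  moreover have "\<Gamma>c c ((cmap c \<circ> x) t) (v t) (coords (W t) c)
      = (\<Sum>b\<in>Basis. (coords (W t) c \<bullet> b) *\<^sub>R \<Gamma>c c ((cmap c \<circ> x) t) (v t) b)"
    using bil_\<Gamma>[OF z] by (intro linear_basis_expansion) (simp add: bilinear_def)
  ultimately show ?thesis
    using ct by (simp add: cov_deriv_along_def D_def at_part[OF c cont_x t])
qed

text \<open>
  The coordinate expressions \<open>u' + \<Gamma>(x', u)\<close> in two charts define the same tangent vector: the
  derivative of the transition map that appears in \<open>u'\<close> is compensated by the transformation law of
  \<open>\<Gamma>\<close>, which is the coordinate formula for \<open>\<nabla>\<close> of a coordinate field of the other chart.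
\<close>

lemma cov_deriv_tangent:
  assumes W: "smooth_field_along I x W" and t: "t \<in> I"
  shows "cov_deriv_along A nabla I x W t \<in> tangent_space A (x t)"
proof (rule tangentI)
  fix c d assume c: "c \<in> charts_at A (x t)" and d: "d \<in> charts_at A (x t)"
  have cA: "c \<in> A" "x t \<in> cdom c" and dA: "d \<in> A" "x t \<in> cdom d" using c d
      by (auto simp: charts_at_iff)
  have tc: "t \<in> part I x c" and td: "t \<in> part I x d" using cA dA t by auto
  interpret C: coord_curve "range_of c" "Gc c" "\<Gamma>c c" "part I x c" "cmap c \<circ> x"
      by (rule coord_curve_chart[OF cA(1)])
  interpret K: coord_curve "range_of d" "Gc d" "\<Gamma>c d" "part I x d" "cmap d \<circ> x"
      by (rule coord_curve_chart[OF dA(1)])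
  let ?uc = "\<lambda>s. coords (W s) c" and ?ud = "\<lambda>s. coords (W s) d"
  let ?U = "cmap c ` (cdom c \<inter> cdom d)" and ?B = "\<lambda>z. frechet_derivative (cmap d \<circ> cinv c) (at z)"
  let ?v = "velocity A I x t"
  have su: "smooth_on (part I x c) ?uc" "smooth_on (part I x d) ?ud"
    using W cA(1) dA(1) unfolding smooth_field_along_def by blast+
  have v: "?v \<in> tangent_space A (x t)" using velocity_tangent[OF C1_x acc_I t] .
  have oU: "open ?U" using open_overlap[OF cA(1) dA(1)] .
  have zU: "cmap c (x t) \<in> ?U" using cA dA by auto
  have sB: "Ck_on (Suc 0) ?U (\<lambda>z. ?B z u)" for u
    using Ck_on_Suc_frechet(2)[OF smooth_trans[OF cA(1) dA(1)] oU] .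
  define B' where "B' u = frechet_derivative (\<lambda>z. ?B z u) (at (cmap c (x t)))" for u
  have B': "((\<lambda>z. ?B z u) has_derivative B' u) (at (cmap c (x t)))" for u
    unfolding B'_def using Ck_on_Suc_frechet(1)[OF sB oU zU] .
  have linB: "linear (?B z)" if "z \<in> ?U" for z
    using has_derivative_linear[OF Ck_on_Suc_frechet(1)[OF smooth_trans[OF cA(1) dA(1)] oU that]] .
  have BJ: "?B (cmap c (x s)) u = J c d (x s) u" for s u by (simp add: J_def)
  have vc: "coords ?v c = C.v t" and vdd: "coords ?v d = K.v t"
    using velocity_v[OF cA(1) tc] velocity_v[OF dA(1) td] by auto
  have "((\<lambda>s. ?B ((cmap c \<circ> x) s) (?uc s)) has_vector_derivative
      B' (?uc t) (C.v t) + ?B ((cmap c \<circ> x) t) (C.vd ?uc t)) (at t within part I x c)"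
    by (rule has_vector_derivative_linear_field[OF oU _ linB, where y = "cmap c \<circ> x" and B' = B'])
      (use zU B' C.has_v[OF tc] C.has_vd[OF su(1) tc] tc in auto)
  then have 1: "((\<lambda>s. ?B ((cmap c \<circ> x) s) (?uc s)) has_vector_derivative
      B' (?uc t) (C.v t) + J c d (x t) (C.vd ?uc t)) (at t within I)"
    unfolding at_part[OF cA(1) cont_x tc] by (simp add: BJ)
  have "((\<lambda>s. ?B ((cmap c \<circ> x) s) (?uc s)) has_vector_derivative
      B' (?uc t) (C.v t) + J c d (x t) (C.vd ?uc t)) (at t within (part I x c \<inter> part I x d))"
    by (rule has_vector_derivative_within_subset[OF 1]) auto
  then have "(?ud has_vector_derivative
      B' (?uc t) (C.v t) + J c d (x t) (C.vd ?uc t)) (at t within (part I x c \<inter> part I x d))"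
    unfolding has_vector_derivative_def
  proof (rule has_derivative_transform[rotated 2])
    show "t \<in> part I x c \<inter> part I x d" using tc td by auto
    show "?ud s = ?B ((cmap c \<circ> x) s) (?uc s)" if "s \<in> part I x c \<inter> part I x d" for s
      using that W tangentD(1)[of "W s" "x s" c d] cA(1) dA(1)
      by (auto simp: smooth_field_along_def BJ charts_at_iff)
  qed
  moreover have "at t within (part I x c \<inter> part I x d) = at t within I"
  proof -
    obtain O1 O2 where "open O1" "part I x c = I \<inter> O1" "open O2" "part I x d = I \<inter> O2"
      using part_open[OF cA(1) cont_x] part_open[OF dA(1) cont_x] by metis
    then show ?thesis using tc td by (intro at_within_nhd[of _ "O1 \<inter> O2"]) auto
  qed
  ultimately have "(?ud has_vector_derivative B' (?uc t) (C.v t)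
      + J c d (x t) (C.vd ?uc t)) (at t within I)"
    by simp
  from vector_derivative_accessible[OF this acc_I t]
  have ud': "K.vd ?ud t = B' (?uc t) (C.v t) + J c d (x t) (C.vd ?uc t)"
    by (simp add: at_part[OF dA(1) cont_x td])
  let ?N = "nabla (x t) ?v (E c (?uc t))"
  note O = open_cdom[OF cA(1)] and sE = smooth_E[OF cA(1)]
  have Nt: "?N \<in> tangent_space A (x t)" using nabla_tangent[OF O cA(2) sE v] .
  have "frechet_derivative (\<lambda>z. coords (E c u (cinv d z)) d) (at (cmap d (x t))) (K.v t)
      = B' u (C.v t)" for u
  proof -
    have p: "cinv d (cmap d (x t)) = x t" using cinv_cmap[OF dA] .
    have "((\<lambda>z. ?B z u) \<circ> (cmap c \<circ> cinv d) has_derivative B' u \<circ> J d c (x t)) (at (cmap d (x t)))"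
      using diff_chain_at[OF trans_derivative[OF d c], of "\<lambda>z. ?B z u" "B' u"] B'[of u] p by simp
    then have "((\<lambda>z. coords (E c u (cinv d z)) d)
        has_derivative B' u \<circ> J d c (x t)) (at (cmap d (x t)))"
      by (rule has_derivative_transform_within_open[OF _ open_overlap[OF dA(1) cA(1)]])
        (use cA dA cinv_cmap[OF dA(1)] in \<open>auto simp: coords_E charts_at_iff J_def\<close>)
    then have "frechet_derivative (\<lambda>z. coords (E c u (cinv d z)) d) (at (cmap d (x t)))
        = B' u \<circ> J d c (x t)"
      by (rule frechet_derivative_at[symmetric])
    then show ?thesis using tangentD(1)[OF v d c] by (simp add: vc vdd)
  qed
  then have Nd: "coords ?N d = B' (?uc t) (C.v t) + \<Gamma>c d (cmap d (x t)) (K.v t) (?ud t)"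
    using nabla_coords[OF O cA(2) sE d v] W t tangentD(1)[of "W t" "x t", OF _ c d] c d
    by (simp add: vdd coords_E smooth_field_along_def)
  have Nc: "coords ?N c = \<Gamma>c c (cmap c (x t)) (C.v t) (?uc t)"
    using \<Gamma>c_chart[OF c v] by (simp add: vc)
  have "coords (cov_deriv_along A nabla I x W t) d = K.vd ?ud t
      + \<Gamma>c d (cmap d (x t)) (K.v t) (?ud t)"
    unfolding cov_deriv_D[OF dA(1) td] K.D_def by simp
  also have "\<dots> = J c d (x t) (C.vd ?uc t) + J c d (x t) (coords ?N c)"
    using Nd tangentD(1)[OF Nt c d] by (simp add: ud')
  also have "\<dots> = J c d (x t) (coords (cov_deriv_along A nabla I x W t) c)"
    unfolding cov_deriv_D[OF cA(1) tc] C.D_def Nc by (simp add: linear_add[OF linear_J[OF c d]])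
  finally show "coords (cov_deriv_along A nabla I x W t) d
      = J c d (x t) (coords (cov_deriv_along A nabla I x W t) c)" .
qed (simp add: cov_deriv_along_def)

lemma smooth_cov_deriv:
  assumes W: "smooth_field_along I x W"
  shows "smooth_field_along I x (cov_deriv_along A nabla I x W)"
  unfolding smooth_field_along_def
proof (intro conjI ballI)
  show "cov_deriv_along A nabla I x W t \<in> tangent_space A (x t)" if "t \<in> I" for t
    using cov_deriv_tangent[OF W that] .
  fix c assume c: "c \<in> A"
  interpret coord_curve "range_of c" "Gc c" "\<Gamma>c c" "part I x c" "cmap c \<circ> x"
      by (rule coord_curve_chart[OF c])
  have "smooth_on (part I x c) (\<lambda>t. coords (W t) c)" using W c
      by (auto simp: smooth_field_along_def)
  from smooth_D[OF this]
  show "smooth_on (part I x c) (\<lambda>t. coords (cov_deriv_along A nabla I x W t) c)"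
    by (intro smooth_onI, rule Ck_on_cong[OF smooth_onD]) (rule cov_deriv_D[OF c])
qed

lemma curve_deriv_tangent:
  "t \<in> I \<Longrightarrow> curve_deriv A nabla I x 2 t \<in> tangent_space A (x t)"
  "t \<in> I \<Longrightarrow> curve_deriv A nabla I x 4 t \<in> tangent_space A (x t)"
  unfolding curve_deriv_simps
  by (intro cov_deriv_tangent smooth_cov_deriv smooth_velocity; assumption)+

text \<open>
  Inside a chart all the covariant derivatives of the velocity are iterates of the coordinate
  operator \<open>D\<close>. The inner derivatives agree with their coordinate versions on the whole part of the
  curve in the chart, which is what is needed to differentiate them again.
\<close>

lemma curve_deriv_coords:
  assumes c: "c \<in> A" and t: "t \<in> part I x c"
  defines "D \<equiv> coord_curve.D (\<Gamma>c c) (part I x c) (cmap c \<circ> x)"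
    and "v \<equiv> coord_curve.v (part I x c) (cmap c \<circ> x)"
  shows "coords (curve_deriv A nabla I x 2 t) c = D v t"
    and "coords (curve_deriv A nabla I x 4 t) c = D (D (D v)) t"
proof -
  interpret C: coord_curve "range_of c" "Gc c" "\<Gamma>c c" "part I x c" "cmap c \<circ> x"
      by (rule coord_curve_chart[OF c])
  have cong: "D u t = D w t" if "\<And>s. s \<in> part I x c \<Longrightarrow> u s = w s" "t \<in> part I x c" for u w t
  proof -
    have "eventually (\<lambda>s. s \<in> part I x c \<longrightarrow> u s = w s) (nhds t)" using that
        by (auto intro: always_eventually)
    then have "C.vd u t = C.vd w t" by (rule vector_derivative_cong_eq) (use that in auto)
    then show ?thesis unfolding D_def C.D_def using that by simp
  qed
  have 2: "coords (cov_deriv_along A nabla I x (velocity A I x) s) c = D v s" if "s \<in> part I x c"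
      for s
    unfolding cov_deriv_D[OF c that] D_def[symmetric] v_def
    by (rule cong[OF _ that]) (rule velocity_v[OF c])
  then show "coords (curve_deriv A nabla I x 2 t) c = D v t" using t
      by (simp add: curve_deriv_simps)
  have 3: "coords (cov_deriv_along A nabla I x (cov_deriv_along A nabla I x (velocity A I x)) s) c
      = D (D v) s"
    if "s \<in> part I x c" for s
    unfolding cov_deriv_D[OF c that] D_def[symmetric] by (rule cong[OF _ that]) (rule 2)
  have "coords (cov_deriv_along A nabla I x (cov_deriv_along A nabla I x (cov_deriv_along A nabla I
      x (velocity A I x))) t) c
     = D (D (D v)) t"
    unfolding cov_deriv_D[OF c t] D_def[symmetric] by (rule cong[OF _ t]) (rule 3)
  then show "coords (curve_deriv A nabla I x 4 t) c = D (D (D v)) t"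
      by (simp add: curve_deriv_simps)
qed

end

section \<open>Dependence of the derivatives on the interval\<close>

context riemannian_mfd
begin

text \<open>
  Velocity and acceleration at \<open>t\<close> depend on the curve near \<open>t\<close> only, and the set of times matters
  only near \<open>t\<close>. This is used both to pass from \<open>[0, T]\<close> to a subinterval, at its interior points,
  and to compare a varied curve with the original one outside the support of the variation.
\<close>

lemma velocity_germ:
  assumes W: "open W" "t \<in> W" and I: "I1 \<inter> W = I2 \<inter> W" "t \<in> I1"
    and eq: "\<And>s. s \<in> I1 \<inter> W \<Longrightarrow> x1 s = x2 s"
  shows "velocity A I1 x1 t = velocity A I2 x2 t"
proof (rule tvec.expand, rule ext)
  fix c :: "('m, 'e) chart"
  have "at t within J = at t within (J \<inter> W)" for J
    using W by (intro at_within_nhd[of _ W]) auto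
  then have at: "at t within I1 = at t within (I1 \<inter> W)" "at t within I2 = at t within (I1 \<inter> W)"
    using I(1) by metis+
  have "vector_derivative (cmap c \<circ> x1) (at t within (I1 \<inter> W))
      = vector_derivative (cmap c \<circ> x2) (at t within (I1 \<inter> W))"
    by (rule vector_derivative_cong_eq) (use eq W I in \<open>auto intro: always_eventually\<close>)
  then show "coords (velocity A I1 x1 t) c = coords (velocity A I2 x2 t) c"
    using eq[OF IntI[OF I(2) W(2)]] by (simp add: velocity_def at)
qed

lemma acceleration_germ:
  assumes W: "open W" "t \<in> W" and I: "I1 \<inter> W = I2 \<inter> W" "t \<in> I1"
    and eq: "\<And>s. s \<in> I1 \<inter> W \<Longrightarrow> x1 s = x2 s"
  shows "curve_deriv A nabla I1 x1 2 t = curve_deriv A nabla I2 x2 2 t"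
proof (rule tvec.expand, rule ext)
  fix c :: "('m, 'e) chart"
  have vel: "velocity A I1 x1 s = velocity A I2 x2 s" if "s \<in> I1 \<inter> W" for s
    using velocity_germ[OF W(1) _ I(1) _ eq, of s] that by auto
  have "at t within J = at t within (J \<inter> W)" for J
    using W by (intro at_within_nhd[of _ W]) auto
  then have at: "at t within I1 = at t within (I1 \<inter> W)" "at t within I2 = at t within (I1 \<inter> W)"
    using I(1) by metis+
  have "vector_derivative (\<lambda>s. coords (velocity A I1 x1 s) c) (at t within (I1 \<inter> W))
      = vector_derivative (\<lambda>s. coords (velocity A I2 x2 s) c) (at t within (I1 \<inter> W))"
    by (rule vector_derivative_cong_eq) (use vel W I in \<open>auto intro: always_eventually\<close>)
  then show "coords (curve_deriv A nabla I1 x1 2 t) c = coords (curve_deriv A nabla I2 x2 2 t) c"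
    using eq[OF IntI[OF I(2) W(2)]] vel[OF IntI[OF I(2) W(2)]]
    by (simp add: curve_deriv_simps(1) cov_deriv_along_def at)
qed

text \<open>
  At an endpoint of a subinterval the derivative becomes one-sided; for a curve of class \<open>C\<^sup>1\<close> on
  the bigger interval this does not change its value.
\<close>

lemma velocity_restrict:
  assumes x: "Ck_into A 1 I x" "axis_accessible I" and I': "I' \<subseteq> I" "axis_accessible I'" "t \<in> I'"
  shows "velocity A I' x t = velocity A I x t"
proof (rule tvec.expand, rule ext)
  fix c :: "('m, 'e) chart"
  show "coords (velocity A I' x t) c = coords (velocity A I x t) c"
  proof (cases "c \<in> charts_at A (x t)")
    case True
    have "(cmap c \<circ> x has_vector_derivative coords (velocity A I x t) c) (at t within I')"
      using has_velocity[OF x _ True] I' by (auto intro: has_vector_derivative_within_subset)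
    from vector_derivative_accessible[OF this I'(2,3)] show ?thesis
      unfolding velocity_coords[of c x t I', OF True] .
  qed (simp add: velocity_def)
qed

end

context smooth_curve
begin

lemma smooth_curve_restrict: "I' \<subseteq> I \<Longrightarrow> axis_accessible I' \<Longrightarrow> smooth_curve A g nabla I' x"
  using Ck_into_subset[OF smooth_into_D[OF smooth_x]] by unfold_locales (auto simp: smooth_into_def)

lemma cov_deriv_restrict:
  assumes I': "I' \<subseteq> I" "axis_accessible I'" "t \<in> I'"
    and W: "smooth_field_along I x W" and eq: "\<And>s. s \<in> I' \<Longrightarrow> W' s = W s"
  shows "cov_deriv_along A nabla I' x W' t = cov_deriv_along A nabla I x W t"
proof (rule tvec.expand, rule ext)
  fix c :: "('m, 'e) chart"
  show "coords (cov_deriv_along A nabla I' x W' t) c = coords (cov_deriv_along A nabla I x W t) c"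
  proof (cases "c \<in> charts_at A (x t)")
    case True
    then have c: "c \<in> A" and t: "t \<in> part I x c" using I' by (auto simp: charts_at_iff)
    interpret coord_curve "range_of c" "Gc c" "\<Gamma>c c" "part I x c" "cmap c \<circ> x"
        by (rule coord_curve_chart[OF c])
    have "smooth_on (part I x c) (\<lambda>t. coords (W t) c)" using W c
        by (auto simp: smooth_field_along_def)
    from has_vd[OF this t] have 1: "((\<lambda>s. coords (W s) c) has_vector_derivative
        vector_derivative (\<lambda>s. coords (W s) c) (at t within I)) (at t within I)"
      unfolding at_part[OF c cont_x t] .
    have "vector_derivative (\<lambda>s. coords (W' s) c) (at t within I') = vector_derivative
        (\<lambda>s. coords (W s) c) (at t within I')"
      by (rule vector_derivative_cong_eq) (use eq I' in \<open>auto intro: always_eventually\<close>)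
    also have "\<dots> = vector_derivative (\<lambda>s. coords (W s) c) (at t within I)"
      by (rule vector_derivative_accessible[OF
          has_vector_derivative_within_subset[OF 1 I'(1)] I'(2,3)])
    finally show ?thesis
      using velocity_restrict[OF C1_x acc_I I'] eq[OF I'(3)] by (simp add: cov_deriv_along_def)
  qed (simp add: cov_deriv_along_def)
qed

lemma curve_deriv_restrict:
  assumes I': "I' \<subseteq> I" "axis_accessible I'" and t: "t \<in> I'"
  shows "curve_deriv A nabla I' x 2 t = curve_deriv A nabla I x 2 t"
    and "curve_deriv A nabla I' x 4 t = curve_deriv A nabla I x 4 t"
proof -
  have 1: "cov_deriv_along A nabla I' x (velocity A I' x) s
      = cov_deriv_along A nabla I x (velocity A I x) s"
    if "s \<in> I'" for s
    using that by (intro cov_deriv_restrict I' smooth_velocity velocity_restrict[OF C1_x acc_I])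
  have 2: "cov_deriv_along A nabla I' x (cov_deriv_along A nabla I' x (velocity A I' x)) s
    = cov_deriv_along A nabla I x (cov_deriv_along A nabla I x (velocity A I x)) s" if "s \<in> I'"
        for s
    using that by (intro cov_deriv_restrict I' smooth_velocity smooth_cov_deriv 1)
  show "curve_deriv A nabla I' x 2 t = curve_deriv A nabla I x 2 t"
    using 1[OF t] by (simp add: curve_deriv_simps(1))
  have "cov_deriv_along A nabla I' x (cov_deriv_along A nabla I' x (cov_deriv_along A nabla I' x
      (velocity A I' x))) t
    = cov_deriv_along A nabla I x (cov_deriv_along A nabla I x (cov_deriv_along A nabla I x
        (velocity A I x))) t"
    using t by (intro cov_deriv_restrict I' smooth_velocity smooth_cov_deriv 2)
  then show "curve_deriv A nabla I' x 4 t = curve_deriv A nabla I x 4 t"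
    by (simp add: curve_deriv_simps)
qed

end

section \<open>The Lagrangian and the Euler-Lagrange expression\<close>

text \<open>
  The geometric data of the problem on the time interval \<open>[0, \<tau>]\<close> with fixed multipliers \<open>\<mu>\<close>.
\<close>

locale constrained_problem = riemannian_mfd A g nabla
  for A :: "('m::{t2_space,second_countable_topology}, 'e::euclidean_space) chart set" and g
      and nabla +
  fixes R :: "'m \<Rightarrow> ('m, 'e) tvec \<Rightarrow> ('m, 'e) tvec \<Rightarrow> ('m, 'e) tvec \<Rightarrow> ('m, 'e) tvec"
    and \<sigma> :: real and V :: "'m \<Rightarrow> real" and k :: nat
    and \<omega> :: "nat \<Rightarrow> 'm \<Rightarrow> ('m, 'e) tvec \<Rightarrow> real" and Y :: "nat \<Rightarrow> ('m, 'e) vfield"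
    and S :: "nat \<Rightarrow> 'm \<Rightarrow> ('m, 'e) tvec \<Rightarrow> ('m, 'e) tvec"
    and \<tau> :: real and \<mu> :: "nat \<Rightarrow> real \<Rightarrow> real"
  assumes curvature: "curvature_tensor A nabla R"
    and V: "Ck_fun_on A 2 UNIV V"
    and Y: "\<And>j. j \<in> {1..k} \<Longrightarrow> smooth_vfield_on A UNIV (Y j)"
    and \<omega>: "\<And>j p z. j \<in> {1..k} \<Longrightarrow> z \<in> tangent_space A p \<Longrightarrow> \<omega> j p z = g p (Y j p) z"
    and S: "\<And>j. j \<in> {1..k} \<Longrightarrow> ext_deriv_tensor A g (\<omega> j) (S j)"
    and \<tau>: "0 < \<tau>"
    and \<mu>: "\<And>j. j \<in> {1..k} \<Longrightarrow> smooth_on {0..\<tau>} (\<mu> j)"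
begin

definition lagrangian :: "real set \<Rightarrow> (real \<Rightarrow> 'm) \<Rightarrow> real \<Rightarrow> real" where
  "lagrangian I x t = (let v = velocity A I x t; a = curve_deriv A nabla I x 2 t in
       g (x t) a a + \<sigma> * g (x t) v v + V (x t) + (\<Sum>j=1..k. \<mu> j t * g (x t) (Y j (x t)) v))"

text \<open>
  The multipliers in the equation are half of those in the functional, in which the constraints are
  multiplied by \<open>1/2\<close> together with the other terms.
\<close>

definition euler_lagrange :: "real set \<Rightarrow> (real \<Rightarrow> 'm) \<Rightarrow> real \<Rightarrow> ('m, 'e) tvec" where
  "euler_lagrange I x t = (let v = velocity A I x t; a = curve_deriv A nabla I x 2 t in
     curve_deriv A nabla I x 4 t + R (x t) a v v - \<sigma> *\<^sub>R a + (1 / 2) *\<^sub>R gradient A g V (x t)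
       - (\<Sum>j=1..k. (vector_derivative (\<mu> j) (at t within {0..\<tau>}) / 2) *\<^sub>R Y j (x t))
       - (\<Sum>j=1..k. (\<mu> j t / 2) *\<^sub>R S j (x t) v))"

abbreviation gradc :: "('m, 'e) chart \<Rightarrow> 'e \<Rightarrow> 'e" where
  "gradc c \<equiv> (\<lambda>z. coords (gradient A g V (cinv c z)) c)"
abbreviation Yc :: "('m, 'e) chart \<Rightarrow> nat \<Rightarrow> 'e \<Rightarrow> 'e" where
  "Yc c \<equiv> (\<lambda>j z. coords (Y j (cinv c z)) c)"
abbreviation Sc :: "('m, 'e) chart \<Rightarrow> nat \<Rightarrow> 'e \<Rightarrow> 'e \<Rightarrow> 'e" where
  "Sc c \<equiv> (\<lambda>j z u. coords (S j (cinv c z) (E c u (cinv c z))) c)"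

lemma Y_tangent: "j \<in> {1..k} \<Longrightarrow> Y j p \<in> tangent_space A p"
  using smooth_vfield_tangent[OF Y] by simp

lemma S_tangent: "j \<in> {1..k} \<Longrightarrow> u \<in> tangent_space A p \<Longrightarrow> S j p u \<in> tangent_space A p"
  using S by (auto simp: ext_deriv_tensor_def)

lemma coord_lagrangian_chart:
  assumes x: "smooth_curve A g nabla I x" and I: "I \<subseteq> {0..\<tau>}" and c: "c \<in> A"
  shows "coord_lagrangian (range_of c) (Gc c) (\<Gamma>c c) (part I x c) (cmap c \<circ> x) (V \<circ> cinv c)
    (gradc c) {1..k} \<mu> (Yc c) (Sc c)"
proof -
  interpret smooth_curve A g nabla I x by (rule x)
  interpret coord_curve "range_of c" "Gc c" "\<Gamma>c c" "part I x c" "cmap c \<circ> x"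
      by (rule coord_curve_chart[OF c])
  show ?thesis
  proof
    show "Ck_on 2 (range_of c) (V \<circ> cinv c)" using V c by (auto simp: Ck_fun_on_def)
    show "Gc c z (gradc c z) h = frechet_derivative (V \<circ> cinv c) (at z) h" if "z \<in> range_of c"
        for z h
      using gradient_chart(2)[OF V range_chart[OF c that], of h] cmap_cinv[OF c that] by simp
    show "smooth_on (part I x c) (\<mu> j)" if "j \<in> {1..k}" for j
      using \<mu>[OF that] I unfolding smooth_on_def by (blast intro: Ck_on_subset)
    show "Ck_on n (range_of c) (Yc c j)" if "j \<in> {1..k}" for j n
      using smooth_vfield_coords[OF Y[OF that] c] by simp
    show "Gc c z (Sc c j z u) h = frechet_derivative (\<lambda>z. Gc c z (Yc c j z) h) (at z) u
        - frechet_derivative (\<lambda>z. Gc c z (Yc c j z) u) (at z) h"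
      if j: "j \<in> {1..k}" and z: "z \<in> range_of c" for j z u h
      using ext_deriv_chart[OF \<omega>[OF j] Y[OF j] S[OF j] range_chart[OF c z] E_tangent[of c u], of h]
        cmap_cinv[OF c z] coords_E_same[OF range_chart[OF c z]] by simp
  qed
qed

lemma euler_lagrange_chart:
  assumes x: "smooth_curve A g nabla I x" and I: "I \<subseteq> {0..\<tau>}" and c: "c \<in> A" and t: "t \<in> part I x c"
  shows "euler_lagrange I x t \<in> tangent_space A (x t)"
    and "coords (euler_lagrange I x t) c = coord_lagrangian.EL (\<Gamma>c c) (part I x c) (cmap c \<circ> x) \<sigma>
      (gradc c) {1..k} \<mu> (Yc c) (Sc c) t"
proof -
  interpret smooth_curve A g nabla I x by (rule x)
  interpret L: coord_lagrangian "range_of c" "Gc c" "\<Gamma>c c" "part I x c" "cmap c \<circ> x" \<sigma> "V \<circ> cinv c"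
    "gradc c" "{1..k}" \<mu> "Yc c" "Sc c" by (rule coord_lagrangian_chart[OF x I c])
  have ct: "c \<in> charts_at A (x t)" using c t by (auto simp: charts_at_iff)
  have tI: "t \<in> I" using t by auto
  have p: "cinv c (cmap c (x t)) = x t" using cinv_cmap[OF c] t by auto
  note v = velocity_tangent[OF C1_x acc_I tI] and a = curve_deriv_tangent[OF tI]
  note R = curvature_chart[OF curvature ct a(1) v v]
  note gr = gradient_chart(1)[OF V ct]
  show "euler_lagrange I x t \<in> tangent_space A (x t)"
    unfolding euler_lagrange_def Let_def
    by (intro tangent_intros v a R gr Y_tangent S_tangent)
  have "L.vd (\<mu> j) t = vector_derivative (\<mu> j) (at t within {0..\<tau>})" if "j \<in> {1..k}" for j
  proof -
    have "(\<mu> j has_vector_derivative vector_derivative (\<mu> j) (at t within {0..\<tau>})) (at t within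
        {0..\<tau>})"
      using smooth_on_vector_derivative(1)[OF \<mu>[OF that] axis_accessible_Icc[OF \<tau>], of t] tI I
          by auto
    then have "(\<mu> j has_vector_derivative vector_derivative (\<mu> j) (at t within {0..\<tau>})) (at t within
        part I x c)"
      by (rule has_vector_derivative_within_subset) (use I in auto)
    from vector_derivative_accessible[OF this L.acc t] show ?thesis .
  qed
  note \<mu>' = this[symmetric]
  note cv = velocity_v[OF c t] and ca = curve_deriv_coords[OF c t]
  have Sv: "coords (S j (x t) (velocity A I x t)) c = Sc c j (cmap c (x t)) (L.v t)" for j
    using E_coords[OF v ct] by (simp add: p cv)
  show "coords (euler_lagrange I x t) c = L.EL t"
    unfolding euler_lagrange_def Let_def L.EL_def coords_simps coords_sum R(2) cv ca Sv
    by (simp add: p \<mu>')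
qed

lemma lagrangian_chart:
  assumes x: "smooth_curve A g nabla I x" and I: "I \<subseteq> {0..\<tau>}" and c: "c \<in> A" and t: "t \<in> part I x c"
  shows "lagrangian I x t = coord_lagrangian.lagr (Gc c) (\<Gamma>c c) \<sigma> (V \<circ> cinv c) {1..k} \<mu> (Yc c) t
    ((cmap c \<circ> x) t) (coord_curve.v (part I x c) (cmap c \<circ> x) t)
    (vector_derivative (coord_curve.v (part I x c) (cmap c \<circ> x)) (at t within part I x c))"
proof -
  interpret smooth_curve A g nabla I x by (rule x)
  interpret L: coord_lagrangian "range_of c" "Gc c" "\<Gamma>c c" "part I x c" "cmap c \<circ> x" \<sigma> "V \<circ> cinv c"
    "gradc c" "{1..k}" \<mu> "Yc c" "Sc c" by (rule coord_lagrangian_chart[OF x I c])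
  have ct: "c \<in> charts_at A (x t)" using c t by (auto simp: charts_at_iff)
  have tI: "t \<in> I" using t by auto
  have p: "cinv c (cmap c (x t)) = x t" using cinv_cmap[OF c] t by auto
  note v = velocity_tangent[OF C1_x acc_I tI] and a = curve_deriv_tangent[OF tI]
  note cv = velocity_v[OF c t] and ca = curve_deriv_coords[OF c t]
  show ?thesis
    unfolding lagrangian_def Let_def L.lagr_def
    using v a Y_tangent by (simp add: g_chart[OF ct] cv ca L.D_def p)
qed

text \<open>
  The Lagrangian along the varied curves is known to be \<open>C\<^sup>1\<close>; the continuity along \<open>x\<close> itself is
  the case of the zero variation.
\<close>

lemma continuous_on_lagrangian:
  assumes x: "smooth_curve A g nabla I x" and I: "I \<subseteq> {0..\<tau>}"
  shows "continuous_on I (lagrangian I x)"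
proof (rule continuous_on_locally)
  interpret smooth_curve A g nabla I x by (rule x)
  fix t assume t: "t \<in> I"
  obtain c where "c \<in> charts_at A (x t)" using ex_chart by blast
  then have c: "c \<in> A" "x t \<in> cdom c" by (auto simp: charts_at_iff)
  interpret L: coord_lagrangian "range_of c" "Gc c" "\<Gamma>c c" "part I x c" "cmap c \<circ> x" \<sigma> "V \<circ> cinv c"
    "gradc c" "{1..k}" \<mu> "Yc c" "Sc c" by (rule coord_lagrangian_chart[OF x I c(1)])
  obtain W where W: "open W" "part I x c = I \<inter> W" using part_open[OF c(1) cont_x] by blast
  have 0: "smooth_on (part I x c) (\<lambda>t. 0 :: 'e)" by (rule smooth_onI, rule Ck_on_const)
  have "Ck_on 1 ({-1<..<1} \<times> part I x c) (\<lambda>(r, t). L.lagr t ((cmap c \<circ> x) t + r *\<^sub>R 0) (L.v t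
      + r *\<^sub>R L.vd (\<lambda>t. 0) t)
      (L.vd L.v t + r *\<^sub>R L.vd (L.vd (\<lambda>t. 0)) t))"
    by (rule L.Ck_on_lagr[OF 0]) (use L.y_in in auto)
  note K = Ck_on_imp_continuous_on[OF this]
  have "continuous_on (part I x c) (\<lambda>t. (0 :: real, t))"
    by (intro continuous_on_Pair continuous_on_const continuous_on_id)
  from continuous_on_compose2[OF K this]
  have "continuous_on (part I x c) (\<lambda>t. L.lagr t ((cmap c \<circ> x) t) (L.v t) (L.vd L.v t))"
    by (simp add: image_subset_iff)
  then have "continuous_on (part I x c) (lagrangian I x)"
    by (rule continuous_on_eq) (rule lagrangian_chart[OF x I c(1), symmetric])
  then show "\<exists>W. open W \<and> t \<in> W \<and> continuous_on (I \<inter> W) (lagrangian I x)"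
    using W t c by (intro exI[of _ W]) auto
qed

lemma euler_lagrange_restrict:
  assumes x: "smooth_curve A g nabla I x" and I': "I' \<subseteq> I" "axis_accessible I'" "t \<in> I'"
  shows "euler_lagrange I' x t = euler_lagrange I x t"
proof -
  interpret smooth_curve A g nabla I x by (rule x)
  show ?thesis
    unfolding euler_lagrange_def velocity_restrict[OF C1_x acc_I I'] curve_deriv_restrict[OF I'] ..
qed

lemma lagrangian_germ:
  assumes "open W" "t \<in> W" "I1 \<inter> W = I2 \<inter> W" "t \<in> I1" "\<And>s. s \<in> I1 \<inter> W \<Longrightarrow> x1 s = x2 s"
  shows "lagrangian I1 x1 t = lagrangian I2 x2 t"
  using velocity_germ[OF assms] acceleration_germ[OF assms] assms(5)[OF IntI[OF assms(4,2)]]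
  by (simp add: lagrangian_def)

end

section \<open>The first variation of the action on a segment\<close>

context constrained_problem
begin

abbreviation EL_comp :: "('m, 'e) chart \<Rightarrow> 'e \<Rightarrow> real set \<Rightarrow> (real \<Rightarrow> 'm) \<Rightarrow> real \<Rightarrow> real" where
  "EL_comp c w I x t \<equiv> g (x t) (euler_lagrange I x t) (E c w (x t))"

abbreviation acc_comp :: "('m, 'e) chart \<Rightarrow> 'e \<Rightarrow> real set \<Rightarrow> (real \<Rightarrow> 'm) \<Rightarrow> real \<Rightarrow> real" where
  "acc_comp c w I x t \<equiv> g (x t) (curve_deriv A nabla I x 2 t) (E c w (x t))"

definition bdry :: "real set \<Rightarrow> (real \<Rightarrow> 'm) \<Rightarrow> ('m, 'e) chart \<Rightarrow> (real \<Rightarrow> 'e) \<Rightarrow> real \<Rightarrow> real" where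
  "bdry I x c = coord_lagrangian.boundary (Gc c) (\<Gamma>c c) (part I x c) (cmap c \<circ> x) \<sigma> {1..k} \<mu> (Yc c)"

text \<open>
  Where \<open>\<phi>\<close> vanishes the variation field is zero and its covariant derivative is \<open>\<phi>' w\<close>, so that
  only the term with the acceleration survives.
\<close>

lemma bdry_vanishing:
  assumes x: "smooth_curve A g nabla I x" and I: "I \<subseteq> {0..\<tau>}" and c: "c \<in> A" and t: "t \<in> part I x c"
    and \<phi>: "\<phi> t = 0" "(\<phi> has_real_derivative \<beta>) (at t)"
  shows "bdry I x c (\<lambda>t. \<phi> t *\<^sub>R w) t = \<beta> * acc_comp c w I x t"
proof -
  interpret smooth_curve A g nabla I x by (rule x)
  interpret L: coord_lagrangian "range_of c" "Gc c" "\<Gamma>c c" "part I x c" "cmap c \<circ> x" \<sigma> "V \<circ> cinv c"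
    "gradc c" "{1..k}" \<mu> "Yc c" "Sc c" by (rule coord_lagrangian_chart[OF x I c])
  have ct: "c \<in> charts_at A (x t)" using c t by (auto simp: charts_at_iff)
  note z = L.y_in[OF t]
  have "((\<lambda>t. \<phi> t *\<^sub>R w) has_vector_derivative (\<phi> t *\<^sub>R 0 + \<beta> *\<^sub>R w)) (at t within part I x c)"
    by (intro has_vector_derivative_scaleR has_vector_derivative_const
        has_field_derivative_at_within[OF \<phi>(2)])
  from vector_derivative_accessible[OF this L.acc t]
  have "L.vd (\<lambda>t. \<phi> t *\<^sub>R w) t = \<beta> *\<^sub>R w" by simp
  then have D: "L.D (\<lambda>t. \<phi> t *\<^sub>R w) t = \<beta> *\<^sub>R w"
    using z by (simp add: L.D_def \<phi>(1) L.\<Gamma>_lin)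
  have tI: "t \<in> I" using t by auto
  show ?thesis
    unfolding bdry_def L.boundary_def D
    using z by (simp add: \<phi>(1) L.G_lin g_chart[OF ct] curve_deriv_tangent[OF tI] E_tangent
        coords_E_same[OF ct]
        curve_deriv_coords(1)[OF c t])
qed

lemma continuous_on_euler_lagrange:
  assumes x: "smooth_curve A g nabla I x" and I: "I \<subseteq> {0..\<tau>}" and c: "c \<in> A" and xc:
      "x ` I \<subseteq> cdom c"
  shows "continuous_on I (\<lambda>t. EL_comp c w I x t)"
proof -
  interpret smooth_curve A g nabla I x by (rule x)
  have part: "part I x c = I" using xc by auto
  interpret L: coord_lagrangian "range_of c" "Gc c" "\<Gamma>c c" "part I x c" "cmap c \<circ> x" \<sigma> "V \<circ> cinv c"
    "gradc c" "{1..k}" \<mu> "Yc c" "Sc c" by (rule coord_lagrangian_chart[OF x I c])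
  have "smooth_on (part I x c) (\<lambda>t. w)" by (rule smooth_onI, rule Ck_on_const)
  from L.continuous_on_EL[OF this] have "continuous_on I (\<lambda>t. Gc c ((cmap c \<circ> x) t) (L.EL t) w)"
      unfolding part .
  then show ?thesis
  proof (rule continuous_on_eq)
    fix t assume "t \<in> I"
    then have t: "t \<in> part I x c" using part by simp
    then have ct: "c \<in> charts_at A (x t)" using c by (auto simp: charts_at_iff)
    show "Gc c ((cmap c \<circ> x) t) (L.EL t) w = EL_comp c w I x t"
      using euler_lagrange_chart[OF x I c t]
          by (simp add: g_chart[OF ct] E_tangent coords_E_same[OF ct])
  qed
qed

text \<open>
  The coordinate result \<open>action_variation\<close> for a family of curves \<open>z r\<close> which in the chart are
  \<open>x + r \<phi> w\<close>. The function \<open>\<phi>\<close> vanishes at both ends, but its derivatives there may not.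
\<close>

lemma segment_variation:
  assumes pq: "p < q" "{p..q} \<subseteq> {0..\<tau>}" and c: "c \<in> A" and e: "0 < e"
    and x: "smooth_curve A g nabla {p..q} x"
    and z: "\<And>r. r \<in> {-e<..<e} \<Longrightarrow> smooth_curve A g nabla {p..q} (z r)"
    and xc: "x ` {p..q} \<subseteq> cdom c"
    and zc: "\<And>r t. r \<in> {-e<..<e} \<Longrightarrow> t \<in> {p..q} \<Longrightarrow>
        z r t \<in> cdom c \<and> cmap c (z r t) = cmap c (x t) + (r * \<phi> t) *\<^sub>R w"
    and \<phi>: "\<And>n. Ck_on n UNIV \<phi>"
    and \<phi>p: "\<phi> p = 0" "(\<phi> has_real_derivative \<beta>p) (at p)" and \<phi>q: "\<phi> q = 0" "(\<phi>
        has_real_derivative \<beta>q) (at q)"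
  shows "((\<lambda>r. integral {p..q} (lagrangian {p..q} (z r))) has_real_derivative
    2 * (\<beta>q * acc_comp c w {p..q} x q
       - \<beta>p * acc_comp c w {p..q} x p
       + integral {p..q} (\<lambda>t. EL_comp c w {p..q} x t * \<phi> t))) (at 0)"
proof -
  let ?I = "{p..q}"
  interpret smooth_curve A g nabla ?I x by (rule x)
  have part: "part ?I x c = ?I" using xc by auto
  interpret L: coord_lagrangian "range_of c" "Gc c" "\<Gamma>c c" ?I "cmap c \<circ> x" \<sigma> "V \<circ> cinv c"
    "gradc c" "{1..k}" \<mu> "Yc c" "Sc c" using coord_lagrangian_chart[OF x pq(2) c] unfolding part .
  let ?W = "\<lambda>t. \<phi> t *\<^sub>R w"
  have W: "smooth_on ?I ?W"
    by (intro smooth_onI Ck_on_scaleR Ck_on_const Ck_on_subset[OF \<phi>]) simp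
  have zx: "cmap c (z r t) = (cmap c \<circ> x) t + r *\<^sub>R ?W t" if "r \<in> {-e<..<e}" "t \<in> ?I" for r t
    using zc[OF that] by simp
  have in_U: "(cmap c \<circ> x) t + r *\<^sub>R ?W t \<in> range_of c" if "r \<in> {-e<..<e}" "t \<in> ?I" for r t
    using zx[OF that, symmetric] zc[OF that] imageI[of "z r t" "cdom c" "cmap c"] by simp
  have lag: "lagrangian ?I (z r) t = L.lagr t ((cmap c \<circ> x) t + r *\<^sub>R ?W t) (L.v t
      + r *\<^sub>R L.vd ?W t)
      (L.vd L.v t + r *\<^sub>R L.vd (L.vd ?W) t)" if r: "r \<in> {-e<..<e}" and t: "t \<in> ?I" for r t
  proof -
    have partz: "part ?I (z r) c = ?I" using zc[OF r] by auto
    interpret Z: coord_lagrangian "range_of c" "Gc c" "\<Gamma>c c" ?I "cmap c \<circ> z r" \<sigma> "V \<circ> cinv c"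
      "gradc c" "{1..k}" \<mu> "Yc c" "Sc c" using coord_lagrangian_chart[OF z[OF r] pq(2) c]
          unfolding partz .
    have cong: "vector_derivative f (at s within ?I) = vector_derivative h (at s within ?I)"
      if "\<And>s. s \<in> ?I \<Longrightarrow> f s = h s" "s \<in> ?I" for f h :: "real \<Rightarrow> 'e" and s
      by (rule vector_derivative_cong_eq) (use that in \<open>auto intro: always_eventually\<close>)
    have lin: "vector_derivative (\<lambda>s. f s + r *\<^sub>R h s) (at s within ?I) = L.vd f s + r *\<^sub>R L.vd h s"
      if "smooth_on ?I f" "smooth_on ?I h" "s \<in> ?I" for f h :: "real \<Rightarrow> 'e" and s
      by (intro vector_derivative_accessible[OF _ L.acc that(3)] has_vector_derivative_add
          bounded_linear.has_vector_derivative[OF bounded_linear_scaleR_right] L.has_vd that)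
    have Zv: "Z.v s = L.v s + r *\<^sub>R L.vd ?W s" if s: "s \<in> ?I" for s
      unfolding Z.v_def L.v_def lin[OF L.smooth_y W s, symmetric]
          by (rule cong[OF _ s]) (use zx[OF r] in simp)
    have "L.vd Z.v t = L.vd L.v t + r *\<^sub>R L.vd (L.vd ?W) t"
      unfolding lin[OF L.smooth_v L.smooth_vd[OF W] t, symmetric] by (rule cong[OF Zv t])
    then show ?thesis
      using lagrangian_chart[OF z[OF r] pq(2) c, unfolded partz, OF t] zx[OF r t] Zv[OF t] by simp
  qed
  have "((\<lambda>r. integral ?I (\<lambda>t. L.lagr t ((cmap c \<circ> x) t + r *\<^sub>R ?W t) (L.v t + r *\<^sub>R L.vd ?W t)
        (L.vd L.v t + r *\<^sub>R L.vd (L.vd ?W) t)))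
    has_real_derivative 2 * (L.boundary ?W q - L.boundary ?W p
      + integral ?I (\<lambda>t. Gc c ((cmap c \<circ> x) t) (L.EL t) (?W t)))) (at 0)"
    by (rule L.action_variation[OF refl pq(1) W e in_U])
  moreover have "L.boundary ?W q = \<beta>q * acc_comp c w ?I x q"
    using bdry_vanishing[OF x pq(2) c, unfolded part, OF _ \<phi>q, of w] pq(1)
    by (simp add: bdry_def part)
  moreover have "L.boundary ?W p = \<beta>p * acc_comp c w ?I x p"
    using bdry_vanishing[OF x pq(2) c, unfolded part, OF _ \<phi>p, of w] pq(1)
    by (simp add: bdry_def part)
  moreover have "integral ?I (\<lambda>t. Gc c ((cmap c \<circ> x) t) (L.EL t) (?W t))
     = integral ?I (\<lambda>t. EL_comp c w ?I x t * \<phi> t)"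
  proof (rule integral_cong)
    fix t assume t: "t \<in> ?I"
    then have ct: "c \<in> charts_at A (x t)" using c xc by (auto simp: charts_at_iff)
    show "Gc c ((cmap c \<circ> x) t) (L.EL t) (?W t) = EL_comp c w ?I x t * \<phi> t"
      using euler_lagrange_chart[OF x pq(2) c, unfolded part, OF t] L.y_in[OF t]
      by (simp add: g_chart[OF ct] E_tangent coords_E_same[OF ct] L.G_lin)
  qed
  ultimately have 1: "((\<lambda>r. integral ?I (\<lambda>t. L.lagr t ((cmap c \<circ> x) t + r *\<^sub>R ?W t) (L.v t
      + r *\<^sub>R L.vd ?W t)
        (L.vd L.v t + r *\<^sub>R L.vd (L.vd ?W) t)))
    has_real_derivative 2 * (\<beta>q * acc_comp c w ?I x q
       - \<beta>p * acc_comp c w ?I x p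
       + integral ?I (\<lambda>t. EL_comp c w ?I x t * \<phi> t))) (at 0)" by simp
  show ?thesis
    unfolding has_field_derivative_def
  proof (rule has_derivative_transform_within_open[OF 1[unfolded has_field_derivative_def]])
    show "open {-e<..<e}" "0 \<in> {-e<..<e}" using e by auto
    show "integral ?I (\<lambda>t. L.lagr t ((cmap c \<circ> x) t + r *\<^sub>R ?W t) (L.v t + r *\<^sub>R L.vd ?W t)
        (L.vd L.v t + r *\<^sub>R L.vd (L.vd ?W) t)) = integral ?I (lagrangian ?I (z r))"
            if "r \<in> {-e<..<e}" for r
      by (rule integral_cong) (rule lag[OF that, symmetric])
  qed
qed

end

section \<open>Variations supported in a chart\<close>

context smooth_mfd
begin

lemma Ck_into_slice:
  assumes F: "Ck_into A n (Q \<times> I) (\<lambda>(r, t). \<alpha> r t)" and r: "r \<in> Q"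
  shows "Ck_into A n I (\<alpha> r)"
  unfolding Ck_into_def
proof (intro conjI ballI)
  have p: "Ck_on n X (\<lambda>t. (r, t))" for X :: "'b::euclidean_space set"
  proof -
    have "Ck_on n X (\<lambda>t. (r, 0) + (0, t))"
      by (intro Ck_on_add Ck_on_const Ck_on_linear bounded_linear_Pair bounded_linear_zero
          bounded_linear_ident)
    then show ?thesis by simp
  qed
  have "continuous_on I (\<lambda>t. (\<lambda>(r, t). \<alpha> r t) (r, t))"
    by (rule continuous_on_compose2[OF Ck_into_D(1)[OF F]]) (use r in \<open>auto intro!:
        continuous_intros\<close>)
  then show "continuous_on I (\<alpha> r)" by simp
  fix c assume "c \<in> A"
  have "Ck_on n (part I (\<alpha> r) c) (\<lambda>t. (cmap c \<circ> (\<lambda>(r, t). \<alpha> r t)) (r, t))"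
    by (rule Ck_on_compose[OF Ck_into_D(2)[OF F \<open>c \<in> A\<close>] p]) (use r in auto)
  then show "Ck_on n (part I (\<alpha> r) c) (cmap c \<circ> \<alpha> r)" by (simp add: comp_def)
qed

text \<open>
  The curve \<open>x\<close> is moved inside the chart for times in \<open>[p, q]\<close>; the support of \<open>\<phi>\<close> will be a
  smaller interval, so that the two cases of the definition overlap.
\<close>

definition vary :: "('m, 'e) chart \<Rightarrow> real \<Rightarrow> real \<Rightarrow> (real \<Rightarrow> real) \<Rightarrow> 'e \<Rightarrow> (real \<Rightarrow> 'm) \<Rightarrow> real \<Rightarrow> real \<Rightarrow>
    'm" where
  "vary c p q \<phi> w x r t = (if t \<in> {p..q} then cinv c (cmap c (x t) + (r * \<phi> t) *\<^sub>R w) else x t)"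

lemma vary_eq:
  assumes "c \<in> A" "x ` {p..q} \<subseteq> cdom c" "\<phi> t = 0 \<or> t \<notin> {p..q}"
  shows "vary c p q \<phi> w x r t = x t"
  using assms cinv_cmap[OF assms(1), of "x t"] by (auto simp: vary_def image_subset_iff)

lemma vary_chart:
  assumes "c \<in> A" "t \<in> {p..q}" "cmap c (x t) + (r * \<phi> t) *\<^sub>R w \<in> range_of c"
  shows "vary c p q \<phi> w x r t \<in> cdom c" "cmap c (vary c p q \<phi> w x r t) = cmap c (x t)
      + (r * \<phi> t) *\<^sub>R w"
  using assms cinv_in[OF assms(1) assms(3)] cmap_cinv[OF assms(1) assms(3)] by (auto simp: vary_def)

text \<open>
  The variation is a composition of maps of class \<open>C\<^sup>n\<close> on \<open>(p, q)\<close>, and it is \<open>x\<close> outside the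
  support \<open>[p', q']\<close> of \<open>\<phi>\<close>. These two open sets of times cover everything, and the class can be
  checked locally.
\<close>

lemma Ck_into_vary:
  assumes c: "c \<in> A" and x: "Ck_into A n I x" "axis_accessible I"
    and \<phi>: "\<And>n. Ck_on n UNIV \<phi>" and supp: "\<And>t. t \<notin> {p'..q'} \<Longrightarrow> \<phi> t = 0" and pq: "p < p'" "q' < q"
    and xc: "x ` {p..q} \<subseteq> cdom c"
    and U: "\<And>r t. r \<in> {-e<..<e} \<Longrightarrow> t \<in> {p..q} \<Longrightarrow> cmap c (x t) + (r * \<phi> t) *\<^sub>R w \<in> range_of c"
  shows "Ck_into A n ({-e<..<e} \<times> I) (\<lambda>(r, t). vary c p q \<phi> w x r t)"
proof -
  let ?S = "{-e<..<e} \<times> I" and ?F = "\<lambda>(r, t). vary c p q \<phi> w x r t"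
  let ?O1 = "UNIV \<times> {p<..<q} :: (real \<times> real) set" and ?O2 =
      "UNIV \<times> (- {p'..q'}) :: (real \<times> real) set"
  have O: "open ?O1" "open ?O2" by (auto intro!: open_Times)
  have cover: "z \<in> ?O1 \<or> z \<in> ?O2" for z using pq by (cases z) auto
  let ?f = "\<lambda>z. cmap c (x (snd z)) + (fst z * \<phi> (snd z)) *\<^sub>R w"
  have eq1: "?F z = cinv c (?f z)" if "z \<in> ?O1" for z using that by (auto simp: vary_def)
  have eq2: "?F z = x (snd z)" if "z \<in> ?O2" for z
    using that supp vary_eq[OF c xc] by (cases z) auto
  have snd: "Ck_on m X (\<lambda>z. h (snd z))" if "Ck_on m Y h" "snd ` X \<subseteq> Y"
    for m X Y and h :: "real \<Rightarrow> 'z::real_normed_vector"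
    by (rule Ck_on_compose[OF that(1) Ck_on_linear[OF bounded_linear_snd] that(2)])
  have f: "Ck_on n (?S \<inter> ?O1) ?f"
  proof (intro Ck_on_add Ck_on_scaleR Ck_on_mult Ck_on_const Ck_on_linear[OF bounded_linear_fst])
    show "Ck_on n (?S \<inter> ?O1) (\<lambda>z. cmap c (x (snd z)))"
    proof -
      have "snd ` (?S \<inter> ?O1) \<subseteq> part I x c" using xc by fastforce
      from snd[OF Ck_into_D(2)[OF x(1) c] this] show ?thesis by simp
    qed
    show "Ck_on n (?S \<inter> ?O1) (\<lambda>z. \<phi> (snd z))" using snd[OF \<phi>] by simp
  qed
  have fU: "?f z \<in> range_of c" if "z \<in> ?S \<inter> ?O1" for z
    using that U[of "fst z" "snd z"] by auto
  have cont: "continuous_on ?S ?F"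
  proof (rule continuous_on_locally)
    fix z assume "z \<in> ?S"
    have "continuous_on (?S \<inter> ?O1) (\<lambda>z. cinv c (?f z))"
      by (rule continuous_on_compose2[OF continuous_cinv[OF c] Ck_on_imp_continuous_on[OF f]]) (use
          fU in blast)
    then have 1: "continuous_on (?S \<inter> ?O1) ?F"
      by (rule continuous_on_eq) (rule eq1[symmetric], blast)
    have "continuous_on (?S \<inter> ?O2) (\<lambda>z. x (snd z))"
      by (rule continuous_on_compose2[OF Ck_into_D(1)[OF x(1)]]) (auto intro!: continuous_intros)
    then have 2: "continuous_on (?S \<inter> ?O2) ?F"
      by (rule continuous_on_eq) (rule eq2[symmetric], blast)
    show "\<exists>W. open W \<and> z \<in> W \<and> continuous_on (?S \<inter> W) ?F"
      using cover[of z] 1 2 O by blast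
  qed
  have accS: "axis_accessible ?S"
    by (rule axis_accessible_Times[OF axis_accessible_if_open x(2)]) simp
  show ?thesis
    unfolding Ck_into_def
  proof (intro conjI ballI cont)
    fix d assume d: "d \<in> A"
    show "Ck_on n (part ?S ?F d) (cmap d \<circ> ?F)"
    proof (rule Ck_on_locally[OF axis_accessible_part[OF d cont accS]])
      fix z assume "z \<in> part ?S ?F d"
      have "Ck_on n (part ?S ?F d \<inter> ?O1) (\<lambda>z. (cmap d \<circ> cinv c) (?f z))"
      proof (rule Ck_on_compose[OF smooth_trans[OF c d]])
        show "Ck_on n (part ?S ?F d \<inter> ?O1) ?f" by (rule Ck_on_subset[OF f]) auto
        show "?f ` (part ?S ?F d \<inter> ?O1) \<subseteq> cmap c ` (cdom c \<inter> cdom d)"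
        proof
          fix y assume "y \<in> ?f ` (part ?S ?F d \<inter> ?O1)"
          then obtain z where z: "y = ?f z" "z \<in> ?S \<inter> ?O1" "?F z \<in> cdom d" by auto
          then have "cinv c y \<in> cdom d" using eq1[of z] by simp
          moreover have "y \<in> range_of c" using fU[OF z(2)] z(1) by simp
          ultimately show "y \<in> cmap c ` (cdom c \<inter> cdom d)"
            using cinv_in[OF c] cmap_cinv[OF c] by (metis IntI imageI)
        qed
      qed
      then have 1: "Ck_on n (part ?S ?F d \<inter> ?O1) (cmap d \<circ> ?F)"
        by (rule Ck_on_cong) (simp only: comp_apply eq1 Int_iff)
      have "Ck_on n (part ?S ?F d \<inter> ?O2) (\<lambda>z. (cmap d \<circ> x) (snd z))"
        by (rule snd[OF Ck_into_D(2)[OF x(1) d]]) (use eq2 in auto)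
      then have 2: "Ck_on n (part ?S ?F d \<inter> ?O2) (cmap d \<circ> ?F)"
        by (rule Ck_on_cong) (simp only: comp_apply eq2 Int_iff)
      show "\<exists>W. open W \<and> z \<in> W \<and> Ck_on n (part ?S ?F d \<inter> W) (cmap d \<circ> ?F)"
        using cover[of z] 1 2 O by blast
    qed
  qed
qed

end

lemma small_variation_in_open:
  fixes y :: "real \<Rightarrow> 'e::euclidean_space"
  assumes y: "continuous_on {p..q} y" and \<phi>: "continuous_on {p..q} \<phi>" and U: "open U"
      "y ` {p..q} \<subseteq> U"
  shows "\<exists>e>0. \<forall>r\<in>{-e<..<e}. \<forall>t\<in>{p..q}. y t + (r * \<phi> t) *\<^sub>R w \<in> U"
proof -
  obtain d where d: "d > 0" "(\<Union>z\<in>y ` {p..q}. ball z d) \<subseteq> U"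
    using compact_subset_open_imp_ball_epsilon_subset[OF compact_continuous_image[OF y compact_Icc]
        U] by blast
  have "bounded (\<phi> ` {p..q})" using compact_continuous_image[OF \<phi> compact_Icc] compact_imp_bounded
      by blast
  then obtain M where M: "M > 0" "\<And>t. t \<in> {p..q} \<Longrightarrow> \<bar>\<phi> t\<bar> \<le> M"
    unfolding bounded_pos by auto
  define e where "e = d / (M * (norm w + 1))"
  have nw: "norm w + 1 > 0" by (simp add: add_nonneg_pos)
  have "e > 0" using d M nw by (simp add: e_def)
  moreover have "y t + (r * \<phi> t) *\<^sub>R w \<in> U" if r: "r \<in> {-e<..<e}" and t: "t \<in> {p..q}" for r t
  proof -
    have "norm ((r * \<phi> t) *\<^sub>R w) = \<bar>r\<bar> * (\<bar>\<phi> t\<bar> * norm w)" by (simp add: abs_mult)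
    also have "\<dots> \<le> \<bar>r\<bar> * (M * (norm w + 1))"
      using M t by (intro mult_left_mono mult_mono) auto
    also have "\<dots> < e * (M * (norm w + 1))"
      using r M nw by (intro mult_strict_right_mono) auto
    also have "\<dots> = d" using M nw by (simp add: e_def)
    finally have "y t + (r * \<phi> t) *\<^sub>R w \<in> ball (y t) d" by (simp add: dist_norm)
    then show ?thesis using d(2) t by blast
  qed
  ultimately show ?thesis by blast
qed

section \<open>The Euler-Lagrange equation for stationary curves\<close>

text \<open>
  An admissible curve at which the extended functional with the multipliers \<open>\<mu>\<close> is stationary.
\<close>

locale extremal = constrained_problem A g nabla R \<sigma> V k \<omega> Y S "T N" \<mu>
  for A :: "('m::{t2_space,second_countable_topology}, 'e::euclidean_space) chart set"
    and g nabla R \<sigma> V k \<omega> Y S and N :: nat and T :: "nat \<Rightarrow> real" and \<mu> +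
  fixes xs :: "nat \<Rightarrow> 'm" and v0 vN :: "('m, 'e) tvec" and x :: "real \<Rightarrow> 'm"
  assumes N: "1 \<le> N" and T0: "T 0 = 0" and T_mono: "strict_mono_on {..N} T"
    and adm: "admissible_curve A N T xs v0 vN x"
    and stationary: "\<And>e \<alpha>. admissible_variation A N T xs v0 vN x e \<alpha> \<Longrightarrow>
      ((\<lambda>r. extended_functional A g nabla \<sigma> V k Y (T N) \<mu> (\<alpha> r)) has_real_derivative 0) (at 0)"
begin

abbreviation piece :: "nat \<Rightarrow> real set" where "piece i \<equiv> {T (i - 1)..T i}"

lemma T_less: "i < j \<Longrightarrow> j \<le> N \<Longrightarrow> T i < T j"
  using T_mono by (auto simp: strict_mono_on_def)

lemma T_le: "i \<le> j \<Longrightarrow> j \<le> N \<Longrightarrow> T i \<le> T j"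
  using T_less[of i j] by (cases "i = j") auto

lemma T_less_iff: "i \<le> N \<Longrightarrow> j \<le> N \<Longrightarrow> T i < T j \<longleftrightarrow> i < j"
  using T_less[of i j] T_le[of j i] by (cases "i < j") auto

lemma piece:
  assumes "i \<in> {1..N}"
  shows "T (i - 1) < T i" "0 \<le> T (i - 1)" "T i \<le> T N" "piece i \<subseteq> {0..T N}"
      "axis_accessible (piece i)"
proof -
  show 1: "T (i - 1) < T i" using assms by (intro T_less) auto
  show "0 \<le> T (i - 1)" using T_le[of 0 "i - 1"] assms T0 by auto
  moreover show "T i \<le> T N" using assms by (intro T_le) auto
  ultimately show "piece i \<subseteq> {0..T N}" by auto
  show "axis_accessible (piece i)" using axis_accessible_Icc[OF 1] .
qed

lemma acc_total: "axis_accessible {0..T N}"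
  using axis_accessible_Icc \<tau> by blast

lemma curve_piece:
  assumes "admissible_curve A N T xs v0 vN z" "i \<in> {1..N}"
  shows "smooth_curve A g nabla (piece i) z"
  by unfold_locales (use assms piece in \<open>auto simp: admissible_curve_def\<close>)

lemma functional_eq:
  "extended_functional A g nabla \<sigma> V k Y (T N) \<mu> z
      = 1 / 2 * integral {0..T N} (lagrangian {0..T N} z)"
  by (simp add: extended_functional_def lagrangian_def[abs_def])

lemma lagrangian_inner:
  assumes "{a..b} \<subseteq> {0..T N}" "t \<in> {a<..<b}"
  shows "lagrangian {0..T N} z t = lagrangian {a..b} z t"
proof (rule lagrangian_germ[where W = "{a<..<b}"])
  show "{0..T N} \<inter> {a<..<b} = {a..b} \<inter> {a<..<b}" "t \<in> {0..T N}" using assms by auto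
qed (use assms in auto)

text \<open>
  The integral of a function that is not integrable is \<open>0\<close> by convention, and the stationarity
  condition would then be void. Integrability holds because the Lagrangian is continuous on each
  piece up to the values at the breakpoints.
\<close>

lemma lagrangian_integrable:
  assumes z: "admissible_curve A N T xs v0 vN z"
  shows "lagrangian {0..T N} z integrable_on {0..T N}"
proof -
  have "lagrangian {0..T N} z integrable_on {0..T i}" if "i \<le> N" for i
    using that
  proof (induction i)
    case 0
    then show ?case using integrable_on_refl[of "lagrangian {0..T N} z" 0] by (simp add: T0)
  next
    case (Suc i)
    then have i: "Suc i \<in> {1..N}" by auto
    note p = piece[OF i]
    have "lagrangian (piece (Suc i)) z integrable_on piece (Suc i)"
      using continuous_on_lagrangian[OF curve_piece[OF z i] p(4)]
          by (rule integrable_continuous_real)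
    then have "lagrangian {0..T N} z integrable_on piece (Suc i)"
      by (rule integrable_spike_finite[where S = "{T i, T (Suc i)}", rotated 2])
        (use lagrangian_inner[OF p(4)] in auto)
    then show ?case
      using Suc p T_le[of 0 i] T0 by (intro Henstock_Kurzweil_Integration.integrable_combine[where a
          = 0 and c = "T i" and b = "T (Suc i)"]) auto
  qed
  then show ?thesis by simp
qed

text \<open>
  Only the segments \<open>[p, m]\<close> and \<open>[m, q]\<close> move, and the curve is smooth on each of them, so
  \<open>segment_variation\<close> applies to both. Since \<open>m\<close> may be a breakpoint, the accelerations from the
  left and from the right may differ, and the boundary terms at \<open>m\<close> need not cancel.
\<close>

lemma first_variation:
  assumes c: "c \<in> A" and pmq: "0 < p" "p < m" "m < q" "q < T N"
    and i: "i \<in> {1..N}" "{p..m} \<subseteq> piece i" and j: "j \<in> {1..N}" "{m..q} \<subseteq> piece j"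
    and xc: "x ` {p..q} \<subseteq> cdom c"
    and \<phi>: "\<And>n. Ck_on n UNIV \<phi>" and supp: "\<And>t. t \<notin> {p'..q'} \<Longrightarrow> \<phi> t = 0" and pq': "p < p'" "q' < q"
    and \<phi>T: "\<And>l. l \<le> N \<Longrightarrow> \<phi> (T l) = 0" and \<phi>m: "\<phi> m = 0" "(\<phi> has_real_derivative \<beta>) (at m)"
  shows "integral {p..m} (\<lambda>t. EL_comp c w {p..m} x t * \<phi> t)
    + integral {m..q} (\<lambda>t. EL_comp c w {m..q} x t * \<phi> t)
    + \<beta> * (acc_comp c w {p..m} x m
         - acc_comp c w {m..q} x m) = 0"
proof -
  have C1: "Ck_into A 1 {0..T N} x" using adm by (simp add: admissible_curve_def)
  have sub: "{p..q} \<subseteq> {0..T N}" "{p..m} \<subseteq> {0..T N}" "{m..q} \<subseteq> {0..T N}" using pmq by auto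
  have "continuous_on {p..q} (cmap c \<circ> x)"
    by (rule continuous_on_compose[OF continuous_on_subset[OF Ck_into_D(1)[OF C1] sub(1)]
          continuous_on_subset[OF continuous_cmap[OF c] xc]])
  moreover have "continuous_on {p..q} \<phi>"
    using Ck_on_imp_continuous_on[OF \<phi>[of 0]] by (rule continuous_on_subset) simp
  moreover have "(cmap c \<circ> x) ` {p..q} \<subseteq> range_of c" using xc unfolding image_comp[symmetric]
      by blast
  ultimately have "\<exists>e>0. \<forall>r\<in>{-e<..<e}. \<forall>t\<in>{p..q}. (cmap c \<circ> x) t + (r * \<phi> t) *\<^sub>R w \<in> range_of c"
    by (rule small_variation_in_open[OF _ _ open_range[OF c]])
  then obtain e where e: "e > 0" and U: "\<And>r t. r \<in> {-e<..<e} \<Longrightarrow> t \<in> {p..q} \<Longrightarrow>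
      cmap c (x t) + (r * \<phi> t) *\<^sub>R w \<in> range_of c"
    unfolding comp_apply by blast
  let ?\<alpha> = "vary c p q \<phi> w x"
  note ve = vary_eq[OF c xc]
  have far: "?\<alpha> r t = x t" if "t \<notin> {p'..q'}" for r t using ve supp[OF that] by blast
  note ck = Ck_into_vary[OF c _ _ \<phi> supp pq' xc U]
  have ck1: "Ck_into A 1 ({-e<..<e} \<times> {0..T N}) (\<lambda>(r, t). ?\<alpha> r t)" by (rule ck[OF C1 acc_total])
  have ckn: "Ck_into A n ({-e<..<e} \<times> piece l) (\<lambda>(r, t). ?\<alpha> r t)" if "l \<in> {1..N}" for l n
  proof (rule ck[OF _ piece(5)[OF that]])
    show "Ck_into A n (piece l) x" using adm that smooth_into_D unfolding admissible_curve_def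
        by blast
  qed
  have vel: "velocity A {0..T N} (?\<alpha> r) t = velocity A {0..T N} x t"
      if "t \<in> {0..T N}" "t \<notin> {p'..q'}" for r t
    by (rule velocity_germ[where W = "- {p'..q'}"]) (use that far in auto)
  have aadm: "admissible_curve A N T xs v0 vN (?\<alpha> r)" if r: "r \<in> {-e<..<e}" for r
    unfolding admissible_curve_def
  proof (intro conjI ballI allI impI)
    show "Ck_into A 1 {0..T N} (?\<alpha> r)" using Ck_into_slice[OF ck1 r] .
    show "smooth_into A (piece l) (?\<alpha> r)" if "l \<in> {1..N}" for l
      unfolding smooth_into_def using Ck_into_slice[OF ckn[OF that] r] by blast
    show "?\<alpha> r (T l) = xs l" if "l \<le> N" for l
      using ve \<phi>T[OF that] adm that by (auto simp: admissible_curve_def)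
    show "velocity A {0..T N} (?\<alpha> r) 0 = v0"
      using vel[of 0] adm pmq pq' by (simp add: admissible_curve_def)
    show "velocity A {0..T N} (?\<alpha> r) (T N) = vN"
      using vel[of "T N"] adm pmq pq' by (simp add: admissible_curve_def)
  qed
  have "admissible_variation A N T xs v0 vN x e ?\<alpha>"
    unfolding admissible_variation_def
  proof (intro conjI ballI e ck1 aadm)
    show "smooth_into A ({-e<..<e} \<times> piece l) (\<lambda>(r, t). ?\<alpha> r t)" if "l \<in> {1..N}" for l
      unfolding smooth_into_def using ckn[OF that] by blast
    show "?\<alpha> 0 t = x t" for t
      using xc cinv_cmap[OF c, of "x t"] by (auto simp: vary_def image_subset_iff)
  qed
  from stationary[OF this]
  have st: "((\<lambda>r. 1 / 2 * integral {0..T N} (lagrangian {0..T N} (?\<alpha> r)))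
      has_real_derivative 0) (at 0)"
    unfolding functional_eq .
  let ?P1 = "\<lambda>r. integral {p..m} (lagrangian {p..m} (?\<alpha> r))" and ?P2 =
      "\<lambda>r. integral {m..q} (lagrangian {m..q} (?\<alpha> r))"
  let ?L = "\<lambda>r. lagrangian {0..T N} (?\<alpha> r)"
  define K where "K = integral {0..p} (lagrangian {0..T N} x)
      + integral {q..T N} (lagrangian {0..T N} x)"
  \<comment> \<open>Only the two integrals around \<open>m\<close> depend on \<open>r\<close>.\<close>
  have split: "integral {0..T N} (?L r) = K + ?P1 r + ?P2 r" if r: "r \<in> {-e<..<e}" for r
  proof -
    note int = lagrangian_integrable[OF aadm[OF r]]
    have sp: "integral {a..b} (?L r) = integral {a..b} (lagrangian {a..b} (?\<alpha> r))"
        if "{a..b} \<subseteq> {0..T N}" for a b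
      by (rule integral_spike[where S = "{a, b}"]) (use lagrangian_inner[OF that] in auto)
    have fr: "?L r t = lagrangian {0..T N} x t" if "t \<in> {0..T N}" "t \<notin> {p'..q'}" for t
      by (rule lagrangian_germ[where W = "- {p'..q'}"]) (use that far in auto)
    have f0: "integral {0..p} (?L r) = integral {0..p} (lagrangian {0..T N} x)"
      by (rule integral_cong) (use fr pmq pq' in auto)
    have f1: "integral {q..T N} (?L r) = integral {q..T N} (lagrangian {0..T N} x)"
      by (rule integral_cong) (use fr pmq pq' in auto)
    have s: "?L r integrable_on {a..b}" if "{a..b} \<subseteq> {0..T N}" for a b
      using integrable_subinterval_real[OF int that] .
    have "integral {0..T N} (?L r) = integral {0..p} (?L r) + integral {p..T N} (?L r)"
      by (rule Henstock_Kurzweil_Integration.integral_combine[symmetric]) (use pmq int in auto)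
    also have "integral {p..T N} (?L r) = integral {p..m} (?L r) + integral {m..T N} (?L r)"
      by (rule Henstock_Kurzweil_Integration.integral_combine[symmetric]) (use pmq s[of p
          "T N"] in auto)
    also have "integral {m..T N} (?L r) = integral {m..q} (?L r) + integral {q..T N} (?L r)"
      by (rule Henstock_Kurzweil_Integration.integral_combine[symmetric]) (use pmq s[of m
          "T N"] in auto)
    finally show ?thesis unfolding K_def f0 f1 sp[OF sub(2)] sp[OF sub(3)] by simp
  qed
  have sc: "smooth_curve A g nabla {a..b} z"
    if "admissible_curve A N T xs v0 vN z" "l \<in> {1..N}" "{a..b} \<subseteq> piece l" "a < b" for z a b l
    using smooth_curve.smooth_curve_restrict[OF curve_piece[OF that(1,2)] that(3)
        axis_accessible_Icc[OF that(4)]] .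
  have \<phi>0: "(\<phi> has_real_derivative 0) (at t)" if "t \<notin> {p'..q'}" for t
    by (rule has_field_derivative_transform_within_open[OF DERIV_const[of 0], of "- {p'..q'}"])
      (use that supp in auto)
  have zc: "?\<alpha> r t \<in> cdom c \<and> cmap c (?\<alpha> r t) = cmap c (x t) + (r * \<phi> t) *\<^sub>R w"
    if "r \<in> {-e<..<e}" "t \<in> {p..q}" for r t
    using vary_chart[where \<phi>=\<phi> and x=x and r=r and w=w, OF c that(2) U[OF that]] by blast
  have p: "\<phi> p = 0" "(\<phi> has_real_derivative 0) (at p)" and q: "\<phi> q = 0" "(\<phi>
      has_real_derivative 0) (at q)"
    using supp \<phi>0 pq' pmq by auto
  let ?J1 = "integral {p..m} (\<lambda>t. EL_comp c w {p..m} x t * \<phi> t)"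
  let ?J2 = "integral {m..q} (\<lambda>t. EL_comp c w {m..q} x t * \<phi> t)"
  have D1: "(?P1 has_real_derivative 2 * (\<beta> * acc_comp c w {p..m} x m - 0 * acc_comp c w {p..m} x p
      + ?J1)) (at 0)"
    by (rule segment_variation[OF pmq(2) sub(2) c e sc[OF adm i pmq(2)] sc[OF aadm i pmq(2)] _ zc \<phi>
        p \<phi>m])
      (use xc pmq in auto)
  have D2: "(?P2 has_real_derivative 2 * (0 * acc_comp c w {m..q} x q - \<beta> * acc_comp c w {m..q} x m
      + ?J2)) (at 0)"
    by (rule segment_variation[OF pmq(3) sub(3) c e sc[OF adm j pmq(3)] sc[OF aadm j pmq(3)] _ zc \<phi>
        \<phi>m q])
      (use xc pmq in auto)
  have "((\<lambda>r. 1 / 2 * (K + ?P1 r + ?P2 r)) has_real_derivative 1 / 2 * (0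
     + 2 * (\<beta> * acc_comp c w {p..m} x m - 0 * acc_comp c w {p..m} x p + ?J1)
     + 2 * (0 * acc_comp c w {m..q} x q - \<beta> * acc_comp c w {m..q} x m + ?J2))) (at 0)"
    by (intro DERIV_cmult DERIV_add DERIV_const D1 D2)
  then have "((\<lambda>r. 1 / 2 * integral {0..T N} (?L r)) has_real_derivative 1 / 2 * (0
     + 2 * (\<beta> * acc_comp c w {p..m} x m - 0 * acc_comp c w {p..m} x p + ?J1)
     + 2 * (0 * acc_comp c w {m..q} x q - \<beta> * acc_comp c w {m..q} x m + ?J2))) (at 0)"
    by (rule has_field_derivative_transform_within_open[of _ _ _ "{-e<..<e}"]) (use e split in auto)
  from DERIV_unique[OF this st] show ?thesis by (simp add: algebra_simps)
qed

lemma T_between: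
  assumes "l \<le> N" "i \<le> N" "T i < T l" "j \<le> N" "T l < T j"
  shows "i < l" "l < j"
  using assms T_less_iff by auto

lemma cont_total: "continuous_on {0..T N} x"
  using adm Ck_into_D(1) unfolding admissible_curve_def by blast

text \<open>
  The window \<open>[p, q]\<close> around \<open>t\<close> lies inside one piece. The bumps are supported in its left part
  \<open>[p, m]\<close>, so the right part and the boundary terms at \<open>m\<close> contribute nothing.
\<close>

lemma euler_lagrange_interior:
  assumes i: "i \<in> {1..N}" and t: "t \<in> {T (i - 1)<..<T i}"
  shows "euler_lagrange (piece i) x t = 0"
proof -
  note pc = piece[OF i] and sc = curve_piece[OF adm i]
  obtain c where c: "c \<in> charts_at A (x t)" using ex_chart by blast
  then have cA: "c \<in> A" by (auto simp: charts_at_iff)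
  have tN: "t \<in> {0..T N}" using t pc by auto
  obtain d where d: "d > 0" "x ` ({0..T N} \<inter> {t - d..t + d}) \<subseteq> cdom c"
    using chart_window[OF cont_total tN c] by blast
  \<comment> \<open>The window stays in the domain of the chart and away from the breakpoints.\<close>
  define p where "p = max (t - d) ((T (i - 1) + t) / 2)"
  define q where "q = min (t + d) ((t + T i) / 2)"
  define m where "m = (t + q) / 2"
  have pq: "T (i - 1) < p" "p < t" "t < q" "q < T i" "t - d \<le> p" "q \<le> t + d"
    using t d by (auto simp: p_def q_def less_max_iff_disj min_less_iff_disj)
  have m: "t < m" "m < q" using pq by (auto simp: m_def)
  have sub: "{p..m} \<subseteq> piece i" "{m..q} \<subseteq> piece i" using pq m by auto
  have xc: "x ` {p..q} \<subseteq> cdom c"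
  proof
    fix y assume "y \<in> x ` {p..q}"
    then obtain s where s: "y = x s" "s \<in> {p..q}" by blast
    then have "s \<in> {0..T N} \<inter> {t - d..t + d}" using pq pc by auto
    then show "y \<in> cdom c" using d(2) s(1) by blast
  qed
  have I: "axis_accessible {p..m}" using axis_accessible_Icc[of p m] pq m by auto
  have scm: "smooth_curve A g nabla {p..m} x"
      using smooth_curve.smooth_curve_restrict[OF sc sub(1) I] .
  have subN: "{p..m} \<subseteq> {0..T N}" using sub(1) pc(4) by blast
  have xcm: "x ` {p..m} \<subseteq> cdom c" using xc m by auto
  have z: "EL_comp c w {p..m} x t = 0" for w
  proof (rule fundamental_lemma_of_variations[OF continuous_on_euler_lagrange[OF scm subN cA xcm]])
    show "p < m" "t \<in> {p..m}" using pq m by auto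
    fix p' q' assume *: "p < p'" "p' < q'" "q' < m"
    have T: "bump p' q' (T l) = 0" if "l \<le> N" for l
    proof (rule bump_zero, rule)
      assume "T l \<in> {p'<..<q'}"
      then have "T (i - 1) < T l" "T l < T i" using * pq m by auto
      then have "i - 1 < l" "l < i" using T_between[OF that, of "i - 1" i] i by auto
      then show False by linarith
    qed
    have "bump p' q' s = 0" if "s \<in> - {p'..q'}" for s using that by (intro bump_zero) auto
    then have der: "(bump p' q' has_real_derivative 0) (at m)"
      by (intro has_field_derivative_transform_within_open[OF DERIV_const[of 0], of
          "- {p'..q'}"]) (use * in auto)
    have "integral {m..q} (\<lambda>t. EL_comp c w {m..q} x t * bump p' q' t) = integral {m..q} (\<lambda>t. 0)"
      by (rule integral_cong) (use * in \<open>auto simp: bump_zero\<close>)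
    moreover have "integral {p..m} (\<lambda>t. EL_comp c w {p..m} x t * bump p' q' t)
      + integral {m..q} (\<lambda>t. EL_comp c w {m..q} x t * bump p' q' t)
      + 0 * (acc_comp c w {p..m} x m
         - acc_comp c w {m..q} x m) = 0"
      by (rule first_variation[OF cA _ _ m(2) _ i sub(1) i sub(2) xc Ck_on_bump _ _ _ T _ der,
          of p' q'])
        (use * pq m pc in \<open>auto simp: bump_zero\<close>)
    ultimately show "integral {p..m} (\<lambda>t. EL_comp c w {p..m} x t * bump p' q' t) = 0"
      by simp
  qed
  have tp: "t \<in> {p..m}" using pq m by auto
  have "t \<in> part {p..m} x c" using tp xcm by auto
  from tangent_eq_0I[OF c euler_lagrange_chart(1)[OF scm subN cA this] z]
  show ?thesis using euler_lagrange_restrict[OF sc sub(1) I tp] by simp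
qed

text \<open>
  At the ends of a piece there is no room for a bump, but the equation extends by continuity. Only
  the pairing with a coordinate field, which is scalar, is known to be continuous.
\<close>

lemma euler_lagrange_piece:
  assumes i: "i \<in> {1..N}" and t: "t \<in> piece i"
  shows "euler_lagrange (piece i) x t = 0"
proof -
  note pc = piece[OF i] and sc = curve_piece[OF adm i]
  obtain c where c: "c \<in> charts_at A (x t)" using ex_chart by blast
  then have cA: "c \<in> A" by (auto simp: charts_at_iff)
  obtain d where d: "d > 0" "x ` (piece i \<inter> {t - d..t + d}) \<subseteq> cdom c"
    using chart_window[OF smooth_curve.cont_x[OF sc] t c] by blast
  define a where "a = max (T (i - 1)) (t - d)"
  define b where "b = min (T i) (t + d)"
  have ab: "a < b" "{a..b} = piece i \<inter> {t - d..t + d}" "t \<in> {a..b}" using t d pc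
      by (auto simp: a_def b_def)
  have I: "axis_accessible {a..b}" "{a..b} \<subseteq> piece i"
    using axis_accessible_Icc[OF ab(1)] by (auto simp: a_def b_def)
  have xc: "x ` {a..b} \<subseteq> cdom c" using d(2) unfolding ab(2) .
  have scm: "smooth_curve A g nabla {a..b} x"
      using smooth_curve.smooth_curve_restrict[OF sc I(2,1)] .
  have subN: "{a..b} \<subseteq> {0..T N}" using I(2) pc(4) by blast
  have z: "EL_comp c w {a..b} x t = 0" for w
  proof (rule continuous_constant_on_closure[of "{a<..<b}" "\<lambda>t. EL_comp c w {a..b} x t" 0 t])
    show "continuous_on (closure {a<..<b}) (\<lambda>t. EL_comp c w {a..b} x t)"
      using continuous_on_euler_lagrange[OF scm subN cA xc] ab(1) by simp
    show "t \<in> closure {a<..<b}" using ab by simp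
    fix s assume s: "s \<in> {a<..<b}"
    then have sab: "s \<in> {a..b}" by auto
    have "euler_lagrange {a..b} x s = 0"
      unfolding euler_lagrange_restrict[OF sc I(2,1) sab]
      by (rule euler_lagrange_interior[OF i]) (use s in \<open>auto simp: a_def b_def\<close>)
    then show "EL_comp c w {a..b} x s = 0"
      using g_zero[OF E_tangent] by simp
  qed
  have "t \<in> part {a..b} x c" using ab(3) xc by auto
  from tangent_eq_0I[OF c euler_lagrange_chart(1)[OF scm subN cA this] z]
  show ?thesis using euler_lagrange_restrict[OF sc I(2,1) ab(3)] by simp
qed

text \<open>
  With the Euler-Lagrange equation on both sides of an interior breakpoint, only the boundary terms
  are left in the first variation. As \<open>\<phi>\<close> vanishes at the breakpoint but \<open>\<phi>'\<close> does not, they say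
  that the jump of the acceleration is orthogonal to every vector.
\<close>

lemma acceleration_match:
  assumes i: "i \<in> {1..<N}" and c: "c \<in> charts_at A (x (T i))"
    and pmq: "0 < p" "p < T i" "T i < q" "q < T N" "{p..T i} \<subseteq> piece i" "{T i..q} \<subseteq> piece (Suc i)"
    and xc: "x ` {p..q} \<subseteq> cdom c"
  shows "curve_deriv A nabla {p..T i} x 2 (T i) = curve_deriv A nabla {T i..q} x 2 (T i)"
proof -
  let ?m = "T i"
  have cA: "c \<in> A" using c by (auto simp: charts_at_iff)
  have i1: "i \<in> {1..N}" and i2: "Suc i \<in> {1..N}" using i by auto
  have acc: "axis_accessible {p..?m}" "axis_accessible {?m..q}"
    using axis_accessible_Icc pmq by auto
  note sc1 = smooth_curve.smooth_curve_restrict[OF curve_piece[OF adm i1] pmq(5) acc(1)]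
    and sc2 = smooth_curve.smooth_curve_restrict[OF curve_piece[OF adm i2] pmq(6) acc(2)]
  have z1: "euler_lagrange {p..?m} x t = 0" if "t \<in> {p..?m}" for t
    using euler_lagrange_restrict[OF curve_piece[OF adm i1] pmq(5) acc(1) that]
      euler_lagrange_piece[OF i1] pmq(5) that by auto
  have z2: "euler_lagrange {?m..q} x t = 0" if "t \<in> {?m..q}" for t
    using euler_lagrange_restrict[OF curve_piece[OF adm i2] pmq(6) acc(2) that]
      euler_lagrange_piece[OF i2] pmq(6) that by auto
  note g0 = g_zero[OF E_tangent]
  define p' where "p' = (p + ?m) / 2"
  define q' where "q' = (?m + q) / 2"
  have pq': "p < p'" "p' < ?m" "?m < q'" "q' < q" using pmq by (auto simp: p'_def q'_def)
  \<comment> \<open>This is \<open>\<phi>' (T i)\<close> for the function \<open>\<phi>\<close> below.\<close>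
  define \<beta> where "\<beta> = bump p' q' ?m"
  have "\<beta> > 0" unfolding \<beta>_def using pq' by (intro bump_pos)
  let ?\<phi> = "\<lambda>t. (t - ?m) * bump p' q' t"
  let ?a1 = "curve_deriv A nabla {p..?m} x 2 ?m" and ?a2 = "curve_deriv A nabla {?m..q} x 2 ?m"
  have t1: "?a1 \<in> tangent_space A (x ?m)"
    using smooth_curve.curve_deriv_tangent(1)[OF sc1] pmq by simp
  have t2: "?a2 \<in> tangent_space A (x ?m)"
    using smooth_curve.curve_deriv_tangent(1)[OF sc2] pmq by simp
  have "\<beta> * (g (x ?m) ?a1 (E c w (x ?m)) - g (x ?m) ?a2 (E c w (x ?m))) = 0" for w
  proof -
    have "Ck_on (Suc 0) UNIV (bump p' q')" by (rule Ck_on_bump)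
    from Ck_on_real_derivative(1)[OF this axis_accessible_UNIV, of ?m]
    obtain b where "(bump p' q' has_real_derivative b) (at ?m)"
      by (auto simp: has_real_derivative_iff_has_vector_derivative)
    then have der: "(?\<phi> has_real_derivative \<beta>) (at ?m)"
      by (auto intro!: derivative_eq_intros simp: \<beta>_def)
    have T: "?\<phi> (T l) = 0" if l: "l \<le> N" for l
    proof (cases "T l \<in> {p'<..<q'}")
      case True
      then have "T (i - 1) < T l" "T l < T (Suc i)" using pq' pmq by auto
      then have "i - 1 < l" "l < Suc i" using T_between[OF l, of "i - 1" "Suc i"] i by auto
      then have "l = i" by linarith
      then show ?thesis by simp
    qed (simp add: bump_zero)
    have "integral {p..?m} (\<lambda>t. EL_comp c w {p..?m} x t * ?\<phi> t)
      + integral {?m..q} (\<lambda>t. EL_comp c w {?m..q} x t * ?\<phi> t)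
      + \<beta> * (g (x ?m) ?a1 (E c w (x ?m)) - g (x ?m) ?a2 (E c w (x ?m))) = 0"
    proof (rule first_variation[OF cA pmq(1-4) i1 pmq(5) i2 pmq(6) xc _ _ pq'(1,4) T _ der])
      show "Ck_on n UNIV ?\<phi>" for n
        by (intro Ck_on_mult Ck_on_diff Ck_on_id Ck_on_const Ck_on_bump)
      show "?\<phi> t = 0" if "t \<notin> {p'..q'}" for t
        using bump_zero[of t p' q'] that by auto
      show "?\<phi> ?m = 0" by simp
    qed
    moreover have "integral {p..?m} (\<lambda>t. EL_comp c w {p..?m} x t * ?\<phi> t) = integral {p..?m} (\<lambda>t. 0)"
      by (rule integral_cong) (simp only: z1 g0 mult_zero_left)
    moreover have "integral {?m..q} (\<lambda>t. EL_comp c w {?m..q} x t * ?\<phi> t) = integral {?m..q} (\<lambda>t. 0)"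
      by (rule integral_cong) (simp only: z2 g0 mult_zero_left)
    ultimately show ?thesis by simp
  qed
  then have "g (x ?m) (?a1 - ?a2) (E c w (x ?m)) = 0" for w
    using g_lin[OF t1 t2 E_tangent, where a = 1 and b = "-1"] \<open>\<beta> > 0\<close> by simp
  from tangent_eq_0I[OF c tangent_intros(2)[OF t1 t2] this] show ?thesis by simp
qed

text \<open>
  The covariant accelerations from the left and from the right agree. They differ from the second
  derivatives in the chart by \<open>\<Gamma>(v, v)\<close>, which is the same on both sides as the curve is \<open>C\<^sup>1\<close>;
  hence the one-sided second derivatives agree as well.
\<close>

lemma C2_at_breakpoint:
  assumes i: "i \<in> {1..<N}" and c: "c \<in> charts_at A (x (T i))"
  shows "\<exists>W. open W \<and> T i \<in> W \<and> Ck_on 2 ({0..T N} \<inter> W) (cmap c \<circ> x)"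
proof -
  let ?m = "T i"
  have cA: "c \<in> A" using c by (auto simp: charts_at_iff)
  have i1: "i \<in> {1..N}" and i2: "Suc i \<in> {1..N}" using i by auto
  note pc1 = piece[OF i1] and pc2 = piece[OF i2]
  have C1: "Ck_into A 1 {0..T N} x" using adm by (simp add: admissible_curve_def)
  have mN: "?m \<in> {0..T N}" using pc1 by auto
  obtain d where d: "d > 0" "x ` ({0..T N} \<inter> {?m - d..?m + d}) \<subseteq> cdom c"
    using chart_window[OF cont_total mN c] by blast
  define p where "p = max (?m - d) ((T (i - 1) + ?m) / 2)"
  define q where "q = min (?m + d) ((?m + T (Suc i)) / 2)"
  have pq: "T (i - 1) < p" "p < ?m" "?m < q" "q < T (Suc i)" "?m - d \<le> p" "q \<le> ?m + d"
    using pc1 pc2 d by (auto simp: p_def q_def less_max_iff_disj min_less_iff_disj)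
  have pqN: "0 < p" "q < T N" using pq pc1 pc2 by auto
  have sub: "{p..?m} \<subseteq> piece i" "{?m..q} \<subseteq> piece (Suc i)" using pq by auto
  have xc: "x ` {p..q} \<subseteq> cdom c"
  proof
    fix y assume "y \<in> x ` {p..q}"
    then obtain s where s: "y = x s" "s \<in> {p..q}" by blast
    then have "s \<in> {0..T N} \<inter> {?m - d..?m + d}" using pq pqN by auto
    then show "y \<in> cdom c" using d(2) s(1) by blast
  qed
  have acc: "axis_accessible {p..?m}" "axis_accessible {?m..q}"
    using axis_accessible_Icc pq by auto
  note sc1 = smooth_curve.smooth_curve_restrict[OF curve_piece[OF adm i1] sub(1) acc(1)]
    and sc2 = smooth_curve.smooth_curve_restrict[OF curve_piece[OF adm i2] sub(2) acc(2)]
  have part1: "part {p..?m} x c = {p..?m}" and part2: "part {?m..q} x c = {?m..q}"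
    using xc pq by (auto simp: image_subset_iff)
  interpret C: coord_curve "range_of c" "Gc c" "\<Gamma>c c" "{p..?m}" "cmap c \<circ> x"
    using smooth_curve.coord_curve_chart[OF sc1 cA] unfolding part1 .
  interpret K: coord_curve "range_of c" "Gc c" "\<Gamma>c c" "{?m..q}" "cmap c \<circ> x"
    using smooth_curve.coord_curve_chart[OF sc2 cA] unfolding part2 .
  have m1: "?m \<in> {p..?m}" and m2: "?m \<in> {?m..q}" using pq by auto
  have "velocity A {p..?m} x ?m = velocity A {?m..q} x ?m"
    using velocity_restrict[OF C1 acc_total _ acc(1) m1] velocity_restrict[OF C1 acc_total _ acc(2)
        m2] pq pqN by auto
  then have v: "C.v ?m = K.v ?m"
    using smooth_curve.velocity_v[OF sc1 cA, unfolded part1, OF m1]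
      smooth_curve.velocity_v[OF sc2 cA, unfolded part2, OF m2] by simp
  have "C.D C.v ?m = K.D K.v ?m"
    using acceleration_match[OF i c pqN(1) pq(2,3) pqN(2) sub xc]
      smooth_curve.curve_deriv_coords(1)[OF sc1 cA, unfolded part1, OF m1]
      smooth_curve.curve_deriv_coords(1)[OF sc2 cA, unfolded part2, OF m2] by simp
  then have a: "C.vd C.v ?m = K.vd K.v ?m" using v by (simp add: C.D_def K.D_def)
  let ?v = "\<lambda>t. if t \<le> ?m then C.v t else K.v t" and ?a = "\<lambda>t.
      if t \<le> ?m then C.vd C.v t else K.vd K.v t"
  have C2: "Ck_on (Suc (Suc 0)) {p..q} (cmap c \<circ> x)"
  proof (rule Ck_on_real_SucI)
    show "(cmap c \<circ> x has_vector_derivative ?v t) (at t within {p..q})" if "t \<in> {p..q}" for t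
      by (rule has_vector_derivative_join[OF pq(2,3) C.has_v K.has_v v that])
    show "Ck_on (Suc 0) {p..q} ?v"
    proof (rule Ck_on_real_SucI)
      have 1: "(?v has_vector_derivative C.vd C.v t) (at t within {p..?m})" if "t \<in> {p..?m}" for t
        using C.has_vd[OF C.smooth_v that] that unfolding has_vector_derivative_def
        by (rule has_derivative_transform[rotated 2]) (use that in auto)
      have 2: "(?v has_vector_derivative K.vd K.v t) (at t within {?m..q})" if "t \<in> {?m..q}" for t
        using K.has_vd[OF K.smooth_v that] unfolding has_vector_derivative_def
        by (rule has_derivative_transform[rotated 2]) (use that v in auto)
      show "(?v has_vector_derivative ?a t) (at t within {p..q})" if "t \<in> {p..q}" for t
        by (rule has_vector_derivative_join[OF pq(2,3) 1 2 a that])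
      have "continuous_on ({p..?m} \<union> {?m..q}) ?a"
      proof (rule continuous_on_cases)
        show "continuous_on {p..?m} (C.vd C.v)" "continuous_on {?m..q} (K.vd K.v)"
          using Ck_on_imp_continuous_on smooth_onD C.smooth_vd[OF C.smooth_v] K.smooth_vd[OF
              K.smooth_v] by blast+
      qed (use a in \<open>auto simp: order_antisym\<close>)
      moreover have "{p..?m} \<union> {?m..q} = {p..q}" using pq by auto
      ultimately show "Ck_on 0 {p..q} ?a" by simp
    qed
  qed
  have "Ck_on 2 ({0..T N} \<inter> {p<..<q}) (cmap c \<circ> x)"
    unfolding numeral_2_eq_2 by (rule Ck_on_subset[OF C2]) auto
  then show ?thesis using pq by (intro exI[of _ "{p<..<q}"]) auto
qed

theorem C2_extremal: "Ck_into A 2 {0..T N} x"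
  unfolding Ck_into_def
proof (intro conjI ballI cont_total)
  fix c assume c: "c \<in> A"
  show "Ck_on 2 (part {0..T N} x c) (cmap c \<circ> x)"
  proof (rule Ck_on_locally[OF axis_accessible_part[OF c cont_total acc_total]])
    fix t assume t: "t \<in> part {0..T N} x c"
    have smooth: "\<exists>W. open W \<and> t \<in> W \<and> Ck_on 2 (part {0..T N} x c \<inter> W) (cmap c \<circ> x)"
      if "i \<in> {1..N}" "open W" "t \<in> W" "{0..T N} \<inter> W \<subseteq> piece i" for i W
    proof -
      have "Ck_into A 2 (piece i) x"
        using adm that(1) smooth_into_D unfolding admissible_curve_def by blast
      from Ck_on_subset[OF Ck_into_D(2)[OF this c], of "part {0..T N} x c \<inter> W"]
      show ?thesis using that by (intro exI[of _ W]) auto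
    qed
    \<comment> \<open>The piece with \<open>T (i - 1) < t \<le> T i\<close>; only \<open>t = 0\<close> has \<open>i = 0\<close>.\<close>
    define i where "i = (LEAST i. t \<le> T i)"
    have iN: "i \<le> N" and ti: "t \<le> T i"
      unfolding i_def using t by (auto intro: Least_le LeastI)
    have less: "T l < t" if "l < i" for l
      using not_less_Least[OF that[unfolded i_def]] by simp
    show "\<exists>W. open W \<and> t \<in> W \<and> Ck_on 2 (part {0..T N} x c \<inter> W) (cmap c \<circ> x)"
    proof (cases "i = 0")
      case True
      then have "t = 0" using t ti T0 by auto
      then show ?thesis using piece[of 1] N T0 by (intro smooth[of 1 "{..<T 1}"]) auto
    next
      case False
      then have i: "i \<in> {1..N}" and tl: "T (i - 1) < t" using iN less[of "i - 1"] by auto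
      consider "t < T i" | "t = T i" "i = N" | "t = T i" "i < N" using ti iN by linarith
      then show ?thesis
      proof cases
        case 1
        then show ?thesis using i tl by (intro smooth[of i "{T (i - 1)<..<T i}"]) auto
      next
        case 2
        then show ?thesis using i tl by (intro smooth[of i "{T (i - 1)<..}"]) auto
      next
        case 3
        then have "c \<in> charts_at A (x (T i))" using c t by (auto simp: charts_at_iff)
        then obtain W where W: "open W" "T i \<in> W" "Ck_on 2 ({0..T N} \<inter> W) (cmap c \<circ> x)"
          using C2_at_breakpoint[of i c] i 3 by auto
        have "Ck_on 2 (part {0..T N} x c \<inter> W) (cmap c \<circ> x)"
          by (rule Ck_on_subset[OF W(3)]) auto
        then show ?thesis using W 3 by blast
      qed
    qed
  qed
qed

end

theorem theorem4p1:
  fixes A :: "('m::{t2_space,second_countable_topology}, 'e::euclidean_space) chart set"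
    and g :: "('m, 'e) metric"
    and nabla :: "('m, 'e) connection"
    and R :: "'m \<Rightarrow> ('m, 'e) tvec \<Rightarrow> ('m, 'e) tvec \<Rightarrow> ('m, 'e) tvec \<Rightarrow> ('m, 'e) tvec"
    and \<sigma> :: real
    and V :: "'m \<Rightarrow> real"
    and Obst :: "'m set"
    and N k :: nat
    and T :: "nat \<Rightarrow> real"
    and xs :: "nat \<Rightarrow> 'm"
    and v0 vN :: "('m, 'e) tvec"
    and D :: "'m \<Rightarrow> ('m, 'e) tvec set"
    and \<omega> :: "nat \<Rightarrow> 'm \<Rightarrow> ('m, 'e) tvec \<Rightarrow> real"
    and Y :: "nat \<Rightarrow> ('m, 'e) vfield"
    and S :: "nat \<Rightarrow> 'm \<Rightarrow> ('m, 'e) tvec \<Rightarrow> ('m, 'e) tvec"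
    and x :: "real \<Rightarrow> 'm"
  assumes "smooth_manifold A"
    and "riemannian_metric A g"
    and "levi_civita_connection A g nabla"
    and "curvature_tensor A nabla R"
    and "0 < \<sigma>"
    and "Ck_fun_on A 2 UNIV V"
    and "regular_submanifold A Obst"
    and "1 \<le> N"
    and "inj_on xs {..N}"
    and "\<And>i. i \<le> N \<Longrightarrow> xs i \<notin> Obst"
    and "T 0 = 0"
    and "strict_mono_on {..N} T"
    and "v0 \<in> tangent_space A (xs 0)"
    and "vN \<in> tangent_space A (xs N)"
    and "distribution A D"
    and "\<not> integrable_distribution A D"
    and "k < DIM('e)"
    and "\<And>j. j \<in> {1..k} \<Longrightarrow> one_form A (\<omega> j)"
    and "lin_indep_forms A k \<omega>"
    and "annihilator_spanned_by A D k \<omega>"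
    and "\<And>j. j \<in> {1..k} \<Longrightarrow> smooth_vfield_on A UNIV (Y j)"
    and "\<And>j p z. j \<in> {1..k} \<Longrightarrow> z \<in> tangent_space A p \<Longrightarrow> \<omega> j p z = g p (Y j p) z"
    and "\<And>j. j \<in> {1..k} \<Longrightarrow> ext_deriv_tensor A g (\<omega> j) (S j)"
    and "normal_extremum A g nabla \<sigma> V k Y N T xs v0 vN x"
  shows "Ck_into A 2 {0..T N} x \<and>
    (\<exists>lam :: nat \<Rightarrow> real \<Rightarrow> real. (\<forall>j\<in>{1..k}. smooth_on {0..T N} (lam j)) \<and>
      (\<forall>i\<in>{1..N}. \<forall>t\<in>{T (i - 1)..T i}.
         let I = {T (i - 1)..T i}; v = velocity A I x t; a = curve_deriv A nabla I x 2 t in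
           0 = curve_deriv A nabla I x 4 t + R (x t) a v v - \<sigma> *\<^sub>R a
             + (1 / 2) *\<^sub>R gradient A g V (x t)
             - (\<Sum>j=1..k. vector_derivative (lam j) (at t within {0..T N}) *\<^sub>R Y j (x t))
             - (\<Sum>j=1..k. lam j t *\<^sub>R S j (x t) v)) \<and>
      satisfies_constraints A g k Y (T N) x)"
proof -
  obtain \<mu> where \<mu>: "\<And>j. j \<in> {1..k} \<Longrightarrow> smooth_on {0..T N} (\<mu> j)"
    and stat: "\<And>e \<alpha>. admissible_variation A N T xs v0 vN x e \<alpha> \<Longrightarrow>
      ((\<lambda>r. extended_functional A g nabla \<sigma> V k Y (T N) \<mu> (\<alpha> r)) has_real_derivative 0) (at 0)"
    using assms(24) unfolding normal_extremum_def by blast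
  have adm: "admissible_curve A N T xs v0 vN x" and con: "satisfies_constraints A g k Y (T N) x"
    using assms(24) unfolding normal_extremum_def by blast+
  have "0 < T N" using strict_mono_onD[OF assms(12), of 0 N] assms(8,11) by simp
  interpret extremal A g nabla R \<sigma> V k \<omega> Y S N T \<mu> xs v0 vN x
    by unfold_locales (use assms \<mu> stat adm \<open>0 < T N\<close> in auto)
  define lam where "lam j t = \<mu> j t / 2" for j t
  have lam: "smooth_on {0..T N} (lam j)" if "j \<in> {1..k}" for j
    unfolding lam_def divide_inverse
    by (intro smooth_onI Ck_on_mult Ck_on_const smooth_onD[OF \<mu>[OF that]])
  have lam': "vector_derivative (lam j) (at t within {0..T N})
      = vector_derivative (\<mu> j) (at t within {0..T N}) / 2"
    if "j \<in> {1..k}" "t \<in> {0..T N}" for j t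
    unfolding lam_def
    by (intro vector_derivative_accessible[OF _ acc_total that(2)] has_vector_derivative_divide
        smooth_on_vector_derivative(1)[OF \<mu>[OF that(1)] acc_total that(2)])
  have EL: "let I = {T (i - 1)..T i}; v = velocity A I x t; a = curve_deriv A nabla I x 2 t in
      0 = curve_deriv A nabla I x 4 t + R (x t) a v v - \<sigma> *\<^sub>R a
        + (1 / 2) *\<^sub>R gradient A g V (x t)
        - (\<Sum>j=1..k. vector_derivative (lam j) (at t within {0..T N}) *\<^sub>R Y j (x t))
        - (\<Sum>j=1..k. lam j t *\<^sub>R S j (x t) v)"
    if i: "i \<in> {1..N}" and t: "t \<in> {T (i - 1)..T i}" for i t
  proof -
    have "t \<in> {0..T N}" using piece(4)[OF i] t by blast
    then have "(\<Sum>j=1..k. vector_derivative (lam j) (at t within {0..T N}) *\<^sub>R Y j (x t))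
      = (\<Sum>j=1..k. (vector_derivative (\<mu> j) (at t within {0..T N}) / 2) *\<^sub>R Y j (x t))"
      by (intro sum.cong refl) (simp only: lam')
    then show ?thesis
      using euler_lagrange_piece[OF i t] by (simp add: euler_lagrange_def Let_def lam_def)
  qed
  show ?thesis
    using C2_extremal lam EL con by blast
qed

end
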